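(* Let $\Omega=(0,1)\times(0,1)$. There exists a family of maps $\mathcal R_\varepsilon: L^2(\Omega)\times L^2(\Omega)\times L^1(0,1)\to L^2(\mathbb R^2)$, $0<\varepsilon<1$ (the maps do not depend on any exact solution or exact data), with the following property. Let $g_{0ex},g_{1ex}\in L^2(\Omega)$, let $\varphi_{ex}\in L^1(0,1)$ be such that there exist $\lambda\in(0,1)$ and $C_0>0$ with either $\varphi_{ex}(t)\ge C_0$ for a.e. $t\in(\lambda,1)$ or $\varphi_{ex}(t)\le -C_0$ for a.e. $t\in(\lambda,1)$, and let $u_{ex}\in C^1([0,1];L^2(\Omega))\cap L^2(0,1;H^2(\Omega))$, $f_{ex}\in L^2(\Omega)$ be such that $(u_{ex},f_{ex})$ solves the source problem with data $(\varphi_{ex},g_{0ex},g_{1ex})$ (defined in the context). For each $\varepsilon\in(0,1)$ let $g_{0\varepsilon},g_{1\varepsilon}\in L^2(\Omega)$ and $\varphi_\varepsilon\in L^1(0,1)$ satisfy $$\|g_{0\varepsilon}-g_{0ex}\|_{L^2(\Omega)}\le\varepsilon,\quad \|g_{1\varepsilon}-g_{1ex}\|_{L^2(\Omega)}\le\varepsilon,\quad \|\varphi_\varepsilon-\varphi_{ex}\|_{L^1(0,1)}\le\varepsilon,$$ and put $f_{2\varepsilon}=\mathcal R_\varepsilon(g_{0\varepsilon},g_{1\varepsilon},\varphi_\varepsilon)$. Then $$\lim_{\varepsilon\to0}\|f_{2\varepsilon}-f_{ex}\|_{L^2(\Omega)}=0.$$ Moreover, if $f_{ex}\in H^1(\Omega)$,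 then there exist $\gamma>0$, depending only on $\varphi_{ex}$, and $\varepsilon_0\in(0,1)$, depending only on $u_{ex}$ and $\varphi_{ex}$, such that for all $0<\varepsilon<\varepsilon_0$ $$\|f_{2\varepsilon}-f_{ex}\|_{L^2(\Omega)}^2\le 4\pi^{-1}\left(\|f_{ex}\|_{L^1(\Omega)}^2\,\varepsilon^{\gamma}+9\|f_{ex}\|_{H^1(\Omega)}^2\,\varepsilon^{1/6}\right).$$
   Context: Functions are real-valued. A pair $(u,f)$ with $u\in C^1([0,1];L^2(\Omega))\cap L^2(0,1;H^2(\Omega))$ and $f\in L^2(\Omega)$ solves the source problem with data $(\varphi,g_0,g_1)$ if $$u_t-\Delta u=\varphi(t)f(x,y)\quad\text{for } t\in(0,1),\ (x,y)\in\Omega,$$ $$u_x(0,y,t)=u_x(1,y,t)=u_y(x,0,t)=u_y(x,1,t)=0,\qquad u(1,y,t)=0$$ for $x,y,t\in(0,1)$, and $$u(x,y,0)=g_0(x,y),\qquad u(x,y,1)=g_1(x,y)\quad\text{in }\Omega.$$ Here the equation is understood in $L^2(\Omega)$ for a.e. $t$, and the boundary values in the sense of traces for a.e. $t$. The norm on $H^1(\Omega)$ is $\|w\|_{H^1(\Omega)}^2=\|w\|_{L^2(\Omega)}^2+\|\partial_xw\|_{L^2(\Omega)}^2+\|\partial_yw\|_{L^2(\Omega)}^2$. *)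

theory Defs
  imports "HOL-Analysis.Analysis"
begin

text \<open>
  Elements of Lebesgue and Sobolev spaces are represented by functions; equality of elements is
  equality almost everywhere with respect to \<^term>\<open>lebesgue_on S\<close>. Since the library integral of a
  non-integrable function is 0, the norms below are meaningful only on members of the
  corresponding spaces.
\<close>

definition L1_space :: "'a::euclidean_space set \<Rightarrow> ('a \<Rightarrow> real) set" where
  "L1_space S = {f. integrable (lebesgue_on S) f}"

definition L1_norm :: "'a::euclidean_space set \<Rightarrow> ('a \<Rightarrow> real) \<Rightarrow> real" where
  "L1_norm S f = (LINT x|lebesgue_on S. \<bar>f x\<bar>)"

definition L2_space :: "'a::euclidean_space set \<Rightarrow> ('a \<Rightarrow> real) set" where
  "L2_space S = {f \<in> borel_measurable (lebesgue_on S). integrable (lebesgue_on S) (\<lambda>x. (f x)\<^sup>2)}"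

definition L2_norm :: "'a::euclidean_space set \<Rightarrow> ('a \<Rightarrow> real) \<Rightarrow> real" where
  "L2_norm S f = sqrt (LINT x|lebesgue_on S. (f x)\<^sup>2)"

primrec C_k :: "nat \<Rightarrow> ('a::euclidean_space \<Rightarrow> real) \<Rightarrow> bool" where
  "C_k 0 f \<longleftrightarrow> continuous_on UNIV f"
| "C_k (Suc k) f \<longleftrightarrow> (\<forall>x. f differentiable at x) \<and>
     (\<forall>i\<in>Basis. C_k k (\<lambda>x. frechet_derivative f (at x) i))"

definition C_infinity :: "('a::euclidean_space \<Rightarrow> real) set" where
  "C_infinity = {f. \<forall>k. C_k k f}"

definition test_functions :: "'a::euclidean_space set \<Rightarrow> ('a \<Rightarrow> real) set" where
  "test_functions S =
     {\<psi> \<in> C_infinity. compact (closure {x. \<psi> x \<noteq> 0}) \<and> closure {x. \<psi> x \<noteq> 0} \<subseteq> S}"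

definition has_weak_partial ::
  "'a::euclidean_space set \<Rightarrow> 'a \<Rightarrow> ('a \<Rightarrow> real) \<Rightarrow> ('a \<Rightarrow> real) \<Rightarrow> bool" where
  "has_weak_partial S i v w \<longleftrightarrow> v \<in> L2_space S \<and> w \<in> L2_space S \<and>
     (\<forall>\<psi>\<in>test_functions S.
        (LINT x|lebesgue_on S. v x * frechet_derivative \<psi> (at x) i) =
        - (LINT x|lebesgue_on S. w x * \<psi> x))"

text \<open>
  A representative of the weak partial derivative in direction \<open>i\<close>. On an open set it is unique up
  to equality almost everywhere; it is arbitrary if no square-integrable weak derivative exists.
\<close>

definition weak_partial ::
  "'a::euclidean_space set \<Rightarrow> 'a \<Rightarrow> ('a \<Rightarrow> real) \<Rightarrow> ('a \<Rightarrow> real)" where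
  "weak_partial S i v = (SOME w. has_weak_partial S i v w)"

definition H1_space :: "'a::euclidean_space set \<Rightarrow> ('a \<Rightarrow> real) set" where
  "H1_space S = {v \<in> L2_space S. \<forall>i\<in>Basis. \<exists>w. has_weak_partial S i v w}"

definition H1_norm :: "'a::euclidean_space set \<Rightarrow> ('a \<Rightarrow> real) \<Rightarrow> real" where
  "H1_norm S v = sqrt ((L2_norm S v)\<^sup>2 + (\<Sum>i\<in>Basis. (L2_norm S (weak_partial S i v))\<^sup>2))"

definition H2_space :: "'a::euclidean_space set \<Rightarrow> ('a \<Rightarrow> real) set" where
  "H2_space S = {v \<in> H1_space S. \<forall>i\<in>Basis. weak_partial S i v \<in> H1_space S}"

text \<open>
  Summing first derivatives in the \<open>H1\<close> norm counts some derivatives more than once; the result is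
  equivalent to the usual norm summing over all multi-indices of order at most 2.
\<close>

definition H2_norm :: "'a::euclidean_space set \<Rightarrow> ('a \<Rightarrow> real) \<Rightarrow> real" where
  "H2_norm S v = sqrt ((L2_norm S v)\<^sup>2 + (\<Sum>i\<in>Basis. (H1_norm S (weak_partial S i v))\<^sup>2))"

definition weak_laplacian :: "'a::euclidean_space set \<Rightarrow> ('a \<Rightarrow> real) \<Rightarrow> ('a \<Rightarrow> real)" where
  "weak_laplacian S v = (\<lambda>x. \<Sum>i\<in>Basis. weak_partial S i (weak_partial S i v) x)"

text \<open>
  Membership in \<open>C\<^sup>1([0,1]; L\<^sup>2(S))\<close>, with derivative \<open>u'\<close> (one-sided at the end points).
\<close>

definition C1_in_L2 ::
  "'a::euclidean_space set \<Rightarrow> (real \<Rightarrow> 'a \<Rightarrow> real) \<Rightarrow> (real \<Rightarrow> 'a \<Rightarrow> real) \<Rightarrow> bool" where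
  "C1_in_L2 S u u' \<longleftrightarrow> (\<forall>t\<in>{0..1}. u t \<in> L2_space S \<and> u' t \<in> L2_space S \<and>
     ((\<lambda>s. L2_norm S (\<lambda>x. (u s x - u t x) / (s - t) - u' t x)) \<longlongrightarrow> 0) (at t within {0..1}) \<and>
     ((\<lambda>s. L2_norm S (\<lambda>x. u' s x - u' t x)) \<longlongrightarrow> 0) (at t within {0..1}))"

text \<open>
  Bochner space \<open>L\<^sup>2(0,1; H\<^sup>2(S))\<close>: strong measurability means being the almost everywhere limit of
  simple functions, in the norm of \<open>H\<^sup>2(S)\<close>. The set \<open>H\<^sup>2(S)\<close> is not a type of class \<open>banach\<close>, so the
  library's Bochner integral does not apply to it directly.
\<close>

definition L2_in_H2 :: "'a::euclidean_space set \<Rightarrow> (real \<Rightarrow> 'a \<Rightarrow> real) set" where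
  "L2_in_H2 S = {u.
     (AE t in lebesgue_on {0<..<1}. u t \<in> H2_space S) \<and>
     (\<exists>s. (\<forall>n. simple_function (lebesgue_on {0<..<1}) (s n) \<and> s n ` {0<..<1} \<subseteq> H2_space S) \<and>
        (AE t in lebesgue_on {0<..<1}. (\<lambda>n::nat. H2_norm S (\<lambda>x. s n t x - u t x)) \<longlonglongrightarrow> 0)) \<and>
     integrable (lebesgue_on {0<..<1}) (\<lambda>t. (H2_norm S (u t))\<^sup>2)}"

text \<open>
  Trace on a side \<open>\<gamma>\<close>, parametrised over the unit interval: the continuous extension to \<open>H\<^sup>1(S)\<close> of
  the restriction map for functions smooth up to the boundary.
\<close>

definition has_trace ::
  "'a::euclidean_space set \<Rightarrow> (real \<Rightarrow> 'a) \<Rightarrow> ('a \<Rightarrow> real) \<Rightarrow> (real \<Rightarrow> real) \<Rightarrow> bool" where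
  "has_trace S \<gamma> v h \<longleftrightarrow> v \<in> H1_space S \<and> h \<in> L2_space {0<..<1} \<and>
     (\<exists>p. (\<forall>n::nat. p n \<in> C_infinity) \<and>
        (\<lambda>n. H1_norm S (\<lambda>x. p n x - v x)) \<longlonglongrightarrow> 0 \<and>
        (\<lambda>n. L2_norm {0<..<1} (\<lambda>s. p n (\<gamma> s) - h s)) \<longlonglongrightarrow> 0)"

definition unit_square :: "(real \<times> real) set" where
  "unit_square = {0<..<1} \<times> {0<..<1}"

definition solves_source_problem ::
  "(real \<Rightarrow> real \<times> real \<Rightarrow> real) \<Rightarrow> (real \<times> real \<Rightarrow> real) \<Rightarrow>
   (real \<Rightarrow> real) \<Rightarrow> (real \<times> real \<Rightarrow> real) \<Rightarrow> (real \<times> real \<Rightarrow> real) \<Rightarrow> bool" where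
  "solves_source_problem u f \<phi> g0 g1 \<longleftrightarrow>
     f \<in> L2_space unit_square \<and> u \<in> L2_in_H2 unit_square \<and>
     (\<exists>u'. C1_in_L2 unit_square u u' \<and>
        (AE t in lebesgue_on {0<..<1}. AE z in lebesgue_on unit_square.
           u' t z - weak_laplacian unit_square (u t) z = \<phi> t * f z)) \<and>
     (AE t in lebesgue_on {0<..<1}.
        has_trace unit_square (\<lambda>y. (0, y)) (weak_partial unit_square (1, 0) (u t)) (\<lambda>_. 0) \<and>
        has_trace unit_square (\<lambda>y. (1, y)) (weak_partial unit_square (1, 0) (u t)) (\<lambda>_. 0) \<and>
        has_trace unit_square (\<lambda>x. (x, 0)) (weak_partial unit_square (0, 1) (u t)) (\<lambda>_. 0) \<and>
        has_trace unit_square (\<lambda>x. (x, 1)) (weak_partial unit_square (0, 1) (u t)) (\<lambda>_. 0) \<and>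
        has_trace unit_square (\<lambda>y. (1, y)) (u t) (\<lambda>_. 0)) \<and>
     (AE z in lebesgue_on unit_square. u 0 z = g0 z) \<and>
     (AE z in lebesgue_on unit_square. u 1 z = g1 z)"

definition nondegenerate_near_1 :: "(real \<Rightarrow> real) \<Rightarrow> bool" where
  "nondegenerate_near_1 \<phi> \<longleftrightarrow> (\<exists>\<tau>\<in>{0<..<1}. \<exists>C0>0.
     (AE t in lebesgue_on {\<tau><..<1}. \<phi> t \<ge> C0) \<or> (AE t in lebesgue_on {\<tau><..<1}. \<phi> t \<le> - C0))"

definition noisy_data ::
  "(real \<times> real \<Rightarrow> real) \<Rightarrow> (real \<times> real \<Rightarrow> real) \<Rightarrow> (real \<Rightarrow> real) \<Rightarrow>
   (real \<Rightarrow> real \<times> real \<Rightarrow> real) \<Rightarrow> (real \<Rightarrow> real \<times> real \<Rightarrow> real) \<Rightarrow> (real \<Rightarrow> real \<Rightarrow> real) \<Rightarrow> bool"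
  where
  "noisy_data g0 g1 \<phi> g0e g1e \<phi>e \<longleftrightarrow> (\<forall>\<epsilon>\<in>{0<..<1}.
     g0e \<epsilon> \<in> L2_space unit_square \<and> L2_norm unit_square (\<lambda>z. g0e \<epsilon> z - g0 z) \<le> \<epsilon> \<and>
     g1e \<epsilon> \<in> L2_space unit_square \<and> L2_norm unit_square (\<lambda>z. g1e \<epsilon> z - g1 z) \<le> \<epsilon> \<and>
     \<phi>e \<epsilon> \<in> L1_space {0<..<1} \<and> L1_norm {0<..<1} (\<lambda>t. \<phi>e \<epsilon> t - \<phi> t) \<le> \<epsilon>)"

text \<open>
  A map \<open>L\<^sup>2(\<Omega>) \<times> L\<^sup>2(\<Omega>) \<times> L\<^sup>1(0,1) \<rightarrow> L\<^sup>2(\<real>\<^sup>2)\<close>, given on representatives; the second conjunct says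
  that it is well defined on classes of almost everywhere equal functions.
\<close>

definition reconstruction_map ::
  "((real \<times> real \<Rightarrow> real) \<Rightarrow> (real \<times> real \<Rightarrow> real) \<Rightarrow> (real \<Rightarrow> real) \<Rightarrow> (real \<times> real \<Rightarrow> real)) \<Rightarrow> bool"
  where
  "reconstruction_map T \<longleftrightarrow>
     (\<forall>g0\<in>L2_space unit_square. \<forall>g1\<in>L2_space unit_square. \<forall>\<phi>\<in>L1_space {0<..<1}.
        T g0 g1 \<phi> \<in> L2_space UNIV) \<and>
     (\<forall>g0\<in>L2_space unit_square. \<forall>g1\<in>L2_space unit_square. \<forall>\<phi>\<in>L1_space {0<..<1}.
      \<forall>h0\<in>L2_space unit_square. \<forall>h1\<in>L2_space unit_square. \<forall>\<psi>\<in>L1_space {0<..<1}.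
        (AE z in lebesgue_on unit_square. g0 z = h0 z) \<longrightarrow>
        (AE z in lebesgue_on unit_square. g1 z = h1 z) \<longrightarrow>
        (AE t in lebesgue_on {0<..<1}. \<phi> t = \<psi> t) \<longrightarrow>
        (AE z in lebesgue. T g0 g1 \<phi> z = T h0 h1 \<psi> z))"

end

theory Submission
  imports Defs "HOL-Real_Asymp.Real_Asymp"
begin

text \<open>
  Testing the equation with \<open>cos (\<alpha> x) cos (n \<pi> y)\<close>, which is compatible with all five boundary
  conditions for every real \<open>\<alpha>\<close> because \<open>u\<close> and \<open>u\<^sub>x\<close> both vanish at \<open>x = 1\<close>, gives
  \<open>W(\<mu>) F(\<alpha>, n) = G\<^sub>1(\<alpha>, n) - exp(- \<mu>) G\<^sub>0(\<alpha>, n)\<close> for the cosine transforms of \<open>f\<close>, \<open>g1\<close>, \<open>g0\<close>,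
  where \<open>\<mu> = \<alpha>\<^sup>2 + n\<^sup>2 \<pi>\<^sup>2\<close> and \<open>W(\<mu>)\<close> is the integral of \<open>exp(- \<mu> (1 - t)) \<phi>(t)\<close>. For large \<open>\<mu>\<close> the
  weight concentrates at \<open>t = 1\<close>, where \<open>\<phi>\<close> is nondegenerate, so \<open>W(\<mu>)\<close> is at least of order
  \<open>1 / \<mu>\<close> and \<open>F\<close> is recovered stably there. The function \<open>\<alpha> \<mapsto> F(\<alpha>, n)\<close> is entire of exponential
  type, so its values at the Fourier frequencies \<open>k \<pi>\<close> are extrapolated from higher frequencies by a
  binomial formula with about \<open>log (1 / \<epsilon>)\<close> terms, at the price of a small negative power of \<open>\<epsilon>\<close>.
  Summing the cosine series up to a power of \<open>1 / \<epsilon>\<close> yields the reconstruction; it converges in \<open>L\<^sup>2\<close>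
  by Parseval, and at a power rate if \<open>f\<close> is in \<open>H\<^sup>1\<close>. Since \<open>f\<close> is determined by \<open>u\<close> and \<open>\<phi>\<close>, the
  constants may be absorbed into \<open>\<epsilon>\<^sub>0\<close>. The required bound is \<open>0\<close> for \<open>f = 0\<close>, so a reconstruction of
  small norm is replaced by \<open>0\<close>.
\<close>

section \<open>Smooth functions and cut-offs\<close>

text \<open>Away from t = 1 nothing controls \<phi>, so W(\<mu>) may vanish at low frequencies and
  cannot be divided by; hence the detour through high ones. One integer K = \<open>level e\<close>,
  about log2(1 / \<epsilon>) / 8, fixes both the order of extrapolation and the index range 0..2^K,
  and the constants follow one budget. By choice of K, \<epsilon> \<le> 256^(-K). The frequencies
  used are at most 32 * 4^K, so division by W, of order at least 1 / \<mu>, leaves errors of order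
  64^(-K). Extrapolation multiplies them by at most 8^K and itself errs by order 8^(-K); the
  frequency step 1 / 64 is chosen for this. Each coefficient is then off by order 8^(-K), and about
  4^K squares sum to order 16^(-K). The tail of an H1 function is of order 4^(-K), so the squared
  error is of order \<epsilon>^(1/4), with a constant depending on f. Passing to the exponent 1/8
  absorbs that constant for small \<epsilon>. Smallness of \<epsilon> must not depend on the noise,
  so the estimates are uniform over all noisy data of size \<epsilon>.\<close>

primrec smooth_upto :: "nat \<Rightarrow> (real \<Rightarrow> real) \<Rightarrow> bool" where
  "smooth_upto 0 f \<longleftrightarrow> continuous_on UNIV f"
| "smooth_upto (Suc k) f \<longleftrightarrow> (\<exists>f'. (\<forall>x. (f has_real_derivative f' x) (at x)) \<and> smooth_upto k f')"

text \<open>The planar class \<open>C_k\<close> speaks of Frechet derivatives. Factors of product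
  functions are handled in this one-dimensional form, where an existentially quantified derivative
  lets closure under sums and products go by plain induction; \<open>C_k_tensor\<close> transfers
  the result to the plane.\<close>

definition smooth_real :: "(real \<Rightarrow> real) \<Rightarrow> bool" where
  "smooth_real f \<longleftrightarrow> (\<forall>k. smooth_upto k f)"

lemma DERIV_everywhere_continuous_on:
  assumes "\<And>x. (f has_real_derivative f' x) (at x)"
  shows "continuous_on UNIV f"
  using assms by (meson DERIV_isCont continuous_at_imp_continuous_on)

lemma smooth_upto_imp_continuous: "smooth_upto k f \<Longrightarrow> continuous_on UNIV f"
  by (cases k) (auto intro: DERIV_everywhere_continuous_on)

lemma smooth_upto_Suc_lower: "smooth_upto (Suc k) f \<Longrightarrow> smooth_upto k f"
proof (induction k arbitrary: f)
  case 0
  then show ?case by (auto intro: DERIV_everywhere_continuous_on)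
next
  case (Suc k)
  then show ?case by (metis smooth_upto.simps(2))
qed

lemma smooth_upto_add:
  "smooth_upto k f \<Longrightarrow> smooth_upto k g \<Longrightarrow> smooth_upto k (\<lambda>x. f x + g x)"
proof (induction k arbitrary: f g)
  case 0
  then show ?case by (auto intro: continuous_intros)
next
  case (Suc k)
  then obtain f' g' where *: "\<And>x. (f has_real_derivative f' x) (at x)" "smooth_upto k f'"
      "\<And>x. (g has_real_derivative g' x) (at x)" "smooth_upto k g'"
    by auto
  have "\<forall>x. ((\<lambda>x. f x + g x) has_real_derivative f' x + g' x) (at x)"
    using * by (auto intro: DERIV_add)
  with Suc.IH[OF *(2,4)] show ?case by (auto intro!: exI[of _ "\<lambda>x. f' x + g' x"])
qed

lemma smooth_upto_mult:
  "smooth_upto k f \<Longrightarrow> smooth_upto k g \<Longrightarrow> smooth_upto k (\<lambda>x. f x * g x)"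
proof (induction k arbitrary: f g)
  case 0
  then show ?case by (auto intro: continuous_intros)
next
  case (Suc k)
  then obtain f' g' where *: "\<And>x. (f has_real_derivative f' x) (at x)" "smooth_upto k f'"
      "\<And>x. (g has_real_derivative g' x) (at x)" "smooth_upto k g'"
    by auto
  have 1: "\<forall>x. ((\<lambda>x. f x * g x) has_real_derivative f' x * g x + g' x * f x) (at x)"
    using * by (auto intro: DERIV_mult)
  have "smooth_upto k (\<lambda>x. f' x * g x + g' x * f x)"
    using Suc.IH Suc.prems * smooth_upto_Suc_lower by (intro smooth_upto_add) blast+
  with 1 show ?case by (auto intro!: exI[of _ "\<lambda>x. f' x * g x + g' x * f x"])
qed

lemma smooth_real_mult: "smooth_real f \<Longrightarrow> smooth_real g \<Longrightarrow> smooth_real (\<lambda>x. f x * g x)"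
  by (simp add: smooth_real_def smooth_upto_mult)

text \<open>Every member of a class closed under differentiation is smooth. Applied to families with
  free coefficients (affine, trigonometric, \<open>exp_recip\<close>), this replaces formulas for
  higher derivatives.\<close>

lemma smooth_real_coinduct:
  assumes "P f" and step: "\<And>f. P f \<Longrightarrow> \<exists>f'. (\<forall>x. (f has_real_derivative f' x) (at x)) \<and> P f'"
  shows "smooth_real f"
proof -
  have "smooth_upto k f" if "P f" for k f
    using that
  proof (induction k arbitrary: f)
    case 0
    then show ?case using step[of f] by (auto intro: DERIV_everywhere_continuous_on)
  next
    case (Suc k)
    then show ?case by (metis step smooth_upto.simps(2))
  qed
  then show ?thesis using assms(1) by (simp add: smooth_real_def)
qed

text \<open>\<open>smooth_upto\<close> may supply a different derivative for each order; uniqueness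
  of derivatives merges them into one function.\<close>

lemma smooth_real_obtain_deriv:
  assumes "smooth_real f"
  obtains f' where "\<And>x. (f has_real_derivative f' x) (at x)" "smooth_real f'"
proof -
  obtain f' where f': "\<And>x. (f has_real_derivative f' x) (at x)"
    using assms unfolding smooth_real_def by (metis smooth_upto.simps(2))
  have "smooth_upto k f'" for k
  proof -
    obtain f'' where "\<And>x. (f has_real_derivative f'' x) (at x)" "smooth_upto k f''"
      using assms unfolding smooth_real_def by (metis smooth_upto.simps(2))
    moreover from this f' have "f' = f''" by (blast intro: DERIV_unique)
    ultimately show ?thesis by simp
  qed
  with f' show ?thesis using that unfolding smooth_real_def by blast
qed

lemma smooth_real_continuous: "smooth_real f \<Longrightarrow> continuous_on S f"
  unfolding smooth_real_def using smooth_upto_imp_continuous continuous_on_subset by blast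

lemma smooth_real_linear: "smooth_real (\<lambda>x. A * x + B)"
proof (rule smooth_real_coinduct[of "\<lambda>f. \<exists>A B. f = (\<lambda>x. A * x + B)"])
  fix f :: "real \<Rightarrow> real" assume "\<exists>A B. f = (\<lambda>x. A * x + B)"
  then obtain A B where f: "f = (\<lambda>x. A * x + B)" by blast
  have "\<forall>x. (f has_real_derivative (0 * x + A)) (at x)"
    unfolding f by (auto intro!: derivative_eq_intros)
  then show "\<exists>f'. (\<forall>x. (f has_real_derivative f' x) (at x)) \<and> (\<exists>A B. f' = (\<lambda>x. A * x + B))"
    by (intro exI[of _ "\<lambda>x. 0 * x + A"]) blast
qed blast

lemma smooth_real_trig: "smooth_real (\<lambda>x. A * cos (c * x) + B * sin (c * x))"
proof (rule smooth_real_coinduct[of "\<lambda>f. \<exists>A B. f = (\<lambda>x. A * cos (c * x) + B * sin (c * x))"])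
  fix f :: "real \<Rightarrow> real" assume "\<exists>A B. f = (\<lambda>x. A * cos (c * x) + B * sin (c * x))"
  then obtain A B where f: "f = (\<lambda>x. A * cos (c * x) + B * sin (c * x))" by blast
  have "\<forall>x. (f has_real_derivative ((B * c) * cos (c * x) + (- A * c) * sin (c * x))) (at x)"
    unfolding f by (auto intro!: derivative_eq_intros simp: algebra_simps)
  then show "\<exists>f'. (\<forall>x. (f has_real_derivative f' x) (at x)) \<and>
      (\<exists>A B. f' = (\<lambda>x. A * cos (c * x) + B * sin (c * x)))"
    by (intro exI[of _ "\<lambda>x. (B * c) * cos (c * x) + (- A * c) * sin (c * x)"]) blast
qed blast

lemma smooth_real_cos: "smooth_real (\<lambda>x. cos (c * x))"
  using smooth_real_trig[of 1 c 0] by simp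

lemma smooth_real_sin: "smooth_real (\<lambda>x. sin (c * x))"
  using smooth_real_trig[of 0 c 1] by simp

lemma smooth_real_const_mult: "smooth_real f \<Longrightarrow> smooth_real (\<lambda>x. c * f x)"
  using smooth_real_mult[OF smooth_real_linear[of 0 c]] by simp

section \<open>Functions flat at the origin, and cut-offs on the unit interval\<close>

definition exp_recip :: "real poly \<Rightarrow> real \<Rightarrow> real" where
  "exp_recip p y = (if y > 0 then poly p (1 / y) * exp (- (1 / y)) else 0)"

lemma tendsto_poly_exp_at_top: "((\<lambda>x. poly p x * exp (- x)) \<longlongrightarrow> (0::real)) at_top"
proof -
  have "((\<lambda>x. \<Sum>i\<le>degree p. coeff p i * (x ^ i / exp x)) \<longlongrightarrow> (\<Sum>i\<le>degree p. coeff p i * 0)) at_top"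
    by (intro tendsto_sum tendsto_mult tendsto_const tendsto_power_div_exp_0)
  then show ?thesis
    by (simp add: poly_altdef sum_distrib_right exp_minus divide_inverse mult.assoc)
qed

text \<open>With s = 1 / y, the derivative of p(s) exp(-s) in y is s^2 (p - p')(s) exp(-s), again a
  polynomial in s times exp(-s); carrying the polynomial as a parameter closes the family under
  differentiation. At y = 0 the difference quotient from the right is s p(s) exp(-s), which tends to
  0 as s grows.\<close>

lemma exp_recip_deriv:
  "(exp_recip p has_real_derivative exp_recip ([:0,0,1:] * (p - pderiv p)) y) (at y)"
proof -
  consider "y > 0" | "y < 0" | "y = 0" by linarith
  then show ?thesis
  proof cases
    case 1
    have "((\<lambda>y. poly p (1 / y) * exp (- (1 / y))) has_real_derivative
        exp_recip ([:0,0,1:] * (p - pderiv p)) y) (at y)"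
      using 1 unfolding exp_recip_def
      by (auto intro!: derivative_eq_intros DERIV_chain2[OF poly_DERIV]
          simp: field_simps power2_eq_square)
    then show ?thesis
    proof (rule has_field_derivative_transform_within_open[of _ _ _ "{0<..}"])
    qed (use 1 in \<open>auto simp: exp_recip_def\<close>)
  next
    case 2
    have "((\<lambda>y. 0) has_real_derivative exp_recip ([:0,0,1:] * (p - pderiv p)) y) (at y)"
      using 2 unfolding exp_recip_def by auto
    then show ?thesis
    proof (rule has_field_derivative_transform_within_open[of _ _ _ "{..<0}"])
    qed (use 2 in \<open>auto simp: exp_recip_def\<close>)
  next
    case 3
    have "((\<lambda>h. exp_recip p h / h) \<longlongrightarrow> 0) (at_right 0)"
    proof -
      have "((\<lambda>h. poly (pCons 0 p) (inverse h) * exp (- inverse h)) \<longlongrightarrow> 0) (at_right 0)"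
        by (rule filterlim_compose[OF tendsto_poly_exp_at_top filterlim_inverse_at_top_right])
      then show ?thesis
      proof (rule Lim_transform_eventually)
        show "\<forall>\<^sub>F h in at_right 0. poly (pCons 0 p) (inverse h) * exp (- inverse h) = exp_recip p h / h"
          using eventually_at_right_less[of 0]
          by eventually_elim (simp add: exp_recip_def field_simps)
      qed
    qed
    moreover have "((\<lambda>h. exp_recip p h / h) \<longlongrightarrow> 0) (at_left 0)"
    proof (rule Lim_transform_eventually[OF tendsto_const])
      show "\<forall>\<^sub>F h in at_left 0. 0 = exp_recip p h / h"
        unfolding eventually_at_filter by (rule eventuallyI) (simp add: exp_recip_def)
    qed
    ultimately have "((\<lambda>h. exp_recip p h / h) \<longlongrightarrow> 0) (at 0)"
      by (simp add: filterlim_split_at)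
    with 3 show ?thesis by (simp add: DERIV_def exp_recip_def)
  qed
qed

lemma smooth_real_exp_recip_affine: "smooth_real (\<lambda>x. exp_recip p (c * x + d))"
proof -
  \<comment> \<open>The scalar A collects the factors c that the chain rule produces.\<close>
  let ?P = "\<lambda>f. \<exists>A p. f = (\<lambda>x. A * exp_recip p (c * x + d))"
  have "smooth_real (\<lambda>x. 1 * exp_recip p (c * x + d))"
  proof (rule smooth_real_coinduct[of ?P])
    fix f assume "?P f"
    then obtain A p where f: "f = (\<lambda>x. A * exp_recip p (c * x + d))" by blast
    define q where "q = [:0,0,1:] * (p - pderiv p)"
    have "((\<lambda>x. A * exp_recip p (c * x + d)) has_real_derivative
        (A * (exp_recip q (c * x + d) * c))) (at x)" for x
      unfolding q_def
      by (rule DERIV_cmult, rule DERIV_chain2[OF exp_recip_deriv]) (auto intro!: derivative_eq_intros)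
    then have "\<forall>x. (f has_real_derivative (A * c) * exp_recip q (c * x + d)) (at x)"
      unfolding f by (simp add: mult_ac)
    then show "\<exists>f'. (\<forall>x. (f has_real_derivative f' x) (at x)) \<and> ?P f'"
      by (intro exI[of _ "\<lambda>x. (A * c) * exp_recip q (c * x + d)"]) blast
  qed blast
  then show ?thesis by simp
qed

text \<open>For j > 0 this vanishes outside the interval from 1 / j to 1 - 1 / j, and it tends to 1
  at each interior point without ever being equal to 1. Limits are taken by dominated convergence,
  for which pointwise convergence and a bound suffice.\<close>

definition cutoff :: "nat \<Rightarrow> real \<Rightarrow> real" where
  "cutoff j x = exp_recip 1 (real j * x - 1) * exp_recip 1 (real j * (1 - x) - 1)"

definition cutoff' :: "nat \<Rightarrow> real \<Rightarrow> real" where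
  "cutoff' j x = real j * exp_recip [:0,0,1:] (real j * x - 1) * exp_recip 1 (real j * (1 - x) - 1)
     - real j * exp_recip [:0,0,1:] (real j * (1 - x) - 1) * exp_recip 1 (real j * x - 1)"

lemma exp_recip_1_bounds: "0 \<le> exp_recip 1 y" "exp_recip 1 y \<le> 1"
  by (auto simp: exp_recip_def)

lemma cutoff_bounds: "0 \<le> cutoff j x" "cutoff j x \<le> 1"
  unfolding cutoff_def using exp_recip_1_bounds by (auto intro: mult_le_one)

lemma cutoff_nonzeroD: "cutoff j x \<noteq> 0 \<Longrightarrow> 1 < real j * x \<and> 1 < real j * (1 - x)"
  by (auto simp: cutoff_def exp_recip_def split: if_splits)

lemma smooth_cutoff: "smooth_real (cutoff j)"
proof -
  have "smooth_real (\<lambda>x. exp_recip 1 (real j * x + (-1)) * exp_recip 1 ((- real j) * x + (real j - 1)))"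
    by (intro smooth_real_mult smooth_real_exp_recip_affine)
  moreover have "cutoff j = (\<lambda>x. exp_recip 1 (real j * x + (-1)) * exp_recip 1 ((- real j) * x + (real j - 1)))"
    by (auto simp: cutoff_def algebra_simps)
  ultimately show ?thesis by simp
qed

lemma DERIV_cutoff: "(cutoff j has_real_derivative cutoff' j x) (at x)"
proof -
  have d: "(exp_recip 1 has_real_derivative exp_recip [:0,0,1:] y) (at y)" for y
    using exp_recip_deriv[of 1 y] by simp
  have "((\<lambda>x. exp_recip 1 (real j * x - 1)) has_real_derivative
      exp_recip [:0,0,1:] (real j * x - 1) * real j) (at x)"
    by (rule DERIV_chain2[OF d]) (auto intro!: derivative_eq_intros)
  moreover have "((\<lambda>x. exp_recip 1 (real j * (1 - x) - 1)) has_real_derivative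
      exp_recip [:0,0,1:] (real j * (1 - x) - 1) * (- real j)) (at x)"
    by (rule DERIV_chain2[OF d]) (auto intro!: derivative_eq_intros)
  ultimately have "((\<lambda>x. exp_recip 1 (real j * x - 1) * exp_recip 1 (real j * (1 - x) - 1))
      has_real_derivative cutoff' j x) (at x)"
    unfolding cutoff'_def by (auto intro!: derivative_eq_intros simp: algebra_simps)
  then show ?thesis by (simp add: cutoff_def[abs_def])
qed

lemma filterlim_affine_at_top: "0 < x \<Longrightarrow> filterlim (\<lambda>j::nat. real j * x - 1) at_top sequentially"
  by real_asymp

lemma exp_recip_1_tendsto: "0 < x \<Longrightarrow> (\<lambda>j::nat. exp_recip 1 (real j * x - 1)) \<longlonglongrightarrow> 1"
proof -
  assume x: "0 < x"
  have "(\<lambda>j::nat. exp (- (1 / (real j * x - 1)))) \<longlonglongrightarrow> 1"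
    using x by real_asymp
  moreover have "\<forall>\<^sub>F j in sequentially. real j * x - 1 > 0"
    using filterlim_affine_at_top[OF x] unfolding filterlim_at_top_dense by blast
  then have "\<forall>\<^sub>F j in sequentially. exp (- (1 / (real j * x - 1))) = exp_recip 1 (real j * x - 1)"
    by eventually_elim (simp add: exp_recip_def)
  ultimately show ?thesis by (rule Lim_transform_eventually)
qed

lemma cutoff_tendsto: "0 < x \<Longrightarrow> x < 1 \<Longrightarrow> (\<lambda>j. cutoff j x) \<longlonglongrightarrow> 1"
  unfolding cutoff_def
  using tendsto_mult[OF exp_recip_1_tendsto[of x] exp_recip_1_tendsto[of "1 - x"]] by simp

lemma exp_recip_2_tendsto:
  "0 < x \<Longrightarrow> (\<lambda>j::nat. real j * exp_recip [:0,0,1:] (real j * x - 1)) \<longlonglongrightarrow> 0"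
proof -
  assume x: "0 < x"
  have "(\<lambda>j::nat. real j * ((1 / (real j * x - 1))\<^sup>2 * exp (- (1 / (real j * x - 1))))) \<longlonglongrightarrow> 0"
    using x by real_asymp
  moreover have "\<forall>\<^sub>F j in sequentially. real j * x - 1 > 0"
    using filterlim_affine_at_top[OF x] unfolding filterlim_at_top_dense by blast
  then have "\<forall>\<^sub>F j in sequentially. real j * ((1 / (real j * x - 1))\<^sup>2 * exp (- (1 / (real j * x - 1))))
      = real j * exp_recip [:0,0,1:] (real j * x - 1)"
    by eventually_elim (simp add: exp_recip_def power2_eq_square)
  ultimately show ?thesis by (rule Lim_transform_eventually)
qed

lemma cutoff'_tendsto: "0 < x \<Longrightarrow> x < 1 \<Longrightarrow> (\<lambda>j. cutoff' j x) \<longlonglongrightarrow> 0"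
  unfolding cutoff'_def
  using tendsto_diff[OF
      tendsto_mult[OF exp_recip_2_tendsto[of x] exp_recip_1_tendsto[of "1 - x"]]
      tendsto_mult[OF exp_recip_2_tendsto[of "1 - x"] exp_recip_1_tendsto[of x]]]
  by simp

text \<open>The derivative of a cut-off grows like j near an end point. Where the factor is nonzero,
  s = 1 / (j x - 1) gives j x = 1 + 1 / s, so x times the factor is (s^2 + s) exp(-s), bounded
  independently of j: a linear zero at the end point compensates the growth.\<close>

lemma exp_recip_2_bound:
  assumes "0 \<le> x"
  shows "x * (real j * exp_recip [:0,0,1:] (real j * x - 1)) \<le> 3"
    and "0 \<le> real j * exp_recip [:0,0,1:] (real j * x - 1)"
proof -
  show "0 \<le> real j * exp_recip [:0,0,1:] (real j * x - 1)"
    by (simp add: exp_recip_def)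
  show "x * (real j * exp_recip [:0,0,1:] (real j * x - 1)) \<le> 3"
  proof (cases "real j * x - 1 > 0")
    case True
    define s where "s = 1 / (real j * x - 1)"
    have s: "s > 0" using True by (simp add: s_def)
    have x: "real j * x = 1 + 1 / s" by (simp add: s_def)
    have e: "1 + s + s\<^sup>2 / 2 \<le> exp s"
      using exp_lower_Taylor_quadratic[of s] s by simp
    have "(1 + 1 / s) * (s\<^sup>2 * exp (- s)) \<le> 3"
    proof -
      have "(1 + 1 / s) * s\<^sup>2 = s\<^sup>2 + s" using s by (simp add: field_simps power2_eq_square)
      also have "\<dots> \<le> 3 * exp s" using e s by (smt (verit) zero_le_power2 field_sum_of_halves)
      finally have "(1 + 1 / s) * s\<^sup>2 \<le> 3 * exp s" .
      then show ?thesis by (simp add: exp_minus field_simps)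
    qed
    moreover have "x * (real j * exp_recip [:0,0,1:] (real j * x - 1)) = (real j * x) * (s\<^sup>2 * exp (- s))"
      using True by (simp add: exp_recip_def s_def power2_eq_square)
    ultimately show ?thesis by (simp only: x)
  next
    case False
    then show ?thesis by (simp add: exp_recip_def)
  qed
qed

text \<open>The two summands of \<open>cutoff'\<close> become large at opposite ends; a factor
  vanishing linearly at both ends tames each of them. This supplies the dominating function in
  \<open>interior_Green\<close>.\<close>

lemma cutoff'_bound:
  assumes "0 \<le> x" "x \<le> 1" "\<bar>a\<bar> \<le> L * x" "\<bar>a\<bar> \<le> L * (1 - x)" "0 \<le> L"
  shows "\<bar>a * cutoff' j x\<bar> \<le> 6 * L"
proof -
  have aux: "\<bar>a * (d * e)\<bar> \<le> 3 * L" if "\<bar>a\<bar> \<le> L * y" "y * d \<le> 3" "0 \<le> d" "0 \<le> e" "e \<le> 1" for y d e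
  proof -
    have "\<bar>a * (d * e)\<bar> = \<bar>a\<bar> * d * e" using that by (simp add: abs_mult)
    also have "\<dots> \<le> \<bar>a\<bar> * d * 1" using that by (intro mult_left_mono) auto
    also have "\<dots> \<le> L * y * d" using that by (simp add: mult_right_mono)
    also have "\<dots> \<le> L * 3" using that assms(5) by (simp add: mult.assoc mult_left_mono)
    finally show ?thesis by simp
  qed
  have "\<bar>a * (real j * exp_recip [:0,0,1:] (real j * x - 1) * exp_recip 1 (real j * (1 - x) - 1))\<bar> \<le> 3 * L"
    using assms exp_recip_2_bound exp_recip_1_bounds by (intro aux[of x]) auto
  moreover have "\<bar>a * (real j * exp_recip [:0,0,1:] (real j * (1 - x) - 1) * exp_recip 1 (real j * x - 1))\<bar> \<le> 3 * L"
    using assms exp_recip_2_bound[of "1 - x"] exp_recip_1_bounds by (intro aux[of "1 - x"]) auto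
  ultimately show ?thesis unfolding cutoff'_def by (simp add: right_diff_distrib)
qed

section \<open>Tensor products as test functions\<close>

definition tensor :: "(real \<Rightarrow> real) \<Rightarrow> (real \<Rightarrow> real) \<Rightarrow> real \<times> real \<Rightarrow> real" where
  "tensor a b z = a (fst z) * b (snd z)"

lemma Basis_plane: "(Basis :: (real \<times> real) set) = {(1,0), (0,1)}"
  by (auto simp: Basis_prod_def)

lemma tensor_has_derivative:
  assumes "(a has_real_derivative a') (at (fst z))" "(b has_real_derivative b') (at (snd z))"
  shows "(tensor a b has_derivative (\<lambda>h. a' * fst h * b (snd z) + a (fst z) * (b' * snd h))) (at z)"
proof -
  have 1: "((\<lambda>z. a (fst z)) has_derivative (\<lambda>h. a' * fst h)) (at z)"
    using has_derivative_compose[OF has_derivative_fst[OF has_derivative_ident]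
        has_field_derivative_imp_has_derivative[OF assms(1)]]
    by (simp add: mult.commute)
  have 2: "((\<lambda>z. b (snd z)) has_derivative (\<lambda>h. b' * snd h)) (at z)"
    using has_derivative_compose[OF has_derivative_snd[OF has_derivative_ident]
        has_field_derivative_imp_has_derivative[OF assms(2)]]
    by (simp add: mult.commute)
  show ?thesis
    unfolding tensor_def[abs_def] by (rule derivative_eq_intros 1 2 ext)+ simp
qed

lemma frechet_derivative_tensor:
  assumes "\<And>x. (a has_real_derivative a' x) (at x)" "\<And>x. (b has_real_derivative b' x) (at x)"
  shows "frechet_derivative (tensor a b) (at z) (1, 0) = tensor a' b z"
    and "frechet_derivative (tensor a b) (at z) (0, 1) = tensor a b' z"
  unfolding frechet_derivative_at[OF tensor_has_derivative[OF assms(1) assms(2), of z], symmetric]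
  by (simp_all add: tensor_def)

lemma C_k_tensor: "smooth_upto k a \<Longrightarrow> smooth_upto k b \<Longrightarrow> C_k k (tensor a b)"
proof (induction k arbitrary: a b)
  case 0
  have "continuous_on UNIV (\<lambda>z. a (fst z))" "continuous_on UNIV (\<lambda>z. b (snd z))"
    using 0 by (auto intro!: continuous_on_compose2[of UNIV a UNIV fst] continuous_on_compose2[of UNIV b UNIV snd]
        continuous_on_fst continuous_on_snd continuous_on_id)
  then show ?case by (auto simp: tensor_def[abs_def] intro: continuous_intros)
next
  case (Suc k)
  then obtain a' b' where *: "\<And>x. (a has_real_derivative a' x) (at x)" "smooth_upto k a'"
      "\<And>x. (b has_real_derivative b' x) (at x)" "smooth_upto k b'"
    by auto
  have "tensor a b differentiable at z" for z
    using tensor_has_derivative[OF *(1,3)] unfolding differentiable_def by blast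
  moreover have "C_k k (\<lambda>z. frechet_derivative (tensor a b) (at z) i)" if "i \<in> Basis" for i
    using that Suc.IH * Suc.prems[THEN smooth_upto_Suc_lower]
    by (auto simp: Basis_plane frechet_derivative_tensor[OF *(1,3)])
  ultimately show ?case by simp
qed

text \<open>The factor \<open>a\<close> acts in the direction \<open>i\<close>, meant to be a basis vector.\<close>

definition dtensor :: "real \<times> real \<Rightarrow> (real \<Rightarrow> real) \<Rightarrow> (real \<Rightarrow> real) \<Rightarrow> real \<times> real \<Rightarrow> real" where
  "dtensor i a b = (if i = (1, 0) then tensor a b else tensor b a)"

definition along :: "real \<times> real \<Rightarrow> real \<times> real \<Rightarrow> real" where
  "along i z = (if i = (1, 0) then fst z else snd z)"

definition across :: "real \<times> real \<Rightarrow> real \<times> real \<Rightarrow> real" where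
  "across i z = (if i = (1, 0) then snd z else fst z)"

lemma dtensor_apply: "dtensor i a b z = a (along i z) * b (across i z)"
  by (simp add: dtensor_def tensor_def along_def across_def)

lemma frechet_derivative_dtensor:
  assumes "i \<in> Basis" "\<And>x. (a has_real_derivative a' x) (at x)" "\<And>x. (b has_real_derivative b' x) (at x)"
  shows "frechet_derivative (dtensor i a b) (at z) i = dtensor i a' b z"
  using assms(1) frechet_derivative_tensor(1)[OF assms(2,3), of z] frechet_derivative_tensor(2)[OF assms(3,2), of z]
  unfolding Basis_plane dtensor_def by fastforce

lemma tensor_C_infinity: "smooth_real a \<Longrightarrow> smooth_real b \<Longrightarrow> tensor a b \<in> C_infinity"
  by (simp add: C_infinity_def smooth_real_def C_k_tensor)

lemma dtensor_C_infinity: "smooth_real a \<Longrightarrow> smooth_real b \<Longrightarrow> dtensor i a b \<in> C_infinity"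
  by (simp add: dtensor_def tensor_C_infinity)

lemma tensor_cutoff_test_function:
  assumes "smooth_real a" "smooth_real b"
  shows "tensor (\<lambda>x. a x * cutoff j x) (\<lambda>y. b y * cutoff j y) \<in> test_functions unit_square"
proof -
  let ?\<psi> = "tensor (\<lambda>x. a x * cutoff j x) (\<lambda>y. b y * cutoff j y)"
  define K where "K = cbox (1 / real j, 1 / real j) (1 - 1 / real j, 1 - 1 / real j)"
  have j: "j > 0" if "?\<psi> z \<noteq> 0" for z
    using that cutoff_nonzeroD[of j "fst z"] by (cases "j = 0") (auto simp: tensor_def)
  have supp: "{z. ?\<psi> z \<noteq> 0} \<subseteq> K"
  proof
    fix z assume "z \<in> {z. ?\<psi> z \<noteq> 0}"
    then have "?\<psi> z \<noteq> 0" by simp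
    then have "j > 0" "cutoff j (fst z) \<noteq> 0" "cutoff j (snd z) \<noteq> 0"
      using j by (auto simp: tensor_def)
    then have "0 < real j" "1 < real j * fst z \<and> 1 < real j * (1 - fst z)"
      "1 < real j * snd z \<and> 1 < real j * (1 - snd z)" using cutoff_nonzeroD by auto
    then show "z \<in> K" unfolding K_def
      by (cases z) (auto simp: cbox_Pair_eq field_simps)
  qed
  have cl: "closure {z. ?\<psi> z \<noteq> 0} \<subseteq> K"
    using supp unfolding K_def by (rule closure_minimal) (rule closed_cbox)
  \<comment> \<open>For j = 0 the box \<open>K\<close> is the whole closed square, as 1 / 0 = 0, but
    then the function vanishes identically; hence the case distinction.\<close>
  have "closure {z. ?\<psi> z \<noteq> 0} \<subseteq> unit_square"
  proof (cases "{z. ?\<psi> z \<noteq> 0} = {}")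
    case False
    then have "j > 0" using j by auto
    then have "1 / real j > 0" by simp
    then have "0 < x \<and> x < 1" if "1 / real j \<le> x" "x \<le> 1 - 1 / real j" for x
      using that by linarith
    then have "K \<subseteq> unit_square"
      unfolding K_def unit_square_def
      by (auto simp: cbox_Pair_eq)
    with cl show ?thesis by blast
  qed (simp only: closure_empty empty_subsetI)
  moreover have "compact (closure {z. ?\<psi> z \<noteq> 0})"
    using cl unfolding K_def by (meson bounded_cbox bounded_subset closed_closure compact_eq_bounded_closed)
  moreover have "?\<psi> \<in> C_infinity"
    by (intro tensor_C_infinity smooth_real_mult assms smooth_cutoff)
  ultimately show ?thesis by (simp add: test_functions_def)
qed

lemma dtensor_cutoff_test_function:
  "smooth_real a \<Longrightarrow> smooth_real b \<Longrightarrow>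
    dtensor i (\<lambda>x. a x * cutoff j x) (\<lambda>y. b y * cutoff j y) \<in> test_functions unit_square"
  by (simp add: dtensor_def tensor_cutoff_test_function)

section \<open>Square-integrable functions\<close>

lemmas LINT_cong = Bochner_Integration.integral_cong

lemma L2_spaceD:
  assumes "f \<in> L2_space S"
  shows "f \<in> borel_measurable (lebesgue_on S)" "integrable (lebesgue_on S) (\<lambda>x. (f x)\<^sup>2)"
  using assms by (auto simp: L2_space_def)

lemma abs_mult_le_sum_squares: "\<bar>x * y\<bar> \<le> x\<^sup>2 + (y::real)\<^sup>2"
proof -
  have "2 * (\<bar>x\<bar> * \<bar>y\<bar>) \<le> \<bar>x\<bar>\<^sup>2 + \<bar>y\<bar>\<^sup>2"
    using sum_squares_bound[of "\<bar>x\<bar>" "\<bar>y\<bar>"] by (simp add: mult.assoc)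
  moreover have "0 \<le> \<bar>x\<bar> * \<bar>y\<bar>" by simp
  ultimately have "\<bar>x\<bar> * \<bar>y\<bar> \<le> \<bar>x\<bar>\<^sup>2 + \<bar>y\<bar>\<^sup>2" by linarith
  then show ?thesis by (simp add: abs_mult)
qed

lemma L2_mult_integrable:
  assumes "f \<in> L2_space S" "g \<in> L2_space S"
  shows "integrable (lebesgue_on S) (\<lambda>x. f x * g x)"
proof (rule Bochner_Integration.integrable_bound)
  show "integrable (lebesgue_on S) (\<lambda>x. (f x)\<^sup>2 + (g x)\<^sup>2)"
    using assms by (auto dest: L2_spaceD)
  show "(\<lambda>x. f x * g x) \<in> borel_measurable (lebesgue_on S)"
    using assms by (auto simp: L2_space_def)
qed (auto simp: abs_mult_le_sum_squares[simplified] intro!: AE_I2)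

lemma L2_const:
  assumes "S \<in> lmeasurable"
  shows "(\<lambda>_. c) \<in> L2_space S"
proof -
  interpret finite_measure "lebesgue_on S" by (rule finite_measure_lebesgue_on[OF assms])
  show ?thesis by (simp add: L2_space_def)
qed

lemma L2_integrable:
  assumes "S \<in> lmeasurable" "f \<in> L2_space S"
  shows "integrable (lebesgue_on S) f"
  using L2_mult_integrable[OF assms(2) L2_const[OF assms(1), of 1]] by simp

lemma L2_add:
  assumes "f \<in> L2_space S" "g \<in> L2_space S"
  shows "(\<lambda>x. f x + g x) \<in> L2_space S"
proof -
  have "integrable (lebesgue_on S) (\<lambda>x. (f x)\<^sup>2 + (g x)\<^sup>2 + 2 * (f x * g x))"
    using assms[unfolded L2_space_def] L2_mult_integrable[OF assms] by simp
  then show ?thesis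
    using assms by (auto simp: L2_space_def power2_sum algebra_simps)
qed

lemma L2_cmult: "f \<in> L2_space S \<Longrightarrow> (\<lambda>x. c * f x) \<in> L2_space S"
  by (auto simp: L2_space_def power_mult_distrib)

lemma L2_diff: "f \<in> L2_space S \<Longrightarrow> g \<in> L2_space S \<Longrightarrow> (\<lambda>x. f x - g x) \<in> L2_space S"
  using L2_add[of f S "\<lambda>x. (-1) * g x"] L2_cmult[of g S "-1"] by simp

lemma L2_zero: "(\<lambda>_. 0) \<in> L2_space S"
  by (simp add: L2_space_def)

lemma L2_sum:
  assumes "\<And>i. i \<in> I \<Longrightarrow> f i \<in> L2_space S"
  shows "(\<lambda>x. \<Sum>i\<in>I. f i x) \<in> L2_space S"
  using assms
  by (induction I rule: infinite_finite_induct) (auto simp: L2_zero intro: L2_add)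

lemma L2_bounded:
  assumes "S \<in> lmeasurable" "f \<in> borel_measurable (lebesgue_on S)" "\<And>x. x \<in> S \<Longrightarrow> \<bar>f x\<bar> \<le> B"
  shows "f \<in> L2_space S"
proof -
  interpret finite_measure "lebesgue_on S" by (rule finite_measure_lebesgue_on[OF assms(1)])
  have "integrable (lebesgue_on S) (\<lambda>x. (f x)\<^sup>2)"
  proof (rule integrable_const_bound[of _ "B\<^sup>2"])
    show "AE x in lebesgue_on S. norm ((f x)\<^sup>2) \<le> B\<^sup>2"
      using assms(3) abs_le_square_iff by (intro AE_I2) (fastforce simp: abs_le_square_iff)
  qed (use assms in auto)
  then show ?thesis using assms by (simp add: L2_space_def)
qed

lemma continuous_bounded_on_bounded:
  fixes f :: "'a::euclidean_space \<Rightarrow> real"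
  assumes "bounded S" "continuous_on UNIV f"
  obtains B where "B > 0" "\<And>x. x \<in> S \<Longrightarrow> \<bar>f x\<bar> \<le> B"
proof -
  have "compact (f ` closure S)"
    using assms by (intro compact_continuous_image) (auto intro: continuous_on_subset)
  then have "bounded (f ` closure S)" by (rule compact_imp_bounded)
  then obtain B where "B > 0" "\<forall>y\<in>f ` closure S. norm y \<le> B"
    unfolding bounded_pos by blast
  then show ?thesis using that closure_subset[of S] by auto
qed

lemma continuous_measurable_lebesgue_on:
  fixes f :: "'a::euclidean_space \<Rightarrow> real"
  assumes "continuous_on UNIV f"
  shows "f \<in> borel_measurable (lebesgue_on S)"
proof -
  have "f \<in> borel_measurable borel" using assms by (rule borel_measurable_continuous_onI)
  then have "f \<in> borel_measurable lebesgue" by (intro measurable_completion) (simp add: measurable_lborel1)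
  then show ?thesis by (simp add: measurable_restrict_space1)
qed

lemma L2_continuous:
  fixes f :: "'a::euclidean_space \<Rightarrow> real"
  assumes "S \<in> lmeasurable" "bounded S" "continuous_on UNIV f"
  shows "f \<in> L2_space S"
  using continuous_bounded_on_bounded[OF assms(2,3)] L2_bounded[OF assms(1) continuous_measurable_lebesgue_on[OF assms(3)]]
  by metis

lemma L2_norm_nonneg: "0 \<le> L2_norm S f"
  by (simp add: L2_norm_def)

lemma L2_norm_power2: "(L2_norm S f)\<^sup>2 = (LINT x|lebesgue_on S. (f x)\<^sup>2)"
  by (simp add: L2_norm_def)

lemma discriminant_le:
  fixes A B C :: real
  assumes "\<And>t. 0 \<le> A - 2 * t * C + t\<^sup>2 * B" "0 \<le> B"
  shows "C\<^sup>2 \<le> A * B"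
proof (cases "B = 0")
  case True
  have "C = 0"
  proof (rule ccontr)
    assume "C \<noteq> 0"
    \<comment> \<open>At this t the affine expression A - 2 t C takes the value -1.\<close>
    then show False using assms(1)[of "(A + 1) / (2 * C)"] True by simp
  qed
  then show ?thesis using True by simp
next
  case False
  have "0 \<le> A - 2 * (C / B) * C + (C / B)\<^sup>2 * B" by (rule assms(1))
  also have "\<dots> = A - C\<^sup>2 / B" using False by (simp add: field_simps power2_eq_square)
  finally show ?thesis using False assms(2) by (simp add: field_simps)
qed

lemma L2_Cauchy_Schwarz:
  assumes "f \<in> L2_space S" "g \<in> L2_space S"
  shows "\<bar>LINT x|lebesgue_on S. f x * g x\<bar> \<le> L2_norm S f * L2_norm S g"
proof -
  note [simp] = L2_spaceD(2)[OF assms(1)] L2_spaceD(2)[OF assms(2)] L2_mult_integrable[OF assms]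
  have "(LINT x|lebesgue_on S. f x * g x)\<^sup>2 \<le> (LINT x|lebesgue_on S. (f x)\<^sup>2) * (LINT x|lebesgue_on S. (g x)\<^sup>2)"
  proof (rule discriminant_le)
    fix t :: real
    have "0 \<le> (LINT x|lebesgue_on S. (f x - t * g x)\<^sup>2)" by simp
    also have "\<dots> = (LINT x|lebesgue_on S. ((f x)\<^sup>2 - (2 * t) * (f x * g x)) + t\<^sup>2 * (g x)\<^sup>2)"
      by (intro LINT_cong) (auto simp: power2_eq_square algebra_simps)
    also have "\<dots> = (LINT x|lebesgue_on S. (f x)\<^sup>2) - 2 * t * (LINT x|lebesgue_on S. f x * g x)
        + t\<^sup>2 * (LINT x|lebesgue_on S. (g x)\<^sup>2)"
      by (subst Bochner_Integration.integral_add Bochner_Integration.integral_diff, (simp; fail), (simp; fail))+ simp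
    finally show "0 \<le> (LINT x|lebesgue_on S. (f x)\<^sup>2) - 2 * t * (LINT x|lebesgue_on S. f x * g x)
        + t\<^sup>2 * (LINT x|lebesgue_on S. (g x)\<^sup>2)" .
  qed simp
  then show ?thesis
    unfolding L2_norm_def real_sqrt_mult[symmetric] by (intro real_le_rsqrt) simp
qed

lemma L2_norm_triangle:
  assumes "f \<in> L2_space S" "g \<in> L2_space S"
  shows "L2_norm S (\<lambda>x. f x + g x) \<le> L2_norm S f + L2_norm S g"
proof -
  note [simp] = L2_spaceD(2)[OF assms(1)] L2_spaceD(2)[OF assms(2)] L2_mult_integrable[OF assms]
  have "(L2_norm S (\<lambda>x. f x + g x))\<^sup>2 = (LINT x|lebesgue_on S. ((f x)\<^sup>2 + 2 * (f x * g x)) + (g x)\<^sup>2)"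
    unfolding L2_norm_power2 by (intro LINT_cong) (auto simp: power2_eq_square algebra_simps)
  also have "\<dots> = (L2_norm S f)\<^sup>2 + 2 * (LINT x|lebesgue_on S. f x * g x) + (L2_norm S g)\<^sup>2"
    unfolding L2_norm_power2
    by (subst Bochner_Integration.integral_add, (simp; fail), (simp; fail))+ simp
  also have "\<dots> \<le> (L2_norm S f)\<^sup>2 + 2 * (L2_norm S f * L2_norm S g) + (L2_norm S g)\<^sup>2"
    using L2_Cauchy_Schwarz[OF assms] by simp
  also have "\<dots> = (L2_norm S f + L2_norm S g)\<^sup>2" by (simp add: power2_sum)
  finally show ?thesis using L2_norm_nonneg by (meson add_nonneg_nonneg power2_le_imp_le)
qed

lemma L2_norm_minus_commute: "L2_norm S (\<lambda>x. f x - g x) = L2_norm S (\<lambda>x. g x - f x)"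
  by (simp add: L2_norm_def power2_commute)

lemma L2_norm_diff_triangle:
  assumes "f \<in> L2_space S" "g \<in> L2_space S" "h \<in> L2_space S"
  shows "L2_norm S (\<lambda>x. f x - h x) \<le> L2_norm S (\<lambda>x. f x - g x) + L2_norm S (\<lambda>x. g x - h x)"
  using L2_norm_triangle[OF L2_diff[OF assms(1,2)] L2_diff[OF assms(2,3)]] by simp

lemma L2_norm_cong_AE:
  assumes "AE x in lebesgue_on S. f x = g x"
      and "f \<in> borel_measurable (lebesgue_on S)" "g \<in> borel_measurable (lebesgue_on S)"
  shows "L2_norm S f = L2_norm S g"
  unfolding L2_norm_def using assms
  by (intro arg_cong[where f = sqrt] integral_cong_AE) auto

lemma L2_space_cong_AE:
  assumes "AE x in lebesgue_on S. f x = g x" "f \<in> L2_space S"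
    and "g \<in> borel_measurable (lebesgue_on S)"
  shows "g \<in> L2_space S"
proof -
  have "integrable (lebesgue_on S) (\<lambda>x. (f x)\<^sup>2) \<longleftrightarrow> integrable (lebesgue_on S) (\<lambda>x. (g x)\<^sup>2)"
    using assms by (intro integrable_cong_AE) (auto dest: L2_spaceD)
  then show ?thesis using assms by (simp add: L2_space_def)
qed

lemma L2_norm_eq_0D:
  assumes "f \<in> L2_space S" "L2_norm S f = 0"
  shows "AE x in lebesgue_on S. f x = 0"
proof -
  have "AE x in lebesgue_on S. (f x)\<^sup>2 = 0"
    using assms integral_nonneg_eq_0_iff_AE[OF L2_spaceD(2)[OF assms(1)]] by (simp add: L2_norm_def)
  then show ?thesis by simp
qed

lemma L2_tendsto_integral:
  assumes "\<And>n. f n \<in> L2_space S" "f' \<in> L2_space S" "g \<in> L2_space S"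
    and "((\<lambda>n. L2_norm S (\<lambda>x. f n x - f' x)) \<longlongrightarrow> 0) F"
  shows "((\<lambda>n. LINT x|lebesgue_on S. f n x * g x) \<longlongrightarrow> (LINT x|lebesgue_on S. f' x * g x)) F"
proof -
  have "((\<lambda>n. L2_norm S (\<lambda>x. f n x - f' x) * L2_norm S g) \<longlongrightarrow> 0 * L2_norm S g) F"
    by (intro tendsto_mult assms tendsto_const)
  moreover have "norm ((LINT x|lebesgue_on S. f n x * g x) - (LINT x|lebesgue_on S. f' x * g x))
      \<le> L2_norm S (\<lambda>x. f n x - f' x) * L2_norm S g" for n
  proof -
    have "(LINT x|lebesgue_on S. f n x * g x) - (LINT x|lebesgue_on S. f' x * g x)
        = (LINT x|lebesgue_on S. (f n x - f' x) * g x)"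
      using assms by (simp add: left_diff_distrib L2_mult_integrable)
    then show ?thesis using L2_Cauchy_Schwarz[OF L2_diff[OF assms(1,2)] assms(3)] by simp
  qed
  ultimately have "((\<lambda>n. (LINT x|lebesgue_on S. f n x * g x) - (LINT x|lebesgue_on S. f' x * g x)) \<longlongrightarrow> 0) F"
    using Lim_null_comparison[of "\<lambda>n. (LINT x|lebesgue_on S. f n x * g x) - (LINT x|lebesgue_on S. f' x * g x)"
        "\<lambda>n. L2_norm S (\<lambda>x. f n x - f' x) * L2_norm S g" F] by simp
  then show ?thesis by (rule LIM_zero_cancel)
qed

lemma L1_le_L2_norm:
  assumes "S \<in> lmeasurable" "f \<in> L2_space S"
  shows "L1_norm S f \<le> sqrt (measure lebesgue S) * L2_norm S f"
proof -
  have f: "(\<lambda>x. \<bar>f x\<bar>) \<in> L2_space S" using assms(2) by (auto simp: L2_space_def)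
  have "\<bar>LINT x|lebesgue_on S. 1 * \<bar>f x\<bar>\<bar> \<le> L2_norm S (\<lambda>_. 1) * L2_norm S (\<lambda>x. \<bar>f x\<bar>)"
    by (rule L2_Cauchy_Schwarz[OF L2_const[OF assms(1)] f])
  moreover have "L2_norm S (\<lambda>x. \<bar>f x\<bar>) = L2_norm S f" by (simp add: L2_norm_def)
  moreover have "L2_norm S (\<lambda>_. 1) = sqrt (measure lebesgue S)"
    unfolding L2_norm_def using assms(1) by (simp add: measure_restrict_space fmeasurableD)
  ultimately show ?thesis unfolding L1_norm_def by simp
qed

section \<open>Integration over the unit square\<close>

abbreviation sq :: "(real \<times> real) measure" where
  "sq \<equiv> lebesgue_on unit_square"

abbreviation itv :: "real measure" where
  "itv \<equiv> lebesgue_on {0<..<1}"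

abbreviation ip :: "(real \<times> real \<Rightarrow> real) \<Rightarrow> (real \<times> real \<Rightarrow> real) \<Rightarrow> real" where
  "ip f g \<equiv> (LINT z|sq. f z * g z)"

abbreviation sq_L2 :: "(real \<times> real \<Rightarrow> real) set" where
  "sq_L2 \<equiv> L2_space unit_square"

abbreviation sq_norm :: "(real \<times> real \<Rightarrow> real) \<Rightarrow> real" where
  "sq_norm \<equiv> L2_norm unit_square"

lemma unit_square_box: "unit_square = box (0, 0) (1, 1)"
  by (auto simp: unit_square_def box_def Basis_plane)

lemma open_unit_square: "open unit_square"
  and bounded_unit_square: "bounded unit_square"
  by (auto simp: unit_square_box bounded_box open_box)

lemma lmeasurable_sq: "unit_square \<in> lmeasurable"
  by (intro lmeasurable_open open_unit_square bounded_unit_square)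

lemma measure_unit_square: "measure lebesgue unit_square = 1"
  using content_Pair[of "0::real" "0::real" "1::real" "1::real"]
  unfolding unit_square_box measure_lborel_box_eq measure_lborel_cbox_eq
  by (simp add: measure_lborel_box_eq measure_lborel_cbox_eq)

lemma lmeasurable_itv: "{0<..<1::real} \<in> lmeasurable"
  by (intro lmeasurable_open) auto

lemma mem_unit_square: "z \<in> unit_square \<longleftrightarrow> 0 < fst z \<and> fst z < 1 \<and> 0 < snd z \<and> snd z < 1"
  by (cases z) (auto simp: unit_square_def)

lemma sq_L2_continuous: "continuous_on UNIV f \<Longrightarrow> f \<in> sq_L2"
  by (rule L2_continuous[OF lmeasurable_sq bounded_unit_square])

lemma sq_integral_continuous:
  fixes q :: "real \<times> real \<Rightarrow> real"
  assumes "continuous_on UNIV q"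
  shows "(LINT z|sq. q z) = integral (cbox (0,0) (1,1)) q"
proof -
  have "integrable (lebesgue_on unit_square) q"
    by (intro L2_integrable lmeasurable_sq sq_L2_continuous assms)
  then have "(LINT z|sq. q z) = integral unit_square q"
    by (rule lebesgue_integral_eq_integral) (simp add: lmeasurable_sq fmeasurableD)
  then show ?thesis by (simp add: unit_square_box integral_open_interval)
qed

lemma interval_integral_continuous:
  fixes q :: "real \<Rightarrow> real"
  assumes "continuous_on UNIV q"
  shows "(LINT z|lebesgue_on {0<..<1}. q z) = integral {0..1} q"
proof -
  have "integrable (lebesgue_on {0<..<1}) q"
    by (intro L2_integrable lmeasurable_itv L2_continuous assms) auto
  then have "(LINT z|lebesgue_on {0<..<1}. q z) = integral {0<..<1} q"
    by (rule lebesgue_integral_eq_integral) (simp add: lmeasurable_itv fmeasurableD)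
  then show ?thesis by (metis box_real(1) cbox_interval integral_open_interval)
qed

text \<open>For s = 0 and s = 1 the map y -> \<open>side i s y\<close> parametrises the two sides
  orthogonal to the direction i, so that one argument serves both coordinates.\<close>

definition side :: "real \<times> real \<Rightarrow> real \<Rightarrow> real \<Rightarrow> real \<times> real" where
  "side i s y = (if i = (1, 0) then (s, y) else (y, s))"

lemma sq_integral_partial:
  fixes q q' :: "real \<times> real \<Rightarrow> real"
  assumes "\<And>s y. ((\<lambda>s. q (side i s y)) has_real_derivative q' (side i s y)) (at s)" "continuous_on UNIV q'"
  shows "(LINT z|sq. q' z) = integral {0..1} (\<lambda>y. q (side i 1 y) - q (side i 0 y))"
proof -
  have c: "continuous_on (cbox (0,0) (1,1)) (\<lambda>(x,y). q' (x,y))"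
    using assms(2) by (auto intro: continuous_on_subset)
  have "(LINT z|sq. q' z) = integral (cbox 0 1) (\<lambda>x. integral (cbox 0 1) (\<lambda>y. q' (x, y)))"
    unfolding sq_integral_continuous[OF assms(2)]
    by (rule integral_prod_continuous) (use assms(2) in \<open>auto intro: continuous_on_subset\<close>)
  also have "\<dots> = integral (cbox 0 1) (\<lambda>y. integral (cbox 0 1) (\<lambda>s. q' (side i s y)))"
    using integral_swap_continuous[OF c] by (cases "i = (1, 0)") (simp_all add: side_def)
  also have "\<dots> = integral (cbox 0 1) (\<lambda>y. q (side i 1 y) - q (side i 0 y))"
  proof (rule integral_cong)
    fix y :: real
    have "((\<lambda>s. q' (side i s y)) has_integral q (side i 1 y) - q (side i 0 y)) {0..1}"
      by (rule fundamental_theorem_of_calculus)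
        (auto simp: has_real_derivative_iff_has_vector_derivative[symmetric]
          intro: DERIV_subset[OF assms(1)])
    then show "integral (cbox 0 1) (\<lambda>s. q' (side i s y)) = q (side i 1 y) - q (side i 0 y)"
      by (simp add: integral_unique)
  qed
  finally show ?thesis by simp
qed

lemma continuous_tensor:
  assumes "continuous_on UNIV a" "continuous_on UNIV b"
  shows "continuous_on UNIV (tensor a b)"
proof -
  have "continuous_on UNIV (\<lambda>z. a (fst z))" "continuous_on UNIV (\<lambda>z. b (snd z))"
    using assms by (auto intro!: continuous_on_compose2[of UNIV a UNIV fst]
        continuous_on_compose2[of UNIV b UNIV snd] continuous_on_fst continuous_on_snd continuous_on_id)
  then show ?thesis by (auto simp: tensor_def[abs_def] intro: continuous_intros)
qed

lemma sq_integral_tensor: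
  assumes "continuous_on UNIV a" "continuous_on UNIV b"
  shows "(LINT z|sq. tensor a b z) = integral {0..1} a * integral {0..1} b"
proof -
  have "(LINT z|sq. tensor a b z)
      = integral (cbox 0 1) (\<lambda>x. integral (cbox 0 1) (\<lambda>y. tensor a b (x, y)))"
    unfolding sq_integral_continuous[OF continuous_tensor[OF assms]]
    by (rule integral_prod_continuous)
      (use continuous_tensor[OF assms] in \<open>auto intro: continuous_on_subset\<close>)
  then show ?thesis by (simp add: tensor_def)
qed

section \<open>Green's formula for weak derivatives\<close>

lemma C_infinity_continuous: "p \<in> C_infinity \<Longrightarrow> continuous_on UNIV p"
  unfolding C_infinity_def by (auto dest: spec[of _ 0])

lemma C_infinity_differentiable: "p \<in> C_infinity \<Longrightarrow> p differentiable at z"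
  unfolding C_infinity_def by (auto dest: spec[of _ 1])

lemma C_infinity_partial_continuous:
  "p \<in> C_infinity \<Longrightarrow> i \<in> Basis \<Longrightarrow> continuous_on UNIV (\<lambda>z. frechet_derivative p (at z) i)"
  unfolding C_infinity_def by (auto dest: spec[of _ 1])

lemma partial_line:
  fixes p :: "real \<times> real \<Rightarrow> real"
  assumes "p differentiable at (side i s y)" "i \<in> Basis"
  shows "((\<lambda>s. p (side i s y)) has_real_derivative frechet_derivative p (at (side i s y)) i) (at s)"
proof -
  let ?D = "frechet_derivative p (at (side i s y))"
  have D: "(p has_derivative ?D) (at (side i s y))" using assms(1) by (simp add: frechet_derivative_works)
  have "((\<lambda>s. side i s y) has_derivative (\<lambda>h. h *\<^sub>R i)) (at s)"
    using assms(2) by (auto simp: Basis_plane side_def intro!: derivative_eq_intros)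
  from has_derivative_compose[OF this D]
  have "((\<lambda>s. p (side i s y)) has_derivative (\<lambda>h. ?D (h *\<^sub>R i))) (at s)" .
  moreover have "(\<lambda>h. ?D (h *\<^sub>R i)) = (*) (?D i)"
    using linear_scale[OF has_derivative_linear[OF D]] by (simp add: fun_eq_iff mult.commute)
  ultimately show ?thesis unfolding has_field_derivative_def by (simp only:)
qed

lemma Green_C_infinity:
  assumes "p \<in> C_infinity" "\<psi> \<in> C_infinity" and i: "i \<in> Basis"
  shows "(LINT z|sq. frechet_derivative p (at z) i * \<psi> z) + (LINT z|sq. p z * frechet_derivative \<psi> (at z) i)
    = integral {0..1} (\<lambda>y. p (side i 1 y) * \<psi> (side i 1 y) - p (side i 0 y) * \<psi> (side i 0 y))"
proof -
  note c = C_infinity_continuous[OF assms(1)] C_infinity_continuous[OF assms(2)]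
    C_infinity_partial_continuous[OF assms(1) i] C_infinity_partial_continuous[OF assms(2) i]
  note l = c[THEN sq_L2_continuous]
  note d = C_infinity_differentiable[OF assms(1)] C_infinity_differentiable[OF assms(2)]
  let ?g = "\<lambda>z. frechet_derivative p (at z) i * \<psi> z + p z * frechet_derivative \<psi> (at z) i"
  have g: "continuous_on UNIV ?g" using c by (intro continuous_intros)
  have "(LINT z|sq. ?g z)
      = integral {0..1} (\<lambda>y. p (side i 1 y) * \<psi> (side i 1 y) - p (side i 0 y) * \<psi> (side i 0 y))"
  proof (rule sq_integral_partial[OF _ g])
    show "((\<lambda>s. p (side i s y) * \<psi> (side i s y)) has_real_derivative ?g (side i s y)) (at s)" for s y
      using DERIV_mult[OF partial_line[OF d(1) i] partial_line[OF d(2) i]] by (simp add: mult.commute)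
  qed
  then show ?thesis using l by (simp add: L2_mult_integrable)
qed

lemma test_functions_vanish: "\<psi> \<in> test_functions S \<Longrightarrow> z \<notin> S \<Longrightarrow> \<psi> z = 0"
  unfolding test_functions_def using closure_subset[of "{x. \<psi> x \<noteq> 0}"] by blast

lemma test_functions_C_infinity: "\<psi> \<in> test_functions S \<Longrightarrow> \<psi> \<in> C_infinity"
  by (simp add: test_functions_def)

lemma C_infinity_has_weak_partial:
  assumes "p \<in> C_infinity" "i \<in> Basis"
  shows "has_weak_partial unit_square i p (\<lambda>z. frechet_derivative p (at z) i)"
  unfolding has_weak_partial_def
proof (intro conjI ballI)
  show "p \<in> sq_L2" "(\<lambda>z. frechet_derivative p (at z) i) \<in> sq_L2"
    using assms by (auto intro: sq_L2_continuous C_infinity_continuous C_infinity_partial_continuous)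
  fix \<psi> assume \<psi>: "\<psi> \<in> test_functions unit_square"
  have "\<psi> (side i 1 y) = 0" "\<psi> (side i 0 y) = 0" for y
    by (rule test_functions_vanish[OF \<psi>], simp add: mem_unit_square side_def)+
  then show "(LINT x|sq. p x * frechet_derivative \<psi> (at x) i) = - (LINT x|sq. frechet_derivative p (at x) i * \<psi> x)"
    using Green_C_infinity[OF assms(1) test_functions_C_infinity[OF \<psi>] assms(2)] by simp
qed

lemma has_weak_partialD:
  assumes "has_weak_partial S i v w"
  shows "v \<in> L2_space S" "w \<in> L2_space S"
    "\<psi> \<in> test_functions S \<Longrightarrow> (LINT x|lebesgue_on S. v x * frechet_derivative \<psi> (at x) i) = - (LINT x|lebesgue_on S. w x * \<psi> x)"
  using assms by (auto simp: has_weak_partial_def)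

lemma has_weak_partial_diff:
  assumes "has_weak_partial unit_square i v w" "has_weak_partial unit_square i v' w'" "i \<in> Basis"
  shows "has_weak_partial unit_square i (\<lambda>z. v z - v' z) (\<lambda>z. w z - w' z)"
  unfolding has_weak_partial_def
proof (intro conjI ballI)
  show "(\<lambda>z. v z - v' z) \<in> sq_L2" "(\<lambda>z. w z - w' z) \<in> sq_L2"
    using has_weak_partialD(1,2)[OF assms(1)] has_weak_partialD(1,2)[OF assms(2)] by (auto intro: L2_diff)
  fix \<psi> assume \<psi>: "\<psi> \<in> test_functions unit_square"
  have "\<psi> \<in> sq_L2" "(\<lambda>z. frechet_derivative \<psi> (at z) i) \<in> sq_L2"
    using test_functions_C_infinity[OF \<psi>] assms(3)
    by (auto intro: sq_L2_continuous C_infinity_continuous C_infinity_partial_continuous)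
  then show "(LINT x|sq. (v x - v' x) * frechet_derivative \<psi> (at x) i) = - (LINT x|sq. (w x - w' x) * \<psi> x)"
    using has_weak_partialD(1,2)[OF assms(1)] has_weak_partialD(1,2)[OF assms(2)]
      has_weak_partialD(3)[OF assms(1) \<psi>] has_weak_partialD(3)[OF assms(2) \<psi>]
    by (simp add: left_diff_distrib L2_mult_integrable)
qed

lemma H1_weak_partial:
  "v \<in> H1_space S \<Longrightarrow> i \<in> Basis \<Longrightarrow> has_weak_partial S i v (weak_partial S i v)"
  unfolding weak_partial_def H1_space_def by (auto intro: someI_ex[of "has_weak_partial S i v"])

lemma H1_norm_bounds:
  fixes v :: "real \<times> real \<Rightarrow> real"
  shows "L2_norm S v \<le> H1_norm S v"
    "i \<in> Basis \<Longrightarrow> L2_norm S (weak_partial S i v) \<le> H1_norm S v"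
proof -
  show "L2_norm S v \<le> H1_norm S v"
    unfolding H1_norm_def by (intro real_le_rsqrt) (simp add: sum_nonneg)
  show "L2_norm S (weak_partial S i v) \<le> H1_norm S v" if "i \<in> Basis"
  proof -
    have "(L2_norm S (weak_partial S i v))\<^sup>2 \<le> (\<Sum>i\<in>Basis. (L2_norm S (weak_partial S i v))\<^sup>2)"
      using that by (intro member_le_sum) auto
    also have "\<dots> \<le> (L2_norm S v)\<^sup>2 + (\<Sum>i\<in>Basis. (L2_norm S (weak_partial S i v))\<^sup>2)" by simp
    finally show ?thesis unfolding H1_norm_def by (rule real_le_rsqrt)
  qed
qed

lemma continuous_dtensor: "continuous_on UNIV a \<Longrightarrow> continuous_on UNIV b \<Longrightarrow> continuous_on UNIV (dtensor i a b)"
  by (simp add: dtensor_def continuous_tensor)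

lemma sq_bounded_tensor:
  assumes "continuous_on UNIV a" "continuous_on UNIV b"
  obtains B where "B > 0" "\<And>z. z \<in> unit_square \<Longrightarrow> \<bar>tensor a b z\<bar> \<le> B"
  using continuous_bounded_on_bounded[OF bounded_unit_square continuous_tensor[OF assms]] by blast

lemma interval_bounded:
  fixes a :: "real \<Rightarrow> real"
  assumes "continuous_on UNIV a"
  obtains B where "B > 0" "\<And>x. 0 < x \<Longrightarrow> x < 1 \<Longrightarrow> \<bar>a x\<bar> \<le> B"
proof -
  have "bounded {0<..<1::real}" by simp
  from continuous_bounded_on_bounded[OF this assms] show ?thesis using that by (metis greaterThanLessThan_iff)
qed

text \<open>The cut-offs lie between 0 and 1 and are not differentiated here, so a multiple of the
  integrable function |k| dominates.\<close>

lemma tensor_cutoff_tendsto: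
  assumes k: "k \<in> sq_L2" and ab: "smooth_real a" "smooth_real b"
  shows "(\<lambda>j. ip k (tensor (\<lambda>x. a x * cutoff j x) (\<lambda>y. b y * cutoff j y)))
    \<longlonglongrightarrow> ip k (tensor a b)"
proof -
  define \<psi> where "\<psi> j = tensor (\<lambda>x. a x * cutoff j x) (\<lambda>y. b y * cutoff j y)" for j
  obtain B where B: "\<And>z. z \<in> unit_square \<Longrightarrow> \<bar>tensor a b z\<bar> \<le> B"
    using sq_bounded_tensor[OF ab[THEN smooth_real_continuous]] by metis
  have "(\<lambda>j. ip k (\<psi> j)) \<longlonglongrightarrow> ip k (tensor a b)"
  proof (rule integral_dominated_convergence[where w = "\<lambda>z. B * \<bar>k z\<bar>"])
    show "integrable sq (\<lambda>z. B * \<bar>k z\<bar>)"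
      using L2_integrable[OF lmeasurable_sq k] by simp
    show "AE z in sq. (\<lambda>j. k z * \<psi> j z) \<longlonglongrightarrow> k z * tensor a b z"
    proof (rule AE_I2)
      fix z assume "z \<in> space sq"
      then have z: "0 < fst z" "fst z < 1" "0 < snd z" "snd z < 1" by (auto simp: mem_unit_square)
      have "(\<lambda>j. k z * ((a (fst z) * cutoff j (fst z)) * (b (snd z) * cutoff j (snd z))))
          \<longlonglongrightarrow> k z * ((a (fst z) * 1) * (b (snd z) * 1))"
        by (intro tendsto_mult tendsto_const cutoff_tendsto z)
      then show "(\<lambda>j. k z * \<psi> j z) \<longlonglongrightarrow> k z * tensor a b z"
        by (simp add: \<psi>_def tensor_def)
    qed
    show "AE z in sq. norm (k z * \<psi> j z) \<le> B * \<bar>k z\<bar>" for j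
    proof (rule AE_I2)
      fix z assume "z \<in> space sq"
      then have z: "z \<in> unit_square" by simp
      have "\<bar>\<psi> j z\<bar> = \<bar>tensor a b z\<bar> * (cutoff j (fst z) * cutoff j (snd z))"
        using cutoff_bounds by (simp add: \<psi>_def tensor_def abs_mult)
      also have "\<dots> \<le> B * 1"
        using B[OF z] cutoff_bounds by (intro mult_mono mult_le_one) (auto intro: order_trans[OF abs_ge_zero])
      finally show "norm (k z * \<psi> j z) \<le> B * \<bar>k z\<bar>"
        using mult_right_mono[of "\<bar>\<psi> j z\<bar>" B "\<bar>k z\<bar>"] by (simp add: abs_mult mult.commute)
    qed
    show "(\<lambda>z. k z * tensor a b z) \<in> borel_measurable sq" "(\<lambda>z. k z * \<psi> j z) \<in> borel_measurable sq" for j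
      unfolding \<psi>_def
      by (intro borel_measurable_times L2_spaceD(1)[OF k] continuous_measurable_lebesgue_on continuous_tensor
          smooth_real_continuous smooth_real_mult ab smooth_cutoff)+
  qed
  then show ?thesis by (simp only: \<psi>_def)
qed

lemma dtensor_cutoff_tendsto:
  "k \<in> sq_L2 \<Longrightarrow> smooth_real a \<Longrightarrow> smooth_real b \<Longrightarrow>
    (\<lambda>j. ip k (dtensor i (\<lambda>x. a x * cutoff j x) (\<lambda>y. b y * cutoff j y)))
      \<longlonglongrightarrow> ip k (dtensor i a b)"
  by (simp add: dtensor_def tensor_cutoff_tendsto)

text \<open>The cut-offs carry orthogonality to test functions over to smooth products that do not
  vanish at the boundary. Applied to the difference of two weak derivatives of one function, this
  makes them interchangeable against products, although \<open>weak_partial\<close> is only some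
  choice among them.\<close>

lemma annihilate_dtensor:
  assumes k: "k \<in> sq_L2"
    and 0: "\<And>\<psi>. \<psi> \<in> test_functions unit_square \<Longrightarrow> ip k \<psi> = 0"
    and ab: "smooth_real a" "smooth_real b"
  shows "ip k (dtensor i a b) = 0"
  using dtensor_cutoff_tendsto[OF k ab] 0[OF dtensor_cutoff_test_function[OF ab]]
  by (simp add: LIMSEQ_const_iff)

lemma dtensor_side: "dtensor i a b (side i s y) = a s * b y"
  by (simp add: dtensor_def tensor_def side_def)

text \<open>The smooth functions that witness the trace satisfy the classical Green formula. Their
  boundary term on side s tends to 0 because the traces do, and the term on the opposite side
  vanishes because \<open>a (1 - s) = 0\<close>. Only one side is treated at a time, since
  \<open>has_trace\<close> supplies a separate approximating sequence for each side.\<close>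

lemma Green_trace:
  assumes w: "has_weak_partial unit_square i v w" and i: "i \<in> Basis" and s: "s \<in> {0, 1}" "a (1 - s) = 0"
    and tr: "has_trace unit_square (side i s) v (\<lambda>_. 0)"
    and ab: "smooth_real a" "smooth_real b" and a': "\<And>x. (a has_real_derivative a' x) (at x)"
  shows "ip w (dtensor i a b) = - ip v (dtensor i a' b)"
proof -
  let ?\<psi> = "dtensor i a b" and ?d\<psi> = "dtensor i a' b" and ?\<gamma> = "side i s"
  obtain b' where b': "\<And>x. (b has_real_derivative b' x) (at x)" using smooth_real_obtain_deriv[OF ab(2)] by blast
  note fd = frechet_derivative_dtensor[OF i a' b']
  note \<psi>C = dtensor_C_infinity[OF ab]
  \<comment> \<open>The boundary factor of Green's formula on side s: the value of \<open>a\<close>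
    there, with a minus sign at the lower end.\<close>
  define c :: real where "c = a s * (if s = 1 then 1 else - 1)"
  have \<gamma>: "continuous_on UNIV ?\<gamma>" unfolding side_def by (cases "i = (1, 0)") (auto intro: continuous_intros)
  have \<psi>: "?\<psi> \<in> sq_L2" and d\<psi>: "?d\<psi> \<in> sq_L2"
    using \<psi>C[of i] C_infinity_partial_continuous[OF \<psi>C[of i] i]
    by (auto simp: fd intro: sq_L2_continuous C_infinity_continuous)
  obtain p where p: "\<And>n::nat. p n \<in> C_infinity"
    and pH1: "(\<lambda>n. H1_norm unit_square (\<lambda>x. p n x - v x)) \<longlonglongrightarrow> 0"
    and ptr: "(\<lambda>n. L2_norm {0<..<1} (\<lambda>y. p n (?\<gamma> y))) \<longlonglongrightarrow> 0"
    and vH1: "v \<in> H1_space unit_square"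
    using tr unfolding has_trace_def by auto
  define dp where "dp n = (\<lambda>z. frechet_derivative (p n) (at z) i)" for n
  have dp: "has_weak_partial unit_square i (p n) (dp n)" for n
    unfolding dp_def by (rule C_infinity_has_weak_partial[OF p i])
  define W where "W n = weak_partial unit_square i (\<lambda>x. p n x - v x)" for n
  have "(\<lambda>x. p n x - v x) \<in> H1_space unit_square" for n
  proof -
    have "has_weak_partial unit_square j (\<lambda>x. p n x - v x)
        (\<lambda>x. frechet_derivative (p n) (at x) j - weak_partial unit_square j v x)" if "j \<in> Basis" for j
      by (rule has_weak_partial_diff[OF C_infinity_has_weak_partial[OF p that] H1_weak_partial[OF vH1 that] that])
    then show ?thesis unfolding H1_space_def
      using has_weak_partialD(1)[OF has_weak_partial_diff[OF dp[of n] w i]] by blast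
  qed
  then have W: "has_weak_partial unit_square i (\<lambda>x. p n x - v x) (W n)" for n
    unfolding W_def by (rule H1_weak_partial[OF _ i])
  have pv: "(\<lambda>n. sq_norm (\<lambda>x. p n x - v x)) \<longlonglongrightarrow> 0"
    by (rule tendsto_sandwich[OF _ _ tendsto_const pH1]) (auto simp: L2_norm_nonneg H1_norm_bounds)
  have W0: "(\<lambda>n. sq_norm (\<lambda>x. W n x - 0)) \<longlonglongrightarrow> 0"
    unfolding W_def
    by (rule tendsto_sandwich[OF _ _ tendsto_const pH1]) (auto simp: L2_norm_nonneg H1_norm_bounds(2)[OF i])
  have eq: "ip w ?\<psi> = c * integral {0..1} (\<lambda>y. p n (?\<gamma> y) * b y)
      - ip (p n) ?d\<psi> - ip (W n) ?\<psi>" for n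
  proof -
    \<comment> \<open>\<open>dp n - w\<close> and \<open>W n\<close> are weak derivatives of the
      same function, so \<open>?k\<close> is a weak derivative of 0.\<close>
    let ?k = "\<lambda>z. (dp n z - w z) - W n z"
    have d: "has_weak_partial unit_square i (\<lambda>x. (p n x - v x) - (p n x - v x)) ?k"
      by (rule has_weak_partial_diff[OF has_weak_partial_diff[OF dp w i] W i])
    have "ip ?k ?\<psi> = 0"
    proof (rule annihilate_dtensor[OF has_weak_partialD(2)[OF d] _ ab])
      fix \<psi> assume "\<psi> \<in> test_functions unit_square"
      from has_weak_partialD(3)[OF d this] show "ip ?k \<psi> = 0" by simp
    qed
    then have "ip w ?\<psi> = ip (dp n) ?\<psi> - ip (W n) ?\<psi>"
      using has_weak_partialD(2)[OF dp[of n]] has_weak_partialD(2)[OF W[of n]] has_weak_partialD(2)[OF w] \<psi>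
      by (simp add: left_diff_distrib L2_mult_integrable)
    moreover have "integral {0..1} (\<lambda>y. p n (side i 1 y) * ?\<psi> (side i 1 y) - p n (side i 0 y) * ?\<psi> (side i 0 y))
        = integral {0..1} (\<lambda>y. c * (p n (?\<gamma> y) * b y))"
      using s by (intro integral_cong) (auto simp: dtensor_side c_def)
    then have "ip (dp n) ?\<psi> + ip (p n) ?d\<psi> = c * integral {0..1} (\<lambda>y. p n (?\<gamma> y) * b y)"
      using Green_C_infinity[OF p[of n] \<psi>C[of i] i] by (simp add: dp_def fd)
    ultimately show ?thesis by linarith
  qed
  have "(\<lambda>n. integral {0..1} (\<lambda>y. p n (?\<gamma> y) * b y)) \<longlonglongrightarrow> 0"
  proof (rule Lim_null_comparison)
    have cs: "continuous_on UNIV (\<lambda>y. p n (?\<gamma> y))" "continuous_on UNIV b" for n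
      using \<gamma> C_infinity_continuous[OF p] smooth_real_continuous[OF ab(2)]
      by (auto intro: continuous_on_compose2)
    show "\<forall>\<^sub>F n in sequentially. norm (integral {0..1} (\<lambda>y. p n (?\<gamma> y) * b y))
        \<le> L2_norm {0<..<1} (\<lambda>y. p n (?\<gamma> y)) * L2_norm {0<..<1} b"
    proof (rule always_eventually, rule allI)
      fix n
      have "integral {0..1} (\<lambda>y. p n (?\<gamma> y) * b y) = (LINT y|itv. p n (?\<gamma> y) * b y)"
        using cs by (intro interval_integral_continuous[symmetric] continuous_intros)
      then show "norm (integral {0..1} (\<lambda>y. p n (?\<gamma> y) * b y))
        \<le> L2_norm {0<..<1} (\<lambda>y. p n (?\<gamma> y)) * L2_norm {0<..<1} b"
        using L2_Cauchy_Schwarz[OF L2_continuous[OF lmeasurable_itv _ cs(1)]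
            L2_continuous[OF lmeasurable_itv _ cs(2)]] by simp
    qed
    show "(\<lambda>n. L2_norm {0<..<1} (\<lambda>y. p n (?\<gamma> y)) * L2_norm {0<..<1} b) \<longlonglongrightarrow> 0"
      using tendsto_mult[OF ptr tendsto_const] by simp
  qed
  moreover have "(\<lambda>n. ip (p n) ?d\<psi>) \<longlonglongrightarrow> ip v ?d\<psi>"
    by (rule L2_tendsto_integral[OF has_weak_partialD(1)[OF dp] has_weak_partialD(1)[OF w] d\<psi> pv])
  moreover have "(\<lambda>n. ip (W n) ?\<psi>) \<longlonglongrightarrow> (LINT z|sq. 0 * ?\<psi> z)"
    by (rule L2_tendsto_integral[OF has_weak_partialD(2)[OF W] L2_zero \<psi> W0])
  ultimately have "(\<lambda>n. c * integral {0..1} (\<lambda>y. p n (?\<gamma> y) * b y)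
      - ip (p n) ?d\<psi> - ip (W n) ?\<psi>)
      \<longlonglongrightarrow> c * 0 - ip v ?d\<psi> - (LINT z|sq. 0 * ?\<psi> z)"
    by (intro tendsto_diff tendsto_mult tendsto_const)
  then show ?thesis unfolding eq[symmetric] by (simp add: LIMSEQ_const_iff)
qed

text \<open>Cut-offs are inserted in both variables and then removed. Differentiation in direction i
  hits only the cut-off attached to \<open>a\<close>; the linear vanishing of \<open>a\<close> at
  both ends keeps \<open>a * cutoff'\<close> bounded uniformly in j, and this product tends to 0
  pointwise, so no boundary term survives.\<close>

lemma interior_Green:
  assumes w: "has_weak_partial unit_square i q w" and i: "i \<in> Basis"
    and ab: "smooth_real a" "smooth_real b" and a': "\<And>x. (a has_real_derivative a' x) (at x)"
    and L: "0 \<le> L" "\<And>x. 0 \<le> x \<Longrightarrow> x \<le> 1 \<Longrightarrow> \<bar>a x\<bar> \<le> L * x" "\<And>x. 0 \<le> x \<Longrightarrow> x \<le> 1 \<Longrightarrow> \<bar>a x\<bar> \<le> L * (1 - x)"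
  shows "ip w (dtensor i a b) = - ip q (dtensor i a' b)"
proof -
  have sa': "smooth_real a'"
    using smooth_real_obtain_deriv[OF ab(1)] a' by (metis DERIV_unique ext)
  obtain b' where b': "\<And>x. (b has_real_derivative b' x) (at x)"
    using smooth_real_obtain_deriv[OF ab(2)] by blast
  define \<psi> where "\<psi> j = dtensor i (\<lambda>x. a x * cutoff j x) (\<lambda>y. b y * cutoff j y)" for j
  define d\<psi> where "d\<psi> j = dtensor i (\<lambda>x. a' x * cutoff j x + cutoff' j x * a x) (\<lambda>y. b y * cutoff j y)" for j
  have \<psi>: "\<psi> j \<in> test_functions unit_square" for j
    unfolding \<psi>_def by (rule dtensor_cutoff_test_function[OF ab])
  have d\<psi>: "(\<lambda>z. frechet_derivative (\<psi> j) (at z) i) = d\<psi> j" for j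
  proof
    fix z show "frechet_derivative (\<psi> j) (at z) i = d\<psi> j z"
      unfolding \<psi>_def d\<psi>_def
      by (rule frechet_derivative_dtensor[OF i DERIV_mult[OF a' DERIV_cutoff] DERIV_mult[OF b' DERIV_cutoff]])
  qed
  obtain A B where A: "A > 0" "\<And>x. 0 < x \<Longrightarrow> x < 1 \<Longrightarrow> \<bar>a' x\<bar> \<le> A"
      and B: "B > 0" "\<And>x. 0 < x \<Longrightarrow> x < 1 \<Longrightarrow> \<bar>b x\<bar> \<le> B"
    using interval_bounded[OF smooth_real_continuous[OF sa']]
      interval_bounded[OF smooth_real_continuous[OF ab(2)]] by metis
  have q: "q \<in> sq_L2" and wL: "w \<in> sq_L2"
    using has_weak_partialD(1,2)[OF w] by auto
  have dcont: "continuous_on UNIV (d\<psi> j)" for j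
    unfolding d\<psi>[symmetric]
    using C_infinity_partial_continuous[OF test_functions_C_infinity[OF \<psi>] i] .
  have lim: "(\<lambda>j. ip q (d\<psi> j)) \<longlonglongrightarrow> ip q (dtensor i a' b)"
  proof (rule integral_dominated_convergence[where w = "\<lambda>z. ((A + 6 * L) * B) * \<bar>q z\<bar>"])
    show "integrable sq (\<lambda>z. ((A + 6 * L) * B) * \<bar>q z\<bar>)"
      using L2_integrable[OF lmeasurable_sq q] by simp
    show "AE z in sq. (\<lambda>j. q z * d\<psi> j z) \<longlonglongrightarrow> q z * dtensor i a' b z"
    proof (rule AE_I2)
      fix z assume "z \<in> space sq"
      then have z: "0 < along i z" "along i z < 1" "0 < across i z" "across i z < 1" by (auto simp: mem_unit_square along_def across_def)
      have "(\<lambda>j. q z * ((a' (along i z) * cutoff j (along i z) + cutoff' j (along i z) * a (along i z)) * (b (across i z) * cutoff j (across i z))))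
          \<longlonglongrightarrow> q z * ((a' (along i z) * 1 + 0 * a (along i z)) * (b (across i z) * 1))"
        by (intro tendsto_mult tendsto_add tendsto_const cutoff_tendsto cutoff'_tendsto z)
      then show "(\<lambda>j. q z * d\<psi> j z) \<longlonglongrightarrow> q z * dtensor i a' b z"
        by (simp add: d\<psi>_def dtensor_apply)
    qed
    show "AE z in sq. norm (q z * d\<psi> j z) \<le> ((A + 6 * L) * B) * \<bar>q z\<bar>" for j
    proof (rule AE_I2)
      fix z assume "z \<in> space sq"
      then have z: "0 < along i z" "along i z < 1" "0 < across i z" "across i z < 1" by (auto simp: mem_unit_square along_def across_def)
      have "\<bar>a' (along i z) * cutoff j (along i z)\<bar> \<le> A * 1"
        unfolding abs_mult using A z cutoff_bounds by (intro mult_mono) auto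
      moreover have "\<bar>a (along i z) * cutoff' j (along i z)\<bar> \<le> 6 * L"
        using L z by (intro cutoff'_bound[of "along i z"]) auto
      ultimately have "\<bar>a' (along i z) * cutoff j (along i z) + cutoff' j (along i z) * a (along i z)\<bar> \<le> A + 6 * L"
        by (simp add: mult.commute)
      moreover have "\<bar>b (across i z) * cutoff j (across i z)\<bar> \<le> B * 1"
        unfolding abs_mult using B z cutoff_bounds by (intro mult_mono) auto
      ultimately have "\<bar>d\<psi> j z\<bar> \<le> (A + 6 * L) * B"
        unfolding d\<psi>_def dtensor_apply abs_mult using A B L(1) by (intro mult_mono) auto
      then show "norm (q z * d\<psi> j z) \<le> ((A + 6 * L) * B) * \<bar>q z\<bar>"
        using mult_right_mono[of "\<bar>d\<psi> j z\<bar>" "(A + 6 * L) * B" "\<bar>q z\<bar>"] by (simp add: abs_mult mult.commute)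
    qed
    show "(\<lambda>z. q z * dtensor i a' b z) \<in> borel_measurable sq"
      by (intro borel_measurable_times L2_spaceD(1)[OF q] continuous_measurable_lebesgue_on continuous_dtensor
          smooth_real_continuous sa' ab)
    show "(\<lambda>z. q z * d\<psi> j z) \<in> borel_measurable sq" for j
      by (intro borel_measurable_times L2_spaceD(1)[OF q] continuous_measurable_lebesgue_on dcont)
  qed
  have "(\<lambda>j. ip w (\<psi> j)) \<longlonglongrightarrow> ip w (dtensor i a b)"
    unfolding \<psi>_def by (rule dtensor_cutoff_tendsto[OF wL ab])
  moreover have "ip w (\<psi> j) = - ip q (d\<psi> j)" for j
    using has_weak_partialD(3)[OF w \<psi>, of j] unfolding d\<psi>[symmetric] by simp
  ultimately have "(\<lambda>j. - ip q (d\<psi> j)) \<longlonglongrightarrow> ip w (dtensor i a b)" by simp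
  then show ?thesis using tendsto_minus[OF lim] LIMSEQ_unique by blast
qed

lemma sq_L2_tensor: "continuous_on UNIV a \<Longrightarrow> continuous_on UNIV b \<Longrightarrow> tensor a b \<in> sq_L2"
  by (intro sq_L2_continuous continuous_tensor)

lemma sq_L2_dtensor: "continuous_on UNIV a \<Longrightarrow> continuous_on UNIV b \<Longrightarrow> dtensor i a b \<in> sq_L2"
  by (intro sq_L2_continuous continuous_dtensor)

lemma partition_smooth:
  assumes "smooth_real a" "\<And>x. (a has_real_derivative a' x) (at x)"
  shows "smooth_real (\<lambda>x. x * a x)" "smooth_real (\<lambda>x. (1 - x) * a x)"
    "\<And>x. ((\<lambda>x. x * a x) has_real_derivative a x + x * a' x) (at x)"
    "\<And>x. ((\<lambda>x. (1 - x) * a x) has_real_derivative - a x + (1 - x) * a' x) (at x)"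
    "continuous_on UNIV a'"
proof -
  show "smooth_real (\<lambda>x. x * a x)"
    using smooth_real_mult[OF smooth_real_linear[of 1 0] assms(1)] by simp
  show "smooth_real (\<lambda>x. (1 - x) * a x)"
    using smooth_real_mult[OF smooth_real_linear[of "-1" 1] assms(1)] by simp
  show "((\<lambda>x. x * a x) has_real_derivative a x + x * a' x) (at x)" for x
    by (rule derivative_eq_intros assms(2) refl)+ (simp add: algebra_simps)
  show "((\<lambda>x. (1 - x) * a x) has_real_derivative - a x + (1 - x) * a' x) (at x)" for x
    by (rule derivative_eq_intros assms(2) refl)+ (simp add: algebra_simps)
  obtain a'' where "\<And>x. (a has_real_derivative a'' x) (at x)" "smooth_real a''"
    using smooth_real_obtain_deriv[OF assms(1)] by blast
  then have "a'' = a'" using assms(2) by (blast intro: DERIV_unique)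
  then show "continuous_on UNIV a'" using \<open>smooth_real a''\<close> smooth_real_continuous by blast
qed

text \<open>In the splitting a = x a + (1 - x) a each part vanishes at one end, so
  \<open>Green_trace\<close> applies to it with the trace on the opposite side. The extra derivative
  terms a and -a cancel.\<close>

lemma Green_trace_both:
  assumes w: "has_weak_partial unit_square i v w" and i: "i \<in> Basis"
    and tr: "has_trace unit_square (side i 0) v (\<lambda>_. 0)" "has_trace unit_square (side i 1) v (\<lambda>_. 0)"
    and ab: "smooth_real a" "smooth_real b" and a': "\<And>x. (a has_real_derivative a' x) (at x)"
  shows "ip w (dtensor i a b) = - ip v (dtensor i a' b)"
proof -
  note p = partition_smooth[OF ab(1) a']
  note c = smooth_real_continuous[OF ab(1)] smooth_real_continuous[OF ab(2)] p(5)
  note L = has_weak_partialD(1,2)[OF w]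
  have "ip w (dtensor i a b)
      = (LINT z|sq. w z * dtensor i (\<lambda>x. x * a x) b z + w z * dtensor i (\<lambda>x. (1 - x) * a x) b z)"
    by (intro LINT_cong) (auto simp: dtensor_apply algebra_simps)
  also have "\<dots> = ip w (dtensor i (\<lambda>x. x * a x) b) + ip w (dtensor i (\<lambda>x. (1 - x) * a x) b)"
    by (intro Bochner_Integration.integral_add L2_mult_integrable L sq_L2_dtensor continuous_intros c)
  also have "ip w (dtensor i (\<lambda>x. x * a x) b) = - ip v (dtensor i (\<lambda>x. a x + x * a' x) b)"
    by (rule Green_trace[OF w i _ _ tr(2) p(1) ab(2) p(3)]) simp_all
  also have "ip w (dtensor i (\<lambda>x. (1 - x) * a x) b) = - ip v (dtensor i (\<lambda>x. - a x + (1 - x) * a' x) b)"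
    by (rule Green_trace[OF w i _ _ tr(1) p(2) ab(2) p(4)]) simp_all
  also have "- ip v (dtensor i (\<lambda>x. a x + x * a' x) b) + - ip v (dtensor i (\<lambda>x. - a x + (1 - x) * a' x) b)
      = - (LINT z|sq. v z * dtensor i (\<lambda>x. a x + x * a' x) b z + v z * dtensor i (\<lambda>x. - a x + (1 - x) * a' x) b z)"
    by (subst Bochner_Integration.integral_add) (auto intro!: L2_mult_integrable L sq_L2_dtensor continuous_intros c)
  also have "\<dots> = - ip v (dtensor i a' b)"
    by (intro arg_cong[where f = uminus] LINT_cong) (auto simp: dtensor_apply algebra_simps)
  finally show ?thesis .
qed

section \<open>Cosine coefficients of a solution\<close>

definition mode :: "real \<Rightarrow> nat \<Rightarrow> real \<times> real \<Rightarrow> real" where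
  "mode \<alpha> n = tensor (\<lambda>x. cos (\<alpha> * x)) (\<lambda>y. cos (real n * pi * y))"

definition coef :: "(real \<times> real \<Rightarrow> real) \<Rightarrow> real \<Rightarrow> nat \<Rightarrow> real" where
  "coef f \<alpha> n = (LINT z|sq. f z * mode \<alpha> n z)"

definition freq :: "real \<Rightarrow> nat \<Rightarrow> real" where
  "freq \<alpha> n = \<alpha>\<^sup>2 + (real n * pi)\<^sup>2"

definition source_weight :: "(real \<Rightarrow> real) \<Rightarrow> real \<Rightarrow> real" where
  "source_weight \<phi> \<mu> = (LINT t|itv. exp (- \<mu> * (1 - t)) * \<phi> t)"

lemma sin_npi_bounds:
  assumes "0 \<le> x" "x \<le> 1"
  shows "\<bar>sin (real n * pi * x)\<bar> \<le> real n * pi * x" "\<bar>sin (real n * pi * x)\<bar> \<le> real n * pi * (1 - x)"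
proof -
  have *: "\<bar>sin (real n * pi * y)\<bar> \<le> real n * pi * y" if "0 \<le> y" for y
    using abs_sin_x_le_abs_x[of "real n * pi * y"] that by simp
  show "\<bar>sin (real n * pi * x)\<bar> \<le> real n * pi * x" by (rule *[OF assms(1)])
  have "sin (real n * pi * (1 - x)) = sin (real n * pi - real n * pi * x)" by (simp add: algebra_simps)
  also have "\<dots> = - cos (real n * pi) * sin (real n * pi * x)" by (simp add: sin_diff)
  finally have "\<bar>sin (real n * pi * (1 - x))\<bar> = \<bar>sin (real n * pi * x)\<bar>"
    by (simp add: abs_mult cos_npi power_abs)
  then show "\<bar>sin (real n * pi * x)\<bar> \<le> real n * pi * (1 - x)" using *[of "1 - x"] assms by simp
qed

lemma L2_mode: "mode \<alpha> n \<in> sq_L2"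
  unfolding mode_def by (intro sq_L2_tensor continuous_intros)

lemma tensor_dtensor_x: "tensor a b = dtensor (1, 0) a b"
  by (simp add: dtensor_def)

lemma tensor_dtensor_y: "tensor a b = dtensor (0, 1) b a"
  by (simp add: dtensor_def)

text \<open>Two integrations by parts in each variable. In x, the first uses that the normal
  derivative has zero trace on both sides; in the second, sin(\<alpha> x) vanishes at x = 0 and v
  itself at x = 1, which is what frees \<alpha> from being a multiple of pi. In y, the first uses
  the zero normal traces and the second that sin(n pi y) vanishes linearly at both ends, which ties
  the second frequency to the integers.\<close>

lemma coef_weak_laplacian:
  assumes v: "v \<in> H2_space unit_square"
    and tr: "has_trace unit_square (\<lambda>y. (0, y)) (weak_partial unit_square (1, 0) v) (\<lambda>_. 0)"
       "has_trace unit_square (\<lambda>y. (1, y)) (weak_partial unit_square (1, 0) v) (\<lambda>_. 0)"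
       "has_trace unit_square (\<lambda>x. (x, 0)) (weak_partial unit_square (0, 1) v) (\<lambda>_. 0)"
       "has_trace unit_square (\<lambda>x. (x, 1)) (weak_partial unit_square (0, 1) v) (\<lambda>_. 0)"
       "has_trace unit_square (\<lambda>y. (1, y)) v (\<lambda>_. 0)"
  shows "weak_laplacian unit_square v \<in> sq_L2"
    and "coef (weak_laplacian unit_square v) \<alpha> n = - freq \<alpha> n * coef v \<alpha> n"
proof -
  note dt = tensor_dtensor_x and dt' = tensor_dtensor_y
  have B: "(1, 0) \<in> (Basis :: (real \<times> real) set)" "(0, 1) \<in> (Basis :: (real \<times> real) set)"
    by (simp_all add: Basis_plane)
  have side: "side (1, 0) s = (\<lambda>y. (s, y))" "side (0, 1) s = (\<lambda>x. (x, s))" for s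
    by (simp_all add: side_def fun_eq_iff)
  define v1 v2 where "v1 = weak_partial unit_square (1, 0) v" and "v2 = weak_partial unit_square (0, 1) v"
  define w1 w2 where "w1 = weak_partial unit_square (1, 0) v1" and "w2 = weak_partial unit_square (0, 1) v2"
  define \<beta> where "\<beta> = real n * pi"
  have H1: "v \<in> H1_space unit_square" "v1 \<in> H1_space unit_square" "v2 \<in> H1_space unit_square"
    using v by (auto simp: H2_space_def v1_def v2_def Basis_plane)
  have d: "has_weak_partial unit_square (1, 0) v v1" "has_weak_partial unit_square (0, 1) v v2"
    "has_weak_partial unit_square (1, 0) v1 w1" "has_weak_partial unit_square (0, 1) v2 w2"
    unfolding w1_def w2_def using H1 by (auto simp: v1_def v2_def Basis_plane intro!: H1_weak_partial)
  note L = has_weak_partialD(1)[OF d(1)] has_weak_partialD(2)[OF d(3)] has_weak_partialD(2)[OF d(4)]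
  have lap: "weak_laplacian unit_square v = (\<lambda>z. w1 z + w2 z)"
    by (auto simp: weak_laplacian_def Basis_plane w1_def w2_def v1_def v2_def)
  show "weak_laplacian unit_square v \<in> sq_L2"
    unfolding lap by (intro L2_add L)
  let ?c = "\<lambda>x. cos (\<alpha> * x)" and ?b = "\<lambda>y. cos (\<beta> * y)"
  let ?s = "\<lambda>x. - \<alpha> * sin (\<alpha> * x)" and ?t = "\<lambda>y. - \<beta> * sin (\<beta> * y)"
  have D: "(?c has_real_derivative ?s x) (at x)" "(?s has_real_derivative - \<alpha>\<^sup>2 * cos (\<alpha> * x)) (at x)"
    "(?b has_real_derivative ?t x) (at x)" "(?t has_real_derivative - \<beta>\<^sup>2 * cos (\<beta> * x)) (at x)" for x
    by (auto intro!: derivative_eq_intros simp: power2_eq_square)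
  have S: "smooth_real ?c" "smooth_real ?b" "smooth_real ?s" "smooth_real ?t"
    by (intro smooth_real_cos smooth_real_const_mult smooth_real_sin)+
  have "ip w1 (tensor ?c ?b) = - ip v1 (tensor ?s ?b)"
    unfolding dt using tr by (intro Green_trace_both[OF d(3) B(1) _ _ S(1,2) D(1)]) (simp_all add: v1_def side)
  also have "ip v1 (tensor ?s ?b) = - ip v (tensor (\<lambda>x. - \<alpha>\<^sup>2 * cos (\<alpha> * x)) ?b)"
    unfolding dt by (rule Green_trace[OF d(1) B(1) _ _ _ S(3,2) D(2), where s = 1]) (use tr(5) in \<open>simp_all add: side\<close>)
  also have "ip v (tensor (\<lambda>x. - \<alpha>\<^sup>2 * cos (\<alpha> * x)) ?b) = (LINT z|sq. - \<alpha>\<^sup>2 * (v z * tensor ?c ?b z))"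
    by (intro LINT_cong) (auto simp: tensor_def algebra_simps)
  finally have e1: "ip w1 (tensor ?c ?b) = - \<alpha>\<^sup>2 * ip v (tensor ?c ?b)"
    by simp
  have "ip w2 (tensor ?c ?b) = - ip v2 (tensor ?c ?t)"
    unfolding dt' using tr by (intro Green_trace_both[OF d(4) B(2) _ _ S(2,1) D(3)]) (simp_all add: v2_def side)
  also have "ip v2 (tensor ?c ?t) = - ip v (tensor ?c (\<lambda>x. - \<beta>\<^sup>2 * cos (\<beta> * x)))"
    unfolding dt'
  proof (rule interior_Green[OF d(2) B(2) S(4,1) D(4), where L = "\<beta> * \<beta>"])
    show "\<bar>- \<beta> * sin (\<beta> * x)\<bar> \<le> \<beta> * \<beta> * x" "\<bar>- \<beta> * sin (\<beta> * x)\<bar> \<le> \<beta> * \<beta> * (1 - x)"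
      if "0 \<le> x" "x \<le> 1" for x
      using sin_npi_bounds[OF that, of n]
      by (auto simp: \<beta>_def abs_mult mult.assoc intro!: mult_left_mono)
  qed (simp add: \<beta>_def)
  also have "ip v (tensor ?c (\<lambda>x. - \<beta>\<^sup>2 * cos (\<beta> * x))) = (LINT z|sq. - \<beta>\<^sup>2 * (v z * tensor ?c ?b z))"
    by (intro LINT_cong) (auto simp: tensor_def algebra_simps)
  finally have e2: "ip w2 (tensor ?c ?b) = - \<beta>\<^sup>2 * ip v (tensor ?c ?b)"
    by simp
  have m: "tensor ?c ?b = mode \<alpha> n" by (simp add: mode_def \<beta>_def)
  have "coef (weak_laplacian unit_square v) \<alpha> n = (LINT z|sq. w1 z * mode \<alpha> n z) + (LINT z|sq. w2 z * mode \<alpha> n z)"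
    unfolding coef_def lap distrib_right by (intro Bochner_Integration.integral_add L2_mult_integrable L L2_mode)
  then show "coef (weak_laplacian unit_square v) \<alpha> n = - freq \<alpha> n * coef v \<alpha> n"
    using e1 e2 unfolding m coef_def freq_def by (simp add: \<beta>_def algebra_simps)
qed

lemma coef_diff:
  "f \<in> sq_L2 \<Longrightarrow> g \<in> sq_L2 \<Longrightarrow> coef (\<lambda>z. f z - g z) \<alpha> n = coef f \<alpha> n - coef g \<alpha> n"
  unfolding coef_def by (simp add: left_diff_distrib L2_mult_integrable L2_mode)

lemma coef_cmult: "coef (\<lambda>z. c * f z) \<alpha> n = c * coef f \<alpha> n"
  unfolding coef_def by (simp add: mult.assoc)

lemma coef_cong_AE:
  assumes "AE z in sq. f z = g z" "f \<in> borel_measurable sq" "g \<in> borel_measurable sq"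
  shows "coef f \<alpha> n = coef g \<alpha> n"
  unfolding coef_def using assms L2_spaceD(1)[OF L2_mode]
  by (intro integral_cong_AE) auto

lemma mode_le_1: "\<bar>mode \<alpha> n z\<bar> \<le> 1"
  by (simp add: mode_def tensor_def abs_mult mult_le_one)

lemma abs_coef_le_L1_norm:
  assumes "f \<in> sq_L2"
  shows "\<bar>coef f \<alpha> n\<bar> \<le> L1_norm unit_square f"
proof -
  have "norm (LINT z|sq. f z * mode \<alpha> n z) \<le> (LINT z|sq. norm (f z * mode \<alpha> n z))"
    by (rule integral_norm_bound)
  also have "\<dots> \<le> (LINT z|sq. \<bar>f z\<bar>)"
    using integrable_norm[OF L2_mult_integrable[OF assms L2_mode]]
      integrable_norm[OF L2_integrable[OF lmeasurable_sq assms]] mode_le_1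
    by (intro integral_mono) (simp_all add: abs_mult mult_left_le)
  finally show ?thesis by (simp add: coef_def L1_norm_def)
qed

lemma abs_coef_le_L2_norm: "f \<in> sq_L2 \<Longrightarrow> \<bar>coef f \<alpha> n\<bar> \<le> sq_norm f"
  using abs_coef_le_L1_norm L1_le_L2_norm[OF lmeasurable_sq] measure_unit_square
  by (metis mult_1 order_trans real_sqrt_one)

lemma coef_tendsto:
  assumes "\<forall>\<^sub>F s in F. f s \<in> sq_L2" "g \<in> sq_L2"
    "((\<lambda>s. sq_norm (\<lambda>z. f s z - g z)) \<longlongrightarrow> 0) F"
  shows "((\<lambda>s. coef (f s) \<alpha> n) \<longlongrightarrow> coef g \<alpha> n) F"
proof (rule LIM_zero_cancel, rule Lim_null_comparison[OF _ assms(3)])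
  show "\<forall>\<^sub>F s in F. norm (coef (f s) \<alpha> n - coef g \<alpha> n) \<le> sq_norm (\<lambda>z. f s z - g z)"
    using assms(1)
  proof eventually_elim
    case (elim s)
    show ?case
      using abs_coef_le_L2_norm[OF L2_diff[OF elim assms(2)], of \<alpha> n] coef_diff[OF elim assms(2), of \<alpha> n] by simp
  qed
qed

text \<open>The coefficient U(t) satisfies U' + \<mu> U = \<phi>(t) F for almost every t. After
  multiplication by exp(\<mu> t) the left side is the continuous function G, the derivative of
  exp(\<mu> t) U(t) everywhere, so the fundamental theorem of calculus applies to it; the equation,
  known only almost everywhere, enters under the integral sign.\<close>

lemma source_problem_coef:
  assumes sol: "solves_source_problem u f \<phi> g0 g1" and \<phi>: "\<phi> \<in> L1_space {0<..<1}"
    and g: "g0 \<in> sq_L2" "g1 \<in> sq_L2"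
  shows "coef g1 \<alpha> n - exp (- freq \<alpha> n) * coef g0 \<alpha> n = source_weight \<phi> (freq \<alpha> n) * coef f \<alpha> n"
proof -
  define \<mu> where "\<mu> = freq \<alpha> n"
  obtain u' where C1: "C1_in_L2 unit_square u u'"
    and pde: "AE t in itv. AE z in sq. u' t z - weak_laplacian unit_square (u t) z = \<phi> t * f z"
    and f: "f \<in> sq_L2" and H2: "AE t in itv. u t \<in> H2_space unit_square"
    and tr: "AE t in itv.
        has_trace unit_square (\<lambda>y. (0, y)) (weak_partial unit_square (1, 0) (u t)) (\<lambda>_. 0) \<and>
        has_trace unit_square (\<lambda>y. (1, y)) (weak_partial unit_square (1, 0) (u t)) (\<lambda>_. 0) \<and>
        has_trace unit_square (\<lambda>x. (x, 0)) (weak_partial unit_square (0, 1) (u t)) (\<lambda>_. 0) \<and>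
        has_trace unit_square (\<lambda>x. (x, 1)) (weak_partial unit_square (0, 1) (u t)) (\<lambda>_. 0) \<and>
        has_trace unit_square (\<lambda>y. (1, y)) (u t) (\<lambda>_. 0)"
    and u01: "AE z in sq. u 0 z = g0 z" "AE z in sq. u 1 z = g1 z"
    using sol unfolding solves_source_problem_def L2_in_H2_def by blast
  define U V where "U t = coef (u t) \<alpha> n" and "V t = coef (u' t) \<alpha> n" for t
  define G where "G t = exp (\<mu> * t) * (V t + \<mu> * U t)" for t
  have uL: "u t \<in> sq_L2" "u' t \<in> sq_L2" if "t \<in> {0..1}" for t
    using C1 that by (auto simp: C1_in_L2_def)
  have inI: "\<forall>\<^sub>F s in at t within {0..1}. s \<in> {0..1::real}" for t
    by (simp add: eventually_at_filter)
  have Uderiv: "(U has_real_derivative V t) (at t within {0..1})" if t: "t \<in> {0..1}" for t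
    unfolding has_field_derivative_iff
  proof (rule Lim_transform_eventually)
    have q: "\<forall>\<^sub>F s in at t within {0..1}. (\<lambda>z. (u s z - u t z) / (s - t)) \<in> sq_L2"
      using inI
    proof eventually_elim
      case (elim s)
      show ?case using L2_cmult[OF L2_diff[OF uL(1)[OF elim] uL(1)[OF t]], of "1 / (s - t)"] by simp
    qed
    show "((\<lambda>s. coef (\<lambda>z. (u s z - u t z) / (s - t)) \<alpha> n) \<longlongrightarrow> V t) (at t within {0..1})"
      unfolding V_def by (rule coef_tendsto[OF q uL(2)[OF t]]) (use C1 t in \<open>auto simp: C1_in_L2_def\<close>)
    show "\<forall>\<^sub>F s in at t within {0..1}. coef (\<lambda>z. (u s z - u t z) / (s - t)) \<alpha> n = (U s - U t) / (s - t)"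
      using inI
    proof eventually_elim
      case (elim s)
      show ?case
        using coef_cmult[of "1 / (s - t)" "\<lambda>z. u s z - u t z" \<alpha> n] coef_diff[OF uL(1)[OF elim] uL(1)[OF t], of \<alpha> n]
        by (simp add: U_def)
    qed
  qed
  have Vcont: "continuous_on {0..1} V"
    unfolding continuous_on_def V_def
  proof
    fix t :: real assume t: "t \<in> {0..1}"
    have "\<forall>\<^sub>F s in at t within {0..1}. u' s \<in> sq_L2"
      using inI by eventually_elim (rule uL)
    then show "((\<lambda>s. coef (u' s) \<alpha> n) \<longlongrightarrow> coef (u' t) \<alpha> n) (at t within {0..1})"
      by (rule coef_tendsto[OF _ uL(2)[OF t]]) (use C1 t in \<open>auto simp: C1_in_L2_def\<close>)
  qed
  have Ucont: "continuous_on {0..1} U"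
    using Uderiv by (meson DERIV_continuous continuous_on_eq_continuous_within)
  have Gcont: "continuous_on {0..1} G"
    unfolding G_def by (intro continuous_intros Ucont Vcont)
  have "((\<lambda>t. exp (\<mu> * t) * U t) has_real_derivative G t) (at t within {0..1})" if "t \<in> {0..1}" for t
  proof -
    have e: "((\<lambda>t. exp (\<mu> * t)) has_real_derivative exp (\<mu> * t) * \<mu>) (at t within {0..1})"
      by (auto intro!: derivative_eq_intros)
    show ?thesis
      using DERIV_mult[OF e Uderiv[OF that]] unfolding G_def by (simp add: algebra_simps)
  qed
  then have "(G has_integral exp (\<mu> * 1) * U 1 - exp (\<mu> * 0) * U 0) {0..1}"
    by (intro fundamental_theorem_of_calculus) (auto simp: has_real_derivative_iff_has_vector_derivative[symmetric])
  then have int1: "integral {0<..<1} G = exp \<mu> * U 1 - U 0"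
    by (metis (no_types, lifting) box_real(1) cbox_interval exp_zero integral_open_interval integral_unique
        mult.left_neutral mult.right_neutral mult_zero_right)
  have AEG: "AE t in itv. G t = exp (\<mu> * t) * \<phi> t * coef f \<alpha> n"
    using pde H2 tr AE_space[of "itv"]
  proof eventually_elim
    case (elim t)
    then have t: "t \<in> {0..1}" by simp
    note lap = coef_weak_laplacian(1)[OF elim(2)] coef_weak_laplacian(2)[OF elim(2), of \<alpha> n]
    have lapL: "weak_laplacian unit_square (u t) \<in> sq_L2" using lap(1) elim(3) by blast
    have "coef (\<lambda>z. u' t z - weak_laplacian unit_square (u t) z) \<alpha> n = coef (\<lambda>z. \<phi> t * f z) \<alpha> n"
      by (rule coef_cong_AE[OF elim(1) L2_spaceD(1)[OF L2_diff[OF uL(2)[OF t] lapL]] L2_spaceD(1)[OF L2_cmult[OF f]]])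
    then have "V t + \<mu> * U t = \<phi> t * coef f \<alpha> n"
      using lap(2) elim(3) by (simp add: coef_diff[OF uL(2)[OF t] lapL] coef_cmult V_def U_def \<mu>_def)
    then show ?case by (simp add: G_def)
  qed
  have E: "integrable itv (\<lambda>t. exp (\<mu> * t) * \<phi> t)"
  proof (rule Bochner_Integration.integrable_bound)
    show "integrable itv (\<lambda>t. exp \<bar>\<mu>\<bar> * \<phi> t)"
      using \<phi> by (simp add: L1_space_def)
    show "(\<lambda>t. exp (\<mu> * t) * \<phi> t) \<in> borel_measurable itv"
    proof (rule borel_measurable_times)
      show "(\<lambda>t. exp (\<mu> * t)) \<in> borel_measurable itv"
        by (intro continuous_measurable_lebesgue_on continuous_intros)
    qed (use \<phi> in \<open>auto simp: L1_space_def\<close>)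
    have "\<mu> * t \<le> \<bar>\<mu>\<bar>" if "0 < t" "t < 1" for t
      using that by (metis abs_ge_self abs_ge_zero less_eq_real_def mult.right_neutral mult_mono)
    then show "AE t in itv. norm (exp (\<mu> * t) * \<phi> t) \<le> norm (exp \<bar>\<mu>\<bar> * \<phi> t)"
      by (intro AE_I2) (auto simp: abs_mult intro!: mult_right_mono)
  qed
  have Gm: "G \<in> borel_measurable itv"
    by (rule continuous_imp_measurable_on_sets_lebesgue[OF continuous_on_subset[OF Gcont]]) auto
  have "(LINT t|itv. G t) = (LINT t|itv. exp (\<mu> * t) * \<phi> t * coef f \<alpha> n)"
    using E by (intro integral_cong_AE[OF Gm _ AEG]) auto
  moreover have "integrable itv G"
    using integrable_cong_AE[OF Gm _ AEG] E by auto
  then have "(LINT t|itv. G t) = integral {0<..<1} G"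
    by (rule lebesgue_integral_eq_integral) (simp add: lmeasurable_itv fmeasurableD)
  ultimately have key: "exp \<mu> * U 1 - U 0 = (LINT t|itv. exp (\<mu> * t) * \<phi> t) * coef f \<alpha> n"
    using int1 by simp
  have "source_weight \<phi> \<mu> = (LINT t|itv. exp (- \<mu>) * (exp (\<mu> * t) * \<phi> t))"
    unfolding source_weight_def
    by (intro LINT_cong) (auto simp: exp_add[symmetric] algebra_simps simp flip: mult.assoc)
  then have "source_weight \<phi> \<mu> = exp (- \<mu>) * (LINT t|itv. exp (\<mu> * t) * \<phi> t)"
    by simp
  then have "source_weight \<phi> \<mu> * coef f \<alpha> n = exp (- \<mu>) * (exp \<mu> * U 1 - U 0)"
    unfolding key by simp
  also have "\<dots> = U 1 - exp (- \<mu>) * U 0"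
    by (simp add: right_diff_distrib exp_minus)
  finally have "source_weight \<phi> \<mu> * coef f \<alpha> n = U 1 - exp (- \<mu>) * U 0" .
  moreover have "U 1 = coef g1 \<alpha> n" "U 0 = coef g0 \<alpha> n"
    unfolding U_def using u01 g L2_spaceD(1)[OF uL(1)[of 0]] L2_spaceD(1)[OF uL(1)[of 1]]
    by (auto intro!: coef_cong_AE dest: L2_spaceD(1))
  ultimately show ?thesis by (simp add: \<mu>_def)
qed

section \<open>The time weight at high frequencies\<close>

lemma source_weight_integrable:
  fixes \<phi> :: "real \<Rightarrow> real"
  assumes "integrable itv \<phi>" "0 \<le> \<mu>"
  shows "integrable itv (\<lambda>t. exp (- \<mu> * (1 - t)) * \<phi> t)"
proof (rule Bochner_Integration.integrable_bound[OF assms(1)])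
  show "(\<lambda>t. exp (- \<mu> * (1 - t)) * \<phi> t) \<in> borel_measurable itv"
  proof (rule borel_measurable_times)
    show "(\<lambda>t. exp (- \<mu> * (1 - t))) \<in> borel_measurable itv"
      by (intro continuous_measurable_lebesgue_on continuous_intros)
  qed (use assms in auto)
  show "AE t in itv. norm (exp (- \<mu> * (1 - t)) * \<phi> t) \<le> norm (\<phi> t)"
    using assms(2) by (intro AE_I2) (auto simp: abs_mult intro!: mult_left_le_one_le)
qed

lemma source_weight_diff:
  assumes "\<phi> \<in> L1_space {0<..<1}" "\<psi> \<in> L1_space {0<..<1}" "0 \<le> \<mu>"
  shows "\<bar>source_weight \<phi> \<mu> - source_weight \<psi> \<mu>\<bar> \<le> L1_norm {0<..<1} (\<lambda>t. \<phi> t - \<psi> t)"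
proof -
  have i: "integrable itv \<phi>" "integrable itv \<psi>"
    using assms by (auto simp: L1_space_def)
  have d: "integrable itv (\<lambda>t. \<phi> t - \<psi> t)" using i by simp
  have "source_weight \<phi> \<mu> - source_weight \<psi> \<mu>
      = (LINT t|itv. exp (- \<mu> * (1 - t)) * (\<phi> t - \<psi> t))"
    unfolding source_weight_def right_diff_distrib
    using source_weight_integrable[OF i(1) assms(3)] source_weight_integrable[OF i(2) assms(3)]
    by (simp add: right_diff_distrib)
  also have "\<bar>\<dots>\<bar> \<le> (LINT t|itv. norm (exp (- \<mu> * (1 - t)) * (\<phi> t - \<psi> t)))"
    unfolding real_norm_def[symmetric] by (rule integral_norm_bound)
  also have "\<dots> \<le> (LINT t|itv. \<bar>\<phi> t - \<psi> t\<bar>)"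
    using integrable_norm[OF source_weight_integrable[OF d assms(3)]] integrable_norm[OF d] assms(3)
    by (intro integral_mono) (auto simp: abs_mult intro!: mult_left_le_one_le)
  finally show ?thesis by (simp add: L1_norm_def)
qed

lemma integral_exp_weight:
  fixes \<mu> :: real
  assumes "0 < \<mu>"
  shows "(LINT t|itv. exp (- \<mu> * (1 - t))) = (1 - exp (- \<mu>)) / \<mu>"
proof -
  have "((\<lambda>t. exp (- \<mu> * (1 - t))) has_integral exp (- \<mu> * (1 - 1)) / \<mu> - exp (- \<mu> * (1 - 0)) / \<mu>) {0..1}"
  proof (rule fundamental_theorem_of_calculus)
    fix t :: real
    have "((\<lambda>t. exp (- \<mu> * (1 - t)) / \<mu>) has_real_derivative exp (- \<mu> * (1 - t))) (at t within {0..1})"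
      using assms by (auto intro!: derivative_eq_intros)
    then show "((\<lambda>t. exp (- \<mu> * (1 - t)) / \<mu>) has_vector_derivative exp (- \<mu> * (1 - t))) (at t within {0..1})"
      by (simp add: has_real_derivative_iff_has_vector_derivative)
  qed simp
  moreover have "(LINT t|itv. exp (- \<mu> * (1 - t))) = integral {0..1} (\<lambda>t. exp (- \<mu> * (1 - t)))"
    by (intro interval_integral_continuous continuous_intros)
  ultimately show ?thesis by (simp add: integral_unique diff_divide_distrib)
qed

text \<open>The integrand is bounded below on the whole interval by C exp(-\<mu> (1 - t)) -
  exp(-\<mu> (1 - \<tau>)) (|\<phi>| + C): for t > \<tau> the first term alone is enough, for t
  \<le> \<tau> the second outweighs everything. The first integrates to C (1 - exp(-\<mu>)) / \<mu>,
  while the second stays exponentially small even after multiplication by \<mu>.\<close>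

lemma source_weight_lower_bound_pos:
  assumes \<phi>: "integrable itv \<phi>"
    and \<tau>: "0 < \<tau>" "\<tau> < 1" and C: "0 < C" "AE t in lebesgue_on {\<tau><..<1}. C \<le> \<phi> t"
  shows "\<forall>\<^sub>F \<mu> in at_top. C / 2 \<le> \<mu> * source_weight \<phi> \<mu>"
proof -
  define K where "K = (LINT t|itv. \<bar>\<phi> t\<bar> + C)"
  have const: "integrable itv (\<lambda>_. C)"
    by (rule L2_integrable[OF lmeasurable_itv L2_const[OF lmeasurable_itv]])
  have i1: "integrable itv (\<lambda>t. \<bar>\<phi> t\<bar> + C)"
    using \<phi> const by simp
  have AE: "AE t in itv. \<tau> < t \<longrightarrow> C \<le> \<phi> t"
  proof -
    have "AE t in lebesgue. t \<in> {\<tau><..<1} \<longrightarrow> C \<le> \<phi> t"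
      using C(2) by (simp add: AE_restrict_space_iff)
    then show ?thesis by (simp add: AE_restrict_space_iff) (auto elim!: eventually_mono)
  qed
  have lower: "C * (1 - exp (- \<mu>)) - \<mu> * exp (- \<mu> * (1 - \<tau>)) * K \<le> \<mu> * source_weight \<phi> \<mu>" if \<mu>: "0 < \<mu>" for \<mu>
  proof -
    have i2: "integrable itv (\<lambda>t. C * exp (- \<mu> * (1 - t)))"
      using source_weight_integrable[OF const, of \<mu>] \<mu> by (simp add: mult.commute)
    have "(LINT t|itv. C * exp (- \<mu> * (1 - t)) - exp (- \<mu> * (1 - \<tau>)) * (\<bar>\<phi> t\<bar> + C))
        \<le> source_weight \<phi> \<mu>"
      unfolding source_weight_def
    proof (rule integral_mono_AE)
      show "AE t in itv. C * exp (- \<mu> * (1 - t)) - exp (- \<mu> * (1 - \<tau>)) * (\<bar>\<phi> t\<bar> + C)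
          \<le> exp (- \<mu> * (1 - t)) * \<phi> t"
        using AE
      proof eventually_elim
        case (elim t)
        show ?case
        proof (cases "\<tau> < t")
          case True
          then have "C * exp (- \<mu> * (1 - t)) \<le> exp (- \<mu> * (1 - t)) * \<phi> t"
            using elim mult_left_mono[of C "\<phi> t" "exp (- \<mu> * (1 - t))"] by (simp add: mult.commute)
          moreover have "0 \<le> exp (- \<mu> * (1 - \<tau>)) * (\<bar>\<phi> t\<bar> + C)" using C by simp
          ultimately show ?thesis by linarith
        next
          case False
          then have "exp (- \<mu> * (1 - t)) \<le> exp (- \<mu> * (1 - \<tau>))" using \<mu> by simp
          then have "exp (- \<mu> * (1 - t)) * (\<bar>\<phi> t\<bar> + C) \<le> exp (- \<mu> * (1 - \<tau>)) * (\<bar>\<phi> t\<bar> + C)"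
            using C by (intro mult_right_mono) auto
          moreover have "exp (- \<mu> * (1 - t)) * (C - \<phi> t) \<le> exp (- \<mu> * (1 - t)) * (\<bar>\<phi> t\<bar> + C)"
            by (intro mult_left_mono) auto
          ultimately show ?thesis by (simp add: algebra_simps)
        qed
      qed
    qed (use i1 i2 source_weight_integrable[OF \<phi>] \<mu> in auto)
    also have "(LINT t|itv. C * exp (- \<mu> * (1 - t)) - exp (- \<mu> * (1 - \<tau>)) * (\<bar>\<phi> t\<bar> + C))
        = (LINT t|itv. C * exp (- \<mu> * (1 - t))) - (LINT t|itv. exp (- \<mu> * (1 - \<tau>)) * (\<bar>\<phi> t\<bar> + C))"
      by (rule Bochner_Integration.integral_diff[OF i2]) (use i1 in simp)
    also have "\<dots> = C * ((1 - exp (- \<mu>)) / \<mu>) - exp (- \<mu> * (1 - \<tau>)) * K"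
      unfolding K_def integral_mult_right_zero integral_exp_weight[OF \<mu>] ..
    finally have "\<mu> * (C * ((1 - exp (- \<mu>)) / \<mu>) - exp (- \<mu> * (1 - \<tau>)) * K) \<le> \<mu> * source_weight \<phi> \<mu>"
      using \<mu> by (intro mult_left_mono) auto
    moreover have "\<mu> * (C * ((1 - exp (- \<mu>)) / \<mu>) - exp (- \<mu> * (1 - \<tau>)) * K)
        = C * (1 - exp (- \<mu>)) - \<mu> * exp (- \<mu> * (1 - \<tau>)) * K"
      using \<mu> by (simp add: field_simps)
    ultimately show ?thesis by linarith
  qed
  have "((\<lambda>\<mu>. C * (1 - exp (- \<mu>)) - \<mu> * exp (- \<mu> * (1 - \<tau>)) * K) \<longlongrightarrow> C * (1 - 0) - 0 * K) at_top"
  proof (intro tendsto_diff tendsto_mult tendsto_const)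
    show "((\<lambda>\<mu>::real. exp (- \<mu>)) \<longlongrightarrow> 0) at_top" by real_asymp
    have "0 < 1 - \<tau>" using \<tau> by simp
    then show "((\<lambda>\<mu>. \<mu> * exp (- \<mu> * (1 - \<tau>))) \<longlongrightarrow> 0) at_top" by real_asymp
  qed
  then have "\<forall>\<^sub>F \<mu> in at_top. C / 2 < C * (1 - exp (- \<mu>)) - \<mu> * exp (- \<mu> * (1 - \<tau>)) * K"
    by (rule order_tendstoD) (use C in simp)
  then show ?thesis using eventually_gt_at_top[of 0]
  proof eventually_elim
    case (elim \<mu>)
    then show ?case using lower[of \<mu>] by linarith
  qed
qed

lemma source_weight_lower_bound:
  assumes "\<phi> \<in> L1_space {0<..<1}" "nondegenerate_near_1 \<phi>"
  obtains c where "0 < c" "\<forall>\<^sub>F \<mu> in at_top. c / \<mu> \<le> \<bar>source_weight \<phi> \<mu>\<bar>"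
proof -
  have \<phi>: "integrable itv \<phi>" using assms(1) by (simp add: L1_space_def)
  obtain \<tau> C where \<tau>: "0 < \<tau>" "\<tau> < 1" and C: "0 < C"
    and AE: "(AE t in lebesgue_on {\<tau><..<1}. \<phi> t \<ge> C) \<or> (AE t in lebesgue_on {\<tau><..<1}. \<phi> t \<le> - C)"
    using assms(2) unfolding nondegenerate_near_1_def by auto
  have "\<forall>\<^sub>F \<mu> in at_top. C / 2 \<le> \<mu> * \<bar>source_weight \<phi> \<mu>\<bar>"
    using AE
  proof
    assume "AE t in lebesgue_on {\<tau><..<1}. \<phi> t \<ge> C"
    from source_weight_lower_bound_pos[OF \<phi> \<tau> C this] show ?thesis
      using eventually_gt_at_top[of 0]
    proof eventually_elim
      case (elim \<mu>)
      then show ?case using abs_ge_self[of "source_weight \<phi> \<mu>"] by (meson less_imp_le mult_left_mono order_trans)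
    qed
  next
    assume "AE t in lebesgue_on {\<tau><..<1}. \<phi> t \<le> - C"
    then have "AE t in lebesgue_on {\<tau><..<1}. C \<le> - \<phi> t" by (auto elim!: eventually_mono)
    from source_weight_lower_bound_pos[OF _ \<tau> C this] \<phi>
    have "\<forall>\<^sub>F \<mu> in at_top. C / 2 \<le> \<mu> * source_weight (\<lambda>t. - \<phi> t) \<mu>" by simp
    then show ?thesis using eventually_gt_at_top[of 0]
    proof eventually_elim
      case (elim \<mu>)
      have "source_weight (\<lambda>t. - \<phi> t) \<mu> \<le> \<bar>source_weight \<phi> \<mu>\<bar>" by (simp add: source_weight_def)
      then show ?case using elim by (meson less_imp_le mult_left_mono order_trans)
    qed
  qed
  then have "\<forall>\<^sub>F \<mu> in at_top. C / 2 / \<mu> \<le> \<bar>source_weight \<phi> \<mu>\<bar>"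
    using eventually_gt_at_top[of 0] by eventually_elim (simp add: field_simps)
  then show ?thesis using that[of "C / 2"] C by simp
qed

section \<open>Extrapolation from high frequencies\<close>

text \<open>The truncated expansion of \<open>(1 - q) ^ (- s)\<close> at \<open>q = 1 - E\<close>, where \<open>E\<close> shifts the frequency
  by \<open>1 / 64\<close>: it expresses the value at a frequency through values at frequencies that are
  larger by at least \<open>s / 64\<close>. The case \<open>s = m = 0\<close> relies on \<open>0 - 1 = 0\<close>.\<close>

definition binom_trunc :: "nat \<Rightarrow> nat \<Rightarrow> 'a::comm_ring_1 \<Rightarrow> 'a" where
  "binom_trunc s K q = (\<Sum>m<K. of_nat ((s + m - 1) choose m) * q ^ m)"

text \<open>The operator \<open>E ^ K * binom_trunc K K (1 - E)\<close> applied to \<open>F\<close>,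
  with the powers of 1 - E expanded into shifts. Using K also as the exponent s moves the nodes up
  without bound as K grows, so that even those belonging to \<omega> = 0 reach the range where the
  time weight is bounded below.\<close>

definition extrapolate :: "nat \<Rightarrow> (real \<Rightarrow> real) \<Rightarrow> real \<Rightarrow> real" where
  "extrapolate K F \<omega> = (\<Sum>m<K. real ((K + m - 1) choose m) *
     (\<Sum>j\<le>m. (-1) ^ j * real (m choose j) * F (\<omega> + real (K + j) / 64)))"

text \<open>For the full series, multiplication by 1 - q lowers the exponent s by one, by Pascal's
  rule; truncation leaves one extra term of top order.\<close>

lemma binom_trunc_Suc:
  "(1 - q) * binom_trunc (Suc s) (Suc k) q
    = binom_trunc s (Suc k) q - of_nat ((s + k) choose k) * q ^ Suc k"
proof (induction k)
  case 0
  then show ?case by (simp add: binom_trunc_def)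
next
  case (Suc k)
  have "(1 - q) * binom_trunc (Suc s) (Suc (Suc k)) q
      = (1 - q) * binom_trunc (Suc s) (Suc k) q + (1 - q) * (of_nat ((s + Suc k) choose Suc k) * q ^ Suc k)"
    by (simp add: binom_trunc_def distrib_left)
  also have "\<dots> = binom_trunc s (Suc k) q - of_nat ((s + k) choose k) * q ^ Suc k
      + (1 - q) * (of_nat ((s + Suc k) choose Suc k) * q ^ Suc k)"
    by (simp only: Suc.IH)
  also have "\<dots> = binom_trunc s (Suc (Suc k)) q - of_nat ((s + Suc k) choose Suc k) * q ^ Suc (Suc k)"
    by (simp add: binom_trunc_def algebra_simps)
  finally show ?case .
qed

text \<open>Each use of \<open>binom_trunc_Suc\<close> turns the error for s + 1 into the error for
  s plus one remainder. Since |1 - q| = 1, powers of 1 - q change no norms, and each of the s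
  remainders is at most 2^(S + k) |q|^(k + 1). The fixed bound S keeps this factor constant along
  the induction.\<close>

lemma binom_trunc_error:
  fixes q :: complex
  assumes "norm (1 - q) = 1" "s \<le> S"
  shows "norm (1 - (1 - q) ^ s * binom_trunc s (Suc k) q) \<le> real s * 2 ^ (S + k) * norm q ^ Suc k"
  using assms(2)
proof (induction s)
  case 0
  have "binom_trunc 0 (Suc k) q = 1"
  proof -
    have "binom_trunc 0 (Suc k) q = (\<Sum>m\<in>{..<Suc k}. if m = 0 then 1 else 0)"
      unfolding binom_trunc_def by (intro sum.cong) auto
    then show ?thesis by simp
  qed
  then show ?case by simp
next
  case (Suc s)
  have "(1 - q) ^ Suc s * binom_trunc (Suc s) (Suc k) q
      = (1 - q) ^ s * (binom_trunc s (Suc k) q - of_nat ((s + k) choose k) * q ^ Suc k)"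
    by (simp only: power_Suc2 mult.assoc binom_trunc_Suc)
  then have "1 - (1 - q) ^ Suc s * binom_trunc (Suc s) (Suc k) q
      = (1 - (1 - q) ^ s * binom_trunc s (Suc k) q) + (1 - q) ^ s * (of_nat ((s + k) choose k) * q ^ Suc k)"
    by (simp add: algebra_simps)
  also have "norm \<dots> \<le> real s * 2 ^ (S + k) * norm q ^ Suc k + 2 ^ (S + k) * norm q ^ Suc k"
  proof (rule norm_triangle_mono)
    show "norm (1 - (1 - q) ^ s * binom_trunc s (Suc k) q) \<le> real s * 2 ^ (S + k) * norm q ^ Suc k"
      using Suc by simp
    have "(s + k) choose k \<le> 2 ^ (s + k)" by (rule binomial_le_pow2)
    also have "\<dots> \<le> 2 ^ (S + k)" using Suc.prems by (intro power_increasing) auto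
    finally have "real ((s + k) choose k) \<le> 2 ^ (S + k)"
      by (metis of_nat_le_iff of_nat_numeral of_nat_power)
    then show "norm ((1 - q) ^ s * (of_nat ((s + k) choose k) * q ^ Suc k)) \<le> 2 ^ (S + k) * norm q ^ Suc k"
      by (simp add: norm_mult norm_power assms(1) mult_right_mono del: power_Suc)
  qed
  finally show ?case by (simp add: algebra_simps)
qed

lemma norm_1_minus_cis: "norm (1 - cis \<theta>) \<le> \<bar>\<theta>\<bar>"
proof -
  have "(norm (1 - cis \<theta>))\<^sup>2 = (1 - cos \<theta>)\<^sup>2 + (sin \<theta>)\<^sup>2"
    by (simp add: cmod_power2)
  also have "\<dots> = 2 - 2 * cos (2 * (\<theta> / 2))"
    using sin_cos_squared_add[of \<theta>] by (simp add: power2_eq_square algebra_simps)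
  also have "\<dots> = 4 * (sin (\<theta> / 2))\<^sup>2"
    by (subst cos_double_sin) simp
  also have "\<dots> = (2 * \<bar>sin (\<theta> / 2)\<bar>)\<^sup>2" by (simp add: power2_eq_square)
  also have "\<dots> \<le> \<bar>\<theta>\<bar>\<^sup>2"
    using abs_sin_x_le_abs_x[of "\<theta> / 2"] by (intro power_mono) auto
  finally show ?thesis by (rule power2_le_imp_le) simp
qed

text \<open>Raising the frequency by 1 / 64 multiplies exp(i \<omega> x) by E = exp(i x / 64), so
  extrapolation becomes multiplication by a polynomial in E; the cosine is the real part.\<close>

lemma extrapolate_cos_eq:
  "extrapolate K (\<lambda>\<alpha>. cos (\<alpha> * x)) \<omega>
    = Re (cis (\<omega> * x) * (cis (x / 64) ^ K * binom_trunc K K (1 - cis (x / 64))))"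
proof -
  define E where "E = cis (x / 64)"
  have shift: "cis ((\<omega> + real (K + j) / 64) * x) = cis (\<omega> * x) * E ^ K * E ^ j" for j
  proof -
    have "cis (\<omega> * x) * E ^ K * E ^ j = cis (\<omega> * x) * E ^ (K + j)" by (simp add: power_add)
    also have "\<dots> = cis (\<omega> * x + real (K + j) * (x / 64))" by (simp add: E_def Complex.DeMoivre cis_mult)
    also have "\<omega> * x + real (K + j) * (x / 64) = (\<omega> + real (K + j) / 64) * x" by (simp add: algebra_simps)
    finally show ?thesis ..
  qed
  have q: "(1 - E) ^ m = (\<Sum>j\<le>m. of_real ((-1) ^ j * real (m choose j)) * E ^ j)" for m
  proof -
    have "(1 - E) ^ m = (- E + 1) ^ m" by simp
    also have "\<dots> = (\<Sum>j\<le>m. of_nat (m choose j) * (- E) ^ j * 1 ^ (m - j))" by (rule binomial_ring)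
    also have "\<dots> = (\<Sum>j\<le>m. of_real ((-1) ^ j * real (m choose j)) * E ^ j)"
      by (intro sum.cong refl) (simp add: power_minus[of E])
    finally show ?thesis .
  qed
  have "cis (\<omega> * x) * (E ^ K * binom_trunc K K (1 - E))
      = (\<Sum>m<K. of_real (real ((K + m - 1) choose m)) *
          (\<Sum>j\<le>m. of_real ((-1) ^ j * real (m choose j)) * cis ((\<omega> + real (K + j) / 64) * x)))"
    unfolding binom_trunc_def q shift
    by (simp add: sum_distrib_left sum_distrib_right mult_ac)
  also have "Re \<dots> = extrapolate K (\<lambda>\<alpha>. cos (\<alpha> * x)) \<omega>"
    unfolding extrapolate_def by (simp add: Re_sum)
  finally show ?thesis by (simp add: E_def)
qed

text \<open>For x in [0, 1] the chord |1 - E| is at most 1 / 64. With K = k + 1, the bound K 2^(2 K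
  - 1) 64^(-K) from \<open>binom_trunc_error\<close> is then at most (2 * 4 / 64)^K = 8^(-K): the
  step 1 / 64 is small enough to beat the binomial coefficients.\<close>

lemma extrapolate_cos_error:
  assumes "0 \<le> x" "x \<le> 1"
  shows "\<bar>cos (\<omega> * x) - extrapolate (Suc k) (\<lambda>\<alpha>. cos (\<alpha> * x)) \<omega>\<bar> \<le> 1 / 8 ^ Suc k"
proof -
  define q where "q = 1 - cis (x / 64)"
  have q1: "norm (1 - q) = 1" by (simp add: q_def)
  have qn: "norm q \<le> 1 / 64" using norm_1_minus_cis[of "x / 64"] assms by (simp add: q_def)
  have "cos (\<omega> * x) - extrapolate (Suc k) (\<lambda>\<alpha>. cos (\<alpha> * x)) \<omega>
      = Re (cis (\<omega> * x) * (1 - (1 - q) ^ Suc k * binom_trunc (Suc k) (Suc k) q))"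
    unfolding extrapolate_cos_eq by (simp add: q_def right_diff_distrib)
  also have "\<bar>\<dots>\<bar> \<le> norm (cis (\<omega> * x) * (1 - (1 - q) ^ Suc k * binom_trunc (Suc k) (Suc k) q))"
    by (rule abs_Re_le_cmod)
  also have "\<dots> = norm (1 - (1 - q) ^ Suc k * binom_trunc (Suc k) (Suc k) q)"
    by (simp only: norm_mult norm_cis mult_1)
  also have "\<dots> \<le> real (Suc k) * 2 ^ (Suc k + k) * norm q ^ Suc k"
    by (rule binom_trunc_error[OF q1]) simp
  also have "\<dots> \<le> 2 ^ Suc k * 2 ^ (Suc k + Suc k) * (1 / 64) ^ Suc k"
  proof (intro mult_mono power_mono)
    show "real (Suc k) \<le> 2 ^ Suc k" using of_nat_less_two_power[of "Suc k"] by (rule less_imp_le)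
    show "(2::real) ^ (Suc k + k) \<le> 2 ^ (Suc k + Suc k)" by (intro power_increasing) auto
  qed (use qn in auto)
  also have "\<dots> = 1 / 8 ^ Suc k"
  proof -
    have "(2::real) ^ Suc k * 2 ^ (Suc k + Suc k) * (1 / 64) ^ Suc k = (2 * (2 * 2) * (1 / 64)) ^ Suc k"
      by (simp only: power_add power_mult_distrib)
    then show ?thesis by (simp add: power_one_over)
  qed
  finally show ?thesis .
qed

text \<open>The weights of the nodes sum in absolute value to at most the sum of 2^(K + m) 2^m over
  m < K, hence to at most 2^K 4^K. This is the amplification of noise.\<close>

lemma extrapolate_bound:
  assumes "\<And>j. j < K \<Longrightarrow> \<bar>F (\<omega> + real (K + j) / 64)\<bar> \<le> B" "0 \<le> B"
  shows "\<bar>extrapolate K F \<omega>\<bar> \<le> 8 ^ K * B"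
proof -
  have inner: "\<bar>\<Sum>j\<le>m. (-1) ^ j * real (m choose j) * F (\<omega> + real (K + j) / 64)\<bar> \<le> 2 ^ m * B" if "m < K" for m
  proof -
    have "\<bar>\<Sum>j\<le>m. (-1) ^ j * real (m choose j) * F (\<omega> + real (K + j) / 64)\<bar>
        \<le> (\<Sum>j\<le>m. real (m choose j) * B)"
      using assms that
      by (intro order_trans[OF sum_abs] sum_mono) (auto simp: abs_mult power_abs intro!: mult_left_mono)
    also have "\<dots> = real (\<Sum>j\<le>m. m choose j) * B" by (simp add: sum_distrib_right)
    also have "\<dots> = 2 ^ m * B" by (simp only: choose_row_sum) simp
    finally show ?thesis .
  qed
  have "\<bar>extrapolate K F \<omega>\<bar> \<le> (\<Sum>m<K. 2 ^ (K + m) * (2 ^ m * B))"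
    unfolding extrapolate_def
  proof (intro order_trans[OF sum_abs] sum_mono)
    fix m assume m: "m \<in> {..<K}"
    have "(K + m - 1) choose m \<le> 2 ^ (K + m - 1)" by (rule binomial_le_pow2)
    also have "\<dots> \<le> 2 ^ (K + m)" by (intro power_increasing) auto
    finally have "real ((K + m - 1) choose m) \<le> 2 ^ (K + m)"
      by (metis of_nat_le_iff of_nat_numeral of_nat_power)
    then show "\<bar>real ((K + m - 1) choose m) * (\<Sum>j\<le>m. (-1) ^ j * real (m choose j) * F (\<omega> + real (K + j) / 64))\<bar>
        \<le> 2 ^ (K + m) * (2 ^ m * B)"
      unfolding abs_mult using inner[of m] m by (intro mult_mono) auto
  qed
  also have "\<dots> = 2 ^ K * B * (\<Sum>m<K. 4 ^ m)"
  proof -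
    have "2 ^ (K + m) * (2 ^ m * B) = 2 ^ K * B * 4 ^ m" for m
      using power_mult_distrib[of "2::real" 2 m] by (simp add: power_add)
    then show ?thesis unfolding sum_distrib_left by (rule sum.cong[OF refl])
  qed
  also have "(\<Sum>m<K. (4::real) ^ m) \<le> 4 ^ K"
    by (simp add: geometric_sum field_simps)
  finally have "\<bar>extrapolate K F \<omega>\<bar> \<le> 2 ^ K * B * 4 ^ K" using assms(2) by (simp add: mult_left_mono)
  also have "\<dots> = 8 ^ K * B" by (simp add: mult_ac flip: power_mult_distrib)
  finally show ?thesis .
qed

lemma extrapolate_diff:
  "extrapolate K F \<omega> - extrapolate K G \<omega> = extrapolate K (\<lambda>\<alpha>. F \<alpha> - G \<alpha>) \<omega>"
  by (simp add: extrapolate_def right_diff_distrib sum_subtractf)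

text \<open>The nodes are finitely many and independent of z, so extrapolation commutes with the
  integral over the square and acts on cos(\<alpha> x) for each fixed x. The error there is uniform
  in x and passes to the coefficient by Cauchy-Schwarz.\<close>

lemma extrapolate_coef_error:
  assumes f: "f \<in> sq_L2"
  shows "\<bar>coef f \<omega> n - extrapolate (Suc k) (\<lambda>\<alpha>. coef f \<alpha> n) \<omega>\<bar> \<le> sq_norm f / 8 ^ Suc k"
proof -
  let ?K = "Suc k"
  define X where "X z = extrapolate ?K (\<lambda>\<alpha>. mode \<alpha> n z) \<omega>" for z
  have Xcont: "continuous_on UNIV X"
    unfolding X_def extrapolate_def mode_def by (intro continuous_intros continuous_tensor)
  have intg: "integrable sq (\<lambda>z. f z * mode \<alpha> n z)" for \<alpha>
    by (rule L2_mult_integrable[OF f L2_mode])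
  have "extrapolate ?K (\<lambda>\<alpha>. coef f \<alpha> n) \<omega> = ip f X"
    unfolding X_def extrapolate_def coef_def sum_distrib_left
    by (subst Bochner_Integration.integral_sum integral_sum')
      (auto simp: intg mult.left_commute[of "f _"] Bochner_Integration.integral_sum)
  then have "coef f \<omega> n - extrapolate ?K (\<lambda>\<alpha>. coef f \<alpha> n) \<omega> = (LINT z|sq. f z * (mode \<omega> n z - X z))"
    using intg L2_mult_integrable[OF f sq_L2_continuous[OF Xcont]] by (simp add: coef_def right_diff_distrib)
  also have "\<bar>\<dots>\<bar> \<le> sq_norm f * sq_norm (\<lambda>z. mode \<omega> n z - X z)"
    by (intro L2_Cauchy_Schwarz f L2_diff L2_mode sq_L2_continuous Xcont)
  also have "\<dots> \<le> sq_norm f * (1 / 8 ^ ?K)"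
  proof (intro mult_left_mono L2_norm_nonneg)
    have b: "\<bar>mode \<omega> n z - X z\<bar> \<le> 1 / 8 ^ ?K" if "z \<in> unit_square" for z
    proof -
      have "X z = extrapolate ?K (\<lambda>\<alpha>. cos (\<alpha> * fst z)) \<omega> * cos (real n * pi * snd z)"
        by (simp add: X_def extrapolate_def mode_def tensor_def sum_distrib_right mult.assoc del: sum.lessThan_Suc)
      then have "mode \<omega> n z - X z = (cos (\<omega> * fst z) - extrapolate ?K (\<lambda>\<alpha>. cos (\<alpha> * fst z)) \<omega>) * cos (real n * pi * snd z)"
        by (simp add: mode_def tensor_def left_diff_distrib)
      also have "\<bar>\<dots>\<bar> \<le> 1 / 8 ^ ?K * 1"
        unfolding abs_mult using that
        by (intro mult_mono extrapolate_cos_error) (auto simp: mem_unit_square)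
      finally show ?thesis by simp
    qed
    interpret finite_measure sq by (rule finite_measure_lebesgue_on[OF lmeasurable_sq])
    have "(LINT z|sq. (mode \<omega> n z - X z)\<^sup>2) \<le> (LINT z|sq. (1 / 8 ^ ?K)\<^sup>2)"
      using L2_spaceD(2)[OF L2_diff[OF L2_mode sq_L2_continuous[OF Xcont]]] b
      by (intro integral_mono) (auto simp: abs_le_square_iff[symmetric])
    also have "\<dots> = (1 / 8 ^ ?K)\<^sup>2"
      using measure_unit_square lmeasurable_sq by (simp add: measure_restrict_space fmeasurableD)
    finally show "sq_norm (\<lambda>z. mode \<omega> n z - X z) \<le> 1 / 8 ^ ?K"
      unfolding L2_norm_def by (intro real_le_lsqrt) auto
  qed
  finally show ?thesis by simp
qed

section \<open>Expansions in orthogonal families\<close>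

text \<open>The functions are orthogonal but not normalised: \<open>w p\<close> is the reciprocal of
  the squared norm of \<open>E p\<close>. The index set is finite, so that limits are kept apart
  from the algebra.\<close>

locale orthogonal_family =
  fixes E :: "'i \<Rightarrow> real \<times> real \<Rightarrow> real" and w :: "'i \<Rightarrow> real" and I :: "'i set"
  assumes E_L2: "E p \<in> sq_L2"
    and finite_I: "finite I"
    and w_pos: "p \<in> I \<Longrightarrow> 0 < w p"
    and orth: "p \<in> I \<Longrightarrow> q \<in> I \<Longrightarrow> ip (E p) (E q) = (if p = q then 1 / w p else 0)"
begin

text \<open>Pythagoras with arbitrary coefficients: the squared error splits into the squared
  distance from the span and the error of the coefficients. Exact coefficients give
  \<open>Bessel\<close>, extrapolated ones the error of the reconstruction.\<close>

lemma expansion_error: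
  assumes f: "f \<in> sq_L2"
  shows "(sq_norm (\<lambda>z. f z - (\<Sum>p\<in>I. w p * c p * E p z)))\<^sup>2
    = (sq_norm f)\<^sup>2 - (\<Sum>p\<in>I. w p * (ip f (E p))\<^sup>2)
      + (\<Sum>p\<in>I. w p * (c p - ip f (E p))\<^sup>2)"
proof -
  define a where "a p = ip f (E p)" for p
  define S where "S z = (\<Sum>p\<in>I. w p * c p * E p z)" for z
  have S: "S \<in> sq_L2"
    unfolding S_def[abs_def] by (intro L2_sum L2_cmult E_L2)
  have intE: "integrable sq (\<lambda>z. g z * E p z)" if "g \<in> sq_L2" for g p
    by (rule L2_mult_integrable[OF that E_L2])
  have gS: "ip g S = (\<Sum>p\<in>I. w p * c p * ip g (E p))"
    if g: "g \<in> sq_L2" for g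
  proof -
    have "ip g S = (LINT z|sq. (\<Sum>p\<in>I. w p * c p * (g z * E p z)))"
      by (intro LINT_cong) (auto simp: S_def sum_distrib_left mult_ac)
    also have "\<dots> = (\<Sum>p\<in>I. (LINT z|sq. w p * c p * (g z * E p z)))"
      by (rule Bochner_Integration.integral_sum) (simp add: intE[OF g])
    finally show ?thesis by simp
  qed
  have ES: "ip S (E q) = c q" if q: "q \<in> I" for q
  proof -
    have "ip S (E q) = ip (E q) S" by (simp add: mult.commute)
    also have "\<dots> = (\<Sum>p\<in>I. w p * c p * ip (E q) (E p))" by (rule gS[OF E_L2])
    also have "\<dots> = (\<Sum>p\<in>I. if q = p then c p else 0)"
      using w_pos[OF q] q by (intro sum.cong) (auto simp: orth)
    also have "\<dots> = c q" using q finite_I by simp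
    finally show ?thesis .
  qed
  have SS: "ip S S = (\<Sum>p\<in>I. w p * (c p)\<^sup>2)"
    unfolding gS[OF S] by (intro sum.cong) (simp_all add: ES power2_eq_square)
  have fS: "ip f S = (\<Sum>p\<in>I. w p * c p * a p)" unfolding gS[OF f] a_def ..
  note ints = L2_spaceD(2)[OF f] L2_mult_integrable[OF f S] L2_mult_integrable[OF S S]
  have "(sq_norm (\<lambda>z. f z - S z))\<^sup>2 = (LINT z|sq. ((f z)\<^sup>2 - 2 * (f z * S z)) + S z * S z)"
    unfolding L2_norm_power2 by (intro LINT_cong) (auto simp: power2_eq_square algebra_simps)
  also have "\<dots> = (sq_norm f)\<^sup>2 - 2 * ip f S + ip S S"
    using ints by (simp add: L2_norm_power2)
  also have "\<dots> = (sq_norm f)\<^sup>2 - (\<Sum>p\<in>I. w p * (a p)\<^sup>2) + (\<Sum>p\<in>I. w p * (c p - a p)\<^sup>2)"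
    unfolding SS fS
    by (simp add: power2_diff algebra_simps sum.distrib sum_subtractf sum_distrib_left)
  finally show ?thesis by (simp add: S_def a_def)
qed

lemma Bessel:
  assumes "f \<in> sq_L2"
  shows "(\<Sum>p\<in>I. w p * (ip f (E p))\<^sup>2) \<le> (sq_norm f)\<^sup>2"
  using expansion_error[OF assms, of "\<lambda>p. LINT z|sq. f z * E p z"]
    zero_le_power2[of "sq_norm (\<lambda>z. f z - (\<Sum>p\<in>I. w p * ip f (E p) * E p z))"]
  by simp

end

section \<open>Orthogonality of the cosine and sine-cosine products\<close>

definition amp :: "nat \<Rightarrow> real" where
  "amp k = (if k = 0 then 1 else 2)"

lemma integral_cos_int:
  "integral {0..1} (\<lambda>x. cos (real_of_int k * pi * x)) = (if k = 0 then 1 else 0)"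
proof (cases "k = 0")
  case False
  have "((\<lambda>x. cos (real_of_int k * pi * x)) has_integral
      sin (real_of_int k * pi * 1) / (real_of_int k * pi) - sin (real_of_int k * pi * 0) / (real_of_int k * pi)) {0..1}"
    by (rule fundamental_theorem_of_calculus)
      (use False in \<open>auto intro!: derivative_eq_intros simp: has_real_derivative_iff_has_vector_derivative[symmetric]\<close>)
  moreover have "sin (real_of_int k * pi) = 0" using sin_zero_iff_int2 by blast
  ultimately show ?thesis using False by (simp add: integral_unique)
qed simp

lemma integral_cos_cos:
  "integral {0..1} (\<lambda>x. cos (real k * pi * x) * cos (real l * pi * x)) = (if k = l then 1 / amp k else 0)"
proof -
  have "integral {0..1} (\<lambda>x. cos (real k * pi * x) * cos (real l * pi * x))
      = integral {0..1} (\<lambda>x. (cos (real_of_int (int k - int l) * pi * x) + cos (real_of_int (int k + int l) * pi * x)) / 2)"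
    by (intro integral_cong) (simp add: cos_times_cos algebra_simps)
  also have "\<dots> = (integral {0..1} (\<lambda>x. cos (real_of_int (int k - int l) * pi * x))
      + integral {0..1} (\<lambda>x. cos (real_of_int (int k + int l) * pi * x))) / 2"
    unfolding integral_divide
    by (subst Henstock_Kurzweil_Integration.integral_add) (auto intro!: integrable_continuous_interval continuous_intros)
  finally show ?thesis unfolding integral_cos_int by (auto simp: amp_def)
qed

lemma integral_sin_sin:
  assumes "0 < k"
  shows "integral {0..1} (\<lambda>x. sin (real k * pi * x) * sin (real l * pi * x)) = (if k = l then 1 / amp k else 0)"
proof -
  have "integral {0..1} (\<lambda>x. sin (real k * pi * x) * sin (real l * pi * x))
      = integral {0..1} (\<lambda>x. (cos (real_of_int (int k - int l) * pi * x) - cos (real_of_int (int k + int l) * pi * x)) / 2)"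
    by (intro integral_cong) (simp add: sin_times_sin algebra_simps)
  also have "\<dots> = (integral {0..1} (\<lambda>x. cos (real_of_int (int k - int l) * pi * x))
      - integral {0..1} (\<lambda>x. cos (real_of_int (int k + int l) * pi * x))) / 2"
    unfolding integral_divide
    by (subst Henstock_Kurzweil_Integration.integral_diff) (auto intro!: integrable_continuous_interval continuous_intros)
  finally show ?thesis using assms unfolding integral_cos_int by (auto simp: amp_def)
qed

lemma tensor_mult: "tensor a b z * tensor a' b' z = tensor (\<lambda>x. a x * a' x) (\<lambda>y. b y * b' y) z"
  by (simp add: tensor_def)

lemma amp_pos: "0 < amp k"
  by (simp add: amp_def)

text \<open>The reciprocal of the squared norm of \<open>cosmode p\<close>; \<open>amp k\<close> is
  the reciprocal of the integral of cos^2(k pi x) over the unit interval.\<close>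

definition pweight :: "nat \<times> nat \<Rightarrow> real" where
  "pweight p = amp (fst p) * amp (snd p)"

definition cosmode :: "nat \<times> nat \<Rightarrow> real \<times> real \<Rightarrow> real" where
  "cosmode p = mode (real (fst p) * pi) (snd p)"

definition grid :: "nat \<Rightarrow> (nat \<times> nat) set" where
  "grid N = {..N} \<times> {..N}"

lemma finite_grid: "finite (grid N)"
  by (simp add: grid_def)

lemma pweight_bounds: "1 \<le> pweight p" "pweight p \<le> 4"
  by (auto simp: pweight_def amp_def)

lemma orthogonal_cosmode:
  "finite I \<Longrightarrow> orthogonal_family cosmode pweight I"
proof
  fix p q :: "nat \<times> nat"
  show "cosmode p \<in> sq_L2" unfolding cosmode_def by (rule L2_mode)
  show "0 < pweight p" by (simp add: pweight_def amp_pos)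
  show "ip (cosmode p) (cosmode q) = (if p = q then 1 / pweight p else 0)"
    unfolding cosmode_def mode_def tensor_mult
    by (subst sq_integral_tensor)
      (auto simp: integral_cos_cos pweight_def prod_eq_iff intro!: continuous_intros)
qed

lemma dtensor_mult: "dtensor i a b z * dtensor i a' b' z = dtensor i (\<lambda>x. a x * a' x) (\<lambda>y. b y * b' y) z"
  by (simp add: dtensor_def tensor_def)

lemma sq_integral_dtensor:
  "continuous_on UNIV a \<Longrightarrow> continuous_on UNIV b \<Longrightarrow>
    (LINT z|sq. dtensor i a b z) = integral {0..1} a * integral {0..1} b"
  by (simp add: dtensor_def sq_integral_tensor)

text \<open>Up to constant factors these are the derivatives of cosine modes in direction i. A
  positive index along i excludes the zero function sin(0).\<close>

lemma orthogonal_dtensor_sin_cos: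
  assumes "finite I" "\<And>p. p \<in> I \<Longrightarrow> 0 < fst p"
  shows "orthogonal_family
    (\<lambda>p. dtensor i (\<lambda>x. sin (real (fst p) * pi * x)) (\<lambda>y. cos (real (snd p) * pi * y))) pweight I"
    (is "orthogonal_family ?E pweight I")
proof
  fix p q :: "nat \<times> nat"
  show "?E p \<in> sq_L2" by (intro sq_L2_dtensor continuous_intros)
  show "0 < pweight p" by (simp add: pweight_def amp_pos)
  assume "p \<in> I"
  then have "0 < fst p" by (rule assms(2))
  then show "ip (?E p) (?E q) = (if p = q then 1 / pweight p else 0)"
    unfolding dtensor_mult
    by (subst sq_integral_dtensor)
      (auto simp: integral_cos_cos integral_sin_sin pweight_def prod_eq_iff intro!: continuous_intros)
qed (rule assms(1))

definition fcoef :: "(real \<times> real \<Rightarrow> real) \<Rightarrow> nat \<times> nat \<Rightarrow> real" where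
  "fcoef f p = ip f (cosmode p)"

definition synth :: "nat \<Rightarrow> (nat \<times> nat \<Rightarrow> real) \<Rightarrow> real \<times> real \<Rightarrow> real" where
  "synth N c z = (\<Sum>p\<in>grid N. pweight p * c p * cosmode p z)"

text \<open>By \<open>synth_error\<close> with exact coefficients, this is the squared distance of f
  from its partial cosine sum. Written as the defect in Bessel's inequality, differences of tails
  are finite sums of nonnegative terms.\<close>

definition tail :: "(real \<times> real \<Rightarrow> real) \<Rightarrow> nat \<Rightarrow> real" where
  "tail f N = (sq_norm f)\<^sup>2 - (\<Sum>p\<in>grid N. pweight p * (fcoef f p)\<^sup>2)"

lemma pweight_nonneg: "0 \<le> pweight p"
  using pweight_bounds(1)[of p] by linarith

lemma synth_error:
  assumes "f \<in> sq_L2"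
  shows "(sq_norm (\<lambda>z. f z - synth N c z))\<^sup>2
    = tail f N + (\<Sum>p\<in>grid N. pweight p * (c p - fcoef f p)\<^sup>2)"
  using orthogonal_family.expansion_error[OF orthogonal_cosmode[OF finite_grid] assms]
  by (simp add: synth_def tail_def fcoef_def)

lemma tail_nonneg: "f \<in> sq_L2 \<Longrightarrow> 0 \<le> tail f N"
  using orthogonal_family.Bessel[OF orthogonal_cosmode[OF finite_grid]]
  by (simp add: tail_def fcoef_def)

lemma grid_mono: "N \<le> M \<Longrightarrow> grid N \<subseteq> grid M"
  by (auto simp: grid_def)

lemma tail_split:
  assumes "N \<le> M"
  shows "tail f N = tail f M + (\<Sum>p\<in>grid M - grid N. pweight p * (fcoef f p)\<^sup>2)"
  using sum.subset_diff[OF grid_mono[OF assms] finite_grid, of "\<lambda>p. pweight p * (fcoef f p)\<^sup>2"]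
  by (simp add: tail_def)

lemma tail_antimono:
  assumes "N \<le> M"
  shows "tail f M \<le> tail f N"
  unfolding tail_split[OF assms] by (simp add: sum_nonneg pweight_nonneg)

section \<open>Completeness of the cosine system\<close>

inductive_set cospoly :: "(real \<times> real \<Rightarrow> real) set" where
  cosmode: "cosmode p \<in> cospoly"
| scale: "f \<in> cospoly \<Longrightarrow> (\<lambda>z. c * f z) \<in> cospoly"
| add: "f \<in> cospoly \<Longrightarrow> g \<in> cospoly \<Longrightarrow> (\<lambda>z. f z + g z) \<in> cospoly"

text \<open>The product-to-sum formula in each variable, with the absolute difference of frequencies
  because indices are natural numbers. It makes the cosine polynomials an algebra, as
  Stone-Weierstrass demands.\<close>

lemma cosmode_mult:
  obtains p1 p2 p3 p4 where
    "\<And>z. cosmode p z * cosmode q z = (1/4) * cosmode p1 z + (1/4) * cosmode p2 z + (1/4) * cosmode p3 z + (1/4) * cosmode p4 z"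
proof -
  define d where "d k l = (if k \<le> l then l - k else k - l)" for k l :: nat
  have c: "cos (real k * pi * x) * cos (real l * pi * x)
      = (cos (real (d k l) * pi * x) + cos (real (k + l) * pi * x)) / 2" for k l x
  proof -
    have "cos (real (d k l) * pi * x) = cos (real k * pi * x - real l * pi * x)"
    proof (cases "k \<le> l")
      case True
      then have "real (d k l) * pi * x = - (real k * pi * x - real l * pi * x)"
        by (simp add: d_def of_nat_diff algebra_simps)
      then show ?thesis by (metis cos_minus)
    next
      case False
      then have "real (d k l) * pi * x = real k * pi * x - real l * pi * x"
        by (simp add: d_def of_nat_diff algebra_simps)
      then show ?thesis by simp
    qed
    then show ?thesis by (simp add: cos_times_cos algebra_simps)
  qed
  obtain k n l m where p: "p = (k, n)" and q: "q = (l, m)" by fastforce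
  have "cosmode p z * cosmode q z
      = (cos (real k * pi * fst z) * cos (real l * pi * fst z)) * (cos (real n * pi * snd z) * cos (real m * pi * snd z))" for z
    by (simp add: p q cosmode_def mode_def tensor_def)
  also have "\<dots> z = (1/4) * cosmode (d k l, d n m) z + (1/4) * cosmode (d k l, n + m) z
      + (1/4) * cosmode (k + l, d n m) z + (1/4) * cosmode (k + l, n + m) z" for z
    unfolding c by (simp add: cosmode_def mode_def tensor_def field_simps)
  finally show ?thesis by (rule that)
qed

lemma cospoly_mult_cosmode: "f \<in> cospoly \<Longrightarrow> (\<lambda>z. f z * cosmode q z) \<in> cospoly"
proof (induction rule: cospoly.induct)
  case (cosmode p)
  obtain p1 p2 p3 p4 where *:
    "\<And>z. cosmode p z * cosmode q z = (1/4) * cosmode p1 z + (1/4) * cosmode p2 z + (1/4) * cosmode p3 z + (1/4) * cosmode p4 z"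
    using cosmode_mult by blast
  show ?case unfolding * by (intro cospoly.intros)
next
  case (scale f c)
  then show ?case using cospoly.scale[of "\<lambda>z. f z * cosmode q z" c] by (simp add: mult.assoc)
next
  case (add f g)
  then show ?case using cospoly.add[OF add.IH] by (simp add: distrib_right)
qed

lemma cospoly_mult:
  assumes f: "f \<in> cospoly" and "g \<in> cospoly"
  shows "(\<lambda>z. f z * g z) \<in> cospoly"
  using assms(2)
proof (induction rule: cospoly.induct)
  case (cosmode p)
  then show ?case by (rule cospoly_mult_cosmode[OF f])
next
  case (scale g c)
  then show ?case using cospoly.scale[of "\<lambda>z. f z * g z" c] by (simp add: mult_ac)
next
  case (add g h)
  then show ?case using cospoly.add[OF add.IH] by (simp add: distrib_left)
qed

lemma continuous_cosmode: "continuous_on UNIV (cosmode p)"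
  unfolding cosmode_def mode_def by (intro continuous_tensor continuous_intros)

lemma cospoly_continuous: "f \<in> cospoly \<Longrightarrow> continuous_on UNIV f"
  by (induction rule: cospoly.induct) (auto intro: continuous_cosmode continuous_intros)

text \<open>Requiring zero coefficients off the grid allows the grid to be enlarged, so that two
  polynomials can be added on a common one.\<close>

lemma cospoly_synth:
  assumes "f \<in> cospoly"
  shows "\<exists>N c. (\<forall>p. p \<notin> grid N \<longrightarrow> c p = 0) \<and> f = synth N c"
  using assms
proof (induction rule: cospoly.induct)
  case (cosmode p)
  define N where "N = max (fst p) (snd p)"
  have p: "p \<in> grid N" by (cases p) (auto simp: grid_def N_def)
  have pos: "pweight p \<noteq> 0" using pweight_bounds(1)[of p] by linarith
  have "cosmode p = synth N (\<lambda>q. if q = p then 1 / pweight p else 0)"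
  proof
    fix z
    have "synth N (\<lambda>q. if q = p then 1 / pweight p else 0) z = (\<Sum>q\<in>grid N. if q = p then cosmode p z else 0)"
      unfolding synth_def using pos by (intro sum.cong) auto
    then show "cosmode p z = synth N (\<lambda>q. if q = p then 1 / pweight p else 0) z"
      using p by (simp add: finite_grid)
  qed
  then show ?case using p by (intro exI[of _ N] exI[of _ "\<lambda>q. if q = p then 1 / pweight p else 0"]) auto
next
  case (scale f a)
  then obtain N c where *: "\<forall>p. p \<notin> grid N \<longrightarrow> c p = 0" "f = synth N c" by blast
  then show ?case
    by (intro exI[of _ N] exI[of _ "\<lambda>p. a * c p"]) (auto simp: synth_def sum_distrib_left mult_ac)
next
  case (add f g)
  then obtain N c M d where *: "\<forall>p. p \<notin> grid N \<longrightarrow> c p = 0" "f = synth N c"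
      "\<forall>p. p \<notin> grid M \<longrightarrow> d p = 0" "g = synth M d" by blast
  have ext: "synth N c = synth (max N M) c" if "\<forall>p. p \<notin> grid N \<longrightarrow> c p = 0" for N M c
  proof
    fix z show "synth N c z = synth (max N M) c z"
      unfolding synth_def using that
      by (intro sum.mono_neutral_left finite_grid grid_mono) auto
  qed
  have "(\<lambda>z. f z + g z) = synth (max N M) (\<lambda>p. c p + d p)"
    unfolding *(2,4) ext[OF *(1), of M] ext[OF *(3), of N] max.commute[of M N]
    by (simp add: synth_def fun_eq_iff sum.distrib distrib_left distrib_right)
  moreover have "\<forall>p. p \<notin> grid (max N M) \<longrightarrow> c p + d p = 0"
  proof (intro allI impI)
    fix p assume "p \<notin> grid (max N M)"
    then have "p \<notin> grid N" "p \<notin> grid M"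
      using grid_mono[of N "max N M"] grid_mono[of M "max N M"] by auto
    then have "c p = 0" "d p = 0" using *(1,3) by blast+
    then show "c p + d p = 0" by simp
  qed
  ultimately show ?case by (intro exI[of _ "max N M"] exI[of _ "\<lambda>p. c p + d p"] conjI)
qed

text \<open>Stone-Weierstrass on the closed square: modes of frequency 1 in one variable separate
  points, since cos(pi x) is injective on [0, 1].\<close>

lemma cospoly_dense:
  fixes g :: "real \<times> real \<Rightarrow> real"
  assumes "continuous_on UNIV g" "0 < e"
  obtains h where "h \<in> cospoly" "\<And>z. z \<in> unit_square \<Longrightarrow> \<bar>g z - h z\<bar> < e"
proof -
  let ?S = "cbox (0, 0) (1, 1) :: (real \<times> real) set"
  have const: "(\<lambda>_. c) \<in> cospoly" for c
    using cospoly.scale[OF cospoly.cosmode[of "(0,0)"], of c] by (simp add: cosmode_def mode_def tensor_def)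
  have inj: "x = y" if "cos (pi * x) = cos (pi * y)" "0 \<le> x" "x \<le> 1" "0 \<le> y" "y \<le> 1" for x y
  proof -
    have r: "0 \<le> pi * t" "pi * t \<le> pi" if "0 \<le> t" "t \<le> 1" for t
      using that mult_left_mono[of t 1 pi] by auto
    have "pi * x = pi * y" by (rule cos_inj_pi) (fact r that(1) r[OF that(2,3)] r[OF that(4,5)])+
    then show ?thesis by simp
  qed
  interpret function_ring_on cospoly ?S
  proof
    show "continuous_on ?S f" if "f \<in> cospoly" for f
      using cospoly_continuous[OF that] continuous_on_subset by blast
    fix x y :: "real \<times> real" assume xy: "x \<in> ?S" "y \<in> ?S" "x \<noteq> y"
    show "\<exists>f\<in>cospoly. f x \<noteq> f y"
    proof (cases "fst x = fst y")
      case True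
      then have "cosmode (0, 1) x \<noteq> cosmode (0, 1) y"
        using xy inj[of "snd x" "snd y"] by (cases x; cases y) (auto simp: cosmode_def mode_def tensor_def)
      then show ?thesis using cospoly.cosmode by blast
    next
      case False
      then have "cosmode (1, 0) x \<noteq> cosmode (1, 0) y"
        using xy inj[of "fst x" "fst y"] by (cases x; cases y) (auto simp: cosmode_def mode_def tensor_def)
      then show ?thesis using cospoly.cosmode by blast
    qed
  qed (auto intro: cospoly.add cospoly_mult const)
  have "continuous_on ?S g" using assms(1) continuous_on_subset by blast
  then obtain F where F: "F \<in> UNIV \<rightarrow> cospoly" "uniform_limit ?S F g sequentially"
    using Stone_Weierstrass by blast
  from uniform_limitD[OF F(2) assms(2)] obtain n where n: "\<forall>z\<in>?S. dist (F n z) (g z) < e"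
    by (auto simp: eventually_sequentially)
  show ?thesis
  proof (rule that[of "F n"])
    show "F n \<in> cospoly" using F(1) by auto
    fix z assume "z \<in> unit_square"
    then have "z \<in> ?S" unfolding unit_square_box using box_subset_cbox by blast
    then show "\<bar>g z - F n z\<bar> < e" using n by (auto simp: dist_real_def abs_minus_commute)
  qed
qed

lemma L2_norm_tendsto_0_dominated:
  assumes "\<And>j::nat. f j \<in> borel_measurable (lebesgue_on S)" "integrable (lebesgue_on S) g"
    and "AE x in lebesgue_on S. (\<lambda>j. f j x) \<longlonglongrightarrow> 0"
    and "\<And>j x. x \<in> S \<Longrightarrow> (f j x)\<^sup>2 \<le> g x"
  shows "(\<lambda>j. L2_norm S (f j)) \<longlonglongrightarrow> 0"
proof -
  have "(\<lambda>j. LINT x|lebesgue_on S. (f j x)\<^sup>2) \<longlonglongrightarrow> (LINT x|lebesgue_on S. 0)"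
  proof (rule integral_dominated_convergence[OF _ _ assms(2)])
    show "AE x in lebesgue_on S. (\<lambda>j. (f j x)\<^sup>2) \<longlonglongrightarrow> 0"
      using assms(3)
    proof eventually_elim
      case (elim x)
      show ?case using tendsto_power[OF elim, of 2] by simp
    qed
    show "AE x in lebesgue_on S. norm ((f j x)\<^sup>2) \<le> g x" for j
      using assms(4) by (intro AE_I2) auto
  qed (use assms(1) in auto)
  then show ?thesis unfolding L2_norm_def using tendsto_real_sqrt by fastforce
qed

definition clip :: "real \<Rightarrow> real \<Rightarrow> real" where
  "clip M x = max (- M) (min M x)"

lemma clip_bound: "0 \<le> M \<Longrightarrow> \<bar>clip M x\<bar> \<le> M"
  by (auto simp: clip_def)

lemma continuous_clip: "continuous_on UNIV (clip M)"
  unfolding clip_def by (intro continuous_intros)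

lemma measurable_clip: "f \<in> borel_measurable N \<Longrightarrow> (\<lambda>x. clip M (f x)) \<in> borel_measurable N"
  unfolding clip_def by simp

lemma L2_clip: "0 \<le> M \<Longrightarrow> f \<in> borel_measurable sq \<Longrightarrow> (\<lambda>z. clip M (f z)) \<in> sq_L2"
  by (rule L2_bounded[OF lmeasurable_sq measurable_clip clip_bound])

lemma clip_approx:
  assumes f: "f \<in> sq_L2"
  shows "(\<lambda>j. sq_norm (\<lambda>z. f z - clip (real j) (f z))) \<longlonglongrightarrow> 0"
proof (rule L2_norm_tendsto_0_dominated[OF _ L2_spaceD(2)[OF f]])
  show "(\<lambda>z. f z - clip (real j) (f z)) \<in> borel_measurable sq" for j
    by (intro borel_measurable_diff measurable_clip L2_spaceD(1)[OF f])
  show "AE z in sq. (\<lambda>j. f z - clip (real j) (f z)) \<longlonglongrightarrow> 0"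
  proof (rule AE_I2)
    fix z
    obtain n where n: "\<bar>f z\<bar> \<le> real n" using real_arch_simple by blast
    have "\<forall>\<^sub>F j in sequentially. 0 = f z - clip (real j) (f z)"
      using eventually_ge_at_top[of n]
    proof eventually_elim
      case (elim j)
      then have "\<bar>f z\<bar> \<le> real j" using n by linarith
      then show ?case by (auto simp: clip_def)
    qed
    then show "(\<lambda>j. f z - clip (real j) (f z)) \<longlonglongrightarrow> 0"
      by (rule Lim_transform_eventually[OF tendsto_const])
  qed
  show "(f z - clip (real j) (f z))\<^sup>2 \<le> (f z)\<^sup>2" for j z
    unfolding abs_le_square_iff[symmetric] by (auto simp: clip_def)
qed

text \<open>Measurability provides continuous functions that converge to f almost everywhere on the
  square. Clipping both sides at M bounds the squared difference by the constant (2 M)^2, which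
  turns pointwise convergence into convergence in L2.\<close>

lemma continuous_approx_clip:
  assumes f: "f \<in> borel_measurable sq" and M: "0 \<le> M"
  obtains g where "\<And>n::nat. continuous_on UNIV (g n)"
    "(\<lambda>n. sq_norm (\<lambda>z. clip M (f z) - g n z)) \<longlonglongrightarrow> 0"
proof -
  have "f measurable_on unit_square"
    using f lmeasurable_sq by (simp add: measurable_on_iff_borel_measurable fmeasurableD)
  then obtain N g where N: "negligible N" and g: "\<And>n. continuous_on UNIV (g n)"
    and lim: "\<And>x. x \<notin> N \<Longrightarrow> (\<lambda>n. g n x) \<longlonglongrightarrow> (if x \<in> unit_square then f x else 0)"
    unfolding measurable_on_def by blast
  have gc: "continuous_on UNIV (\<lambda>z. clip M (g n z))" for n
    using continuous_on_compose2[OF continuous_clip g[of n]] by auto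
  have "(\<lambda>n. sq_norm (\<lambda>z. clip M (f z) - clip M (g n z))) \<longlonglongrightarrow> 0"
  proof (rule L2_norm_tendsto_0_dominated[where g = "\<lambda>_. (2 * M)\<^sup>2"])
    show "(\<lambda>z. clip M (f z) - clip M (g j z)) \<in> borel_measurable sq" for j
      using measurable_clip[OF f] continuous_measurable_lebesgue_on[OF gc] by auto
    show "integrable sq (\<lambda>_. (2 * M)\<^sup>2)"
      by (rule L2_integrable[OF lmeasurable_sq L2_const[OF lmeasurable_sq]])
    have "AE z in lebesgue. z \<notin> N"
      using N AE_not_in negligible_iff_null_sets by blast
    then have "AE z in sq. z \<notin> N"
      using lmeasurable_sq by (simp add: AE_restrict_space_iff fmeasurableD) (auto elim: eventually_mono)
    then show "AE z in sq. (\<lambda>n. clip M (f z) - clip M (g n z)) \<longlonglongrightarrow> 0"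
      using AE_space
    proof eventually_elim
      case (elim z)
      then have "(\<lambda>n. g n z) \<longlonglongrightarrow> f z" using lim[of z] by auto
      then have "(\<lambda>n. clip M (g n z)) \<longlonglongrightarrow> clip M (f z)"
        unfolding clip_def by (intro tendsto_intros)
      from tendsto_diff[OF tendsto_const this, of "clip M (f z)"] show ?case by simp
    qed
    show "(clip M (f z) - clip M (g j z))\<^sup>2 \<le> (2 * M)\<^sup>2" for j z
      using clip_bound[OF M, of "f z"] clip_bound[OF M, of "g j z"]
      unfolding abs_le_square_iff[symmetric] by linarith
  qed
  then show ?thesis by (rule that[of "\<lambda>n z. clip M (g n z)", OF gc])
qed

lemma L2_norm_le_bound:
  assumes "f \<in> sq_L2" "0 \<le> B" "\<And>z. z \<in> unit_square \<Longrightarrow> \<bar>f z\<bar> \<le> B"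
  shows "sq_norm f \<le> B"
proof -
  have "(LINT z|sq. (f z)\<^sup>2) \<le> (LINT z|sq. B\<^sup>2)"
  proof (intro integral_mono)
    show "integrable sq (\<lambda>_. B\<^sup>2)"
      by (rule L2_integrable[OF lmeasurable_sq L2_const[OF lmeasurable_sq]])
    show "(f z)\<^sup>2 \<le> B\<^sup>2" if "z \<in> space sq" for z
      using assms(2) assms(3)[of z] that by (simp add: abs_le_square_iff[symmetric])
  qed (rule L2_spaceD(2)[OF assms(1)])
  also have "\<dots> = B\<^sup>2"
    using measure_unit_square lmeasurable_sq by (simp add: measure_restrict_space fmeasurableD)
  finally show ?thesis unfolding L2_norm_def using assms(2) by (intro real_le_lsqrt) auto
qed

lemma L2_synth: "synth N c \<in> sq_L2"
  unfolding synth_def[abs_def] cosmode_def by (intro L2_sum L2_cmult L2_mode)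

text \<open>f is approximated by a clipped function, that one by a continuous function, and this by
  a cosine polynomial, which is a synthesis on some grid. A partial sum is the best approximation on
  its grid, so the distance of the polynomial from f bounds the tail from that grid on.\<close>

lemma tail_tendsto_0:
  assumes f: "f \<in> sq_L2"
  shows "(\<lambda>N. tail f N) \<longlonglongrightarrow> 0"
proof (rule LIMSEQ_I)
  fix r :: real assume r: "0 < r"
  \<comment> \<open>Three approximations cost at most e each, and (3 e)^2 = 9 r / 16 is below
    r.\<close>
  define e where "e = sqrt r / 4"
  have e: "0 < e" using r by (simp add: e_def)
  from LIMSEQ_D[OF clip_approx[OF f] e] obtain j where j: "sq_norm (\<lambda>z. f z - clip (real j) (f z)) < e"
    by (auto simp: abs_less_iff)
  obtain g where gc: "\<And>n::nat. continuous_on UNIV (g n)"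
    and gl: "(\<lambda>n. sq_norm (\<lambda>z. clip (real j) (f z) - g n z)) \<longlonglongrightarrow> 0"
    using continuous_approx_clip[OF L2_spaceD(1)[OF f], of "real j"] by auto
  from LIMSEQ_D[OF gl e] obtain n where n: "sq_norm (\<lambda>z. clip (real j) (f z) - g n z) < e"
    by (auto simp: abs_less_iff)
  obtain h where h: "h \<in> cospoly" "\<And>z. z \<in> unit_square \<Longrightarrow> \<bar>g n z - h z\<bar> < e"
    using cospoly_dense[OF gc e] by blast
  note L = f L2_clip[OF of_nat_0_le_iff L2_spaceD(1)[OF f], of j] sq_L2_continuous[OF gc[of n]]
    sq_L2_continuous[OF cospoly_continuous[OF h(1)]]
  have "sq_norm (\<lambda>z. g n z - h z) \<le> e"
    using h(2) e by (intro L2_norm_le_bound L2_diff L) (auto intro: less_imp_le)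
  then have lt: "sq_norm (\<lambda>z. f z - h z) < 3 * e"
    using L2_norm_diff_triangle[OF L(1,2,3)] L2_norm_diff_triangle[OF L(1,3,4)] j n by linarith
  obtain N c where hN: "h = synth N c" using cospoly_synth[OF h(1)] by blast
  have "tail f N \<le> (sq_norm (\<lambda>z. f z - h z))\<^sup>2"
    unfolding hN synth_error[OF f]
    by (simp add: sum_nonneg pweight_nonneg)
  also have "\<dots> \<le> (3 * e)\<^sup>2" using lt L2_norm_nonneg by (intro power_mono) auto
  also have "\<dots> < r" using r by (simp add: e_def power_mult_distrib power_divide)
  finally have "tail f N < r" .
  then show "\<exists>N. \<forall>M\<ge>N. norm (tail f M - 0) < r"
    using tail_antimono[of N _ f] tail_nonneg[OF f] by (intro exI[of _ N]) (auto intro: le_less_trans)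
qed

text \<open>The sine factor vanishes linearly at both ends of direction i, so
  \<open>interior_Green\<close> applies whatever f does at the boundary: up to sign, k pi times a
  cosine coefficient of f is a sine-cosine coefficient of w, and Bessel's inequality for w applies.
  The first index is always the one along i; \<open>prod.swap\<close> restores the order of
  coordinates in the other direction.\<close>

lemma weak_partial_Bessel:
  assumes w: "has_weak_partial unit_square i f w" and i: "i \<in> Basis"
    and I: "finite I" "\<And>p. p \<in> I \<Longrightarrow> 0 < fst p"
  shows "(\<Sum>p\<in>I. pweight p * ((real (fst p))\<^sup>2 * (fcoef f (if i = (1, 0) then p else prod.swap p))\<^sup>2))
    \<le> (sq_norm w)\<^sup>2" (is "(\<Sum>p\<in>I. pweight p * ((real (fst p))\<^sup>2 * (?c p)\<^sup>2)) \<le> _")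
proof -
  let ?s = "\<lambda>k::nat. \<lambda>x. sin (real k * pi * x)" and ?b = "\<lambda>k::nat. \<lambda>x. cos (real k * pi * x)"
  have c: "(LINT z|sq. w z * dtensor i (?s (fst p)) (?b (snd p)) z) = - (real (fst p) * pi) * ?c p" for p
  proof -
    have "(LINT z|sq. w z * dtensor i (?s (fst p)) (?b (snd p)) z)
        = - (LINT z|sq. f z * dtensor i (\<lambda>x. real (fst p) * pi * cos (real (fst p) * pi * x)) (?b (snd p)) z)"
      by (rule interior_Green[OF w i smooth_real_sin smooth_real_cos, where L = "real (fst p) * pi"])
        (auto simp: sin_npi_bounds intro!: derivative_eq_intros)
    also have "(LINT z|sq. f z * dtensor i (\<lambda>x. real (fst p) * pi * cos (real (fst p) * pi * x)) (?b (snd p)) z)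
        = (LINT z|sq. (real (fst p) * pi) * (f z * cosmode (if i = (1, 0) then p else prod.swap p) z))"
      by (intro LINT_cong) (auto simp: dtensor_def tensor_def cosmode_def mode_def)
    finally show ?thesis by (simp add: fcoef_def)
  qed
  have "(\<Sum>p\<in>I. pweight p * ((real (fst p))\<^sup>2 * (?c p)\<^sup>2))
      \<le> (\<Sum>p\<in>I. pweight p * (LINT z|sq. w z * dtensor i (?s (fst p)) (?b (snd p)) z)\<^sup>2)"
  proof (intro sum_mono mult_left_mono pweight_nonneg)
    fix p
    have "(real (fst p))\<^sup>2 * 1 * (?c p)\<^sup>2 \<le> (real (fst p))\<^sup>2 * pi\<^sup>2 * (?c p)\<^sup>2"
      using pi_ge_two by (intro mult_right_mono mult_left_mono) (auto intro!: one_le_power)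
    then show "(real (fst p))\<^sup>2 * (?c p)\<^sup>2 \<le> (LINT z|sq. w z * dtensor i (?s (fst p)) (?b (snd p)) z)\<^sup>2"
      unfolding c by (simp add: power_mult_distrib)
  qed
  also have "\<dots> \<le> (sq_norm w)\<^sup>2"
    by (rule orthogonal_family.Bessel[OF orthogonal_dtensor_sin_cos[OF I] has_weak_partialD(2)[OF w]])
  finally show ?thesis .
qed

text \<open>Outside \<open>grid N\<close> at least one of the two indices exceeds N, and each of the
  two cases is controlled by one partial derivative. This bounds the finite sums over
  \<open>grid M - grid N\<close> uniformly in M; letting M grow reaches the tail itself by
  \<open>tail_tendsto_0\<close>.\<close>

lemma tail_H1_bound:
  assumes f: "f \<in> H1_space unit_square"
  obtains B where "0 \<le> B" "\<And>N. tail f N \<le> B / (real (Suc N))\<^sup>2"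
proof -
  define w1 w2 where "w1 = weak_partial unit_square (1, 0) f" and "w2 = weak_partial unit_square (0, 1) f"
  have d: "has_weak_partial unit_square (1, 0) f w1" "has_weak_partial unit_square (0, 1) f w2"
    using f by (auto simp: w1_def w2_def Basis_plane intro!: H1_weak_partial)
  have fL: "f \<in> sq_L2" using has_weak_partialD(1)[OF d(1)] .
  define B where "B = (sq_norm w1)\<^sup>2 + (sq_norm w2)\<^sup>2"
  have D1: "(1, 0) \<in> (Basis :: (real \<times> real) set)" and D2: "(0, 1) \<in> (Basis :: (real \<times> real) set)"
    by (simp_all add: Basis_plane)
  have b1: "(\<Sum>p\<in>I. pweight p * ((real (fst p))\<^sup>2 * (fcoef f p)\<^sup>2)) \<le> (sq_norm w1)\<^sup>2"
    if "finite I" "\<And>p. p \<in> I \<Longrightarrow> 0 < fst p" for I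
    using weak_partial_Bessel[OF d(1) D1 that] by simp
  have b2: "(\<Sum>p\<in>I. pweight p * ((real (snd p))\<^sup>2 * (fcoef f p)\<^sup>2)) \<le> (sq_norm w2)\<^sup>2"
    if "finite I" "\<And>p. p \<in> I \<Longrightarrow> 0 < snd p" for I
  proof -
    have "(\<Sum>p\<in>prod.swap ` I. pweight p * ((real (fst p))\<^sup>2 * (fcoef f (prod.swap p))\<^sup>2)) \<le> (sq_norm w2)\<^sup>2"
      using weak_partial_Bessel[OF d(2) D2, of "prod.swap ` I"] that by fastforce
    then show ?thesis by (subst (asm) sum.reindex) (simp_all add: pweight_def mult.commute)
  qed
  have part: "(\<Sum>p\<in>grid M - grid N. pweight p * (fcoef f p)\<^sup>2) \<le> B / (real (Suc N))\<^sup>2" for M N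
  proof -
    define I1 I2 where "I1 = {p \<in> grid M. N < fst p}" and "I2 = {p \<in> grid M. N < snd p}"
    have fin: "finite I1" "finite I2" by (auto simp: I1_def I2_def finite_grid)
    have nn: "0 \<le> pweight p * (fcoef f p)\<^sup>2" for p using pweight_bounds(1)[of p] by simp
    have sc: "pweight p * (fcoef f p)\<^sup>2 * (real (Suc N))\<^sup>2 \<le> pweight p * ((real m)\<^sup>2 * (fcoef f p)\<^sup>2)" if "N < m" for p m
    proof -
      have "(real (Suc N))\<^sup>2 \<le> (real m)\<^sup>2" using that by (intro power_mono) auto
      from mult_left_mono[OF this nn[of p]] show ?thesis by (simp add: mult_ac)
    qed
    have "(\<Sum>p\<in>grid M - grid N. pweight p * (fcoef f p)\<^sup>2) \<le> (\<Sum>p\<in>I1 \<union> I2. pweight p * (fcoef f p)\<^sup>2)"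
      using nn by (intro sum_mono2) (auto simp: fin, auto simp: I1_def I2_def grid_def)
    also have "\<dots> \<le> (\<Sum>p\<in>I1. pweight p * (fcoef f p)\<^sup>2) + (\<Sum>p\<in>I2. pweight p * (fcoef f p)\<^sup>2)"
      using sum.union_inter[OF fin, of "\<lambda>p. pweight p * (fcoef f p)\<^sup>2"]
        sum_nonneg[of "I1 \<inter> I2" "\<lambda>p. pweight p * (fcoef f p)\<^sup>2"] nn by simp
    finally have le: "(\<Sum>p\<in>grid M - grid N. pweight p * (fcoef f p)\<^sup>2)
        \<le> (\<Sum>p\<in>I1. pweight p * (fcoef f p)\<^sup>2) + (\<Sum>p\<in>I2. pweight p * (fcoef f p)\<^sup>2)" .
    have "(\<Sum>p\<in>I1. pweight p * (fcoef f p)\<^sup>2) * (real (Suc N))\<^sup>2 \<le> (sq_norm w1)\<^sup>2"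
      unfolding sum_distrib_right
      by (rule order_trans[OF sum_mono b1]) (auto simp: fin I1_def finite_grid simp del: of_nat_Suc intro!: sc)
    moreover have "(\<Sum>p\<in>I2. pweight p * (fcoef f p)\<^sup>2) * (real (Suc N))\<^sup>2 \<le> (sq_norm w2)\<^sup>2"
      unfolding sum_distrib_right
      by (rule order_trans[OF sum_mono b2]) (auto simp: fin I2_def finite_grid simp del: of_nat_Suc intro!: sc)
    moreover have "(\<Sum>p\<in>grid M - grid N. pweight p * (fcoef f p)\<^sup>2) * (real (Suc N))\<^sup>2
        \<le> ((\<Sum>p\<in>I1. pweight p * (fcoef f p)\<^sup>2) + (\<Sum>p\<in>I2. pweight p * (fcoef f p)\<^sup>2)) * (real (Suc N))\<^sup>2"
      using le by (rule mult_right_mono) simp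
    ultimately have "(\<Sum>p\<in>grid M - grid N. pweight p * (fcoef f p)\<^sup>2) * (real (Suc N))\<^sup>2 \<le> B"
      unfolding B_def distrib_right by linarith
    then show ?thesis by (simp add: pos_le_divide_eq del: of_nat_Suc)
  qed
  show ?thesis
  proof (rule that[of B])
    show "0 \<le> B" by (simp add: B_def)
    fix N
    have "(\<lambda>M. tail f M + B / (real (Suc N))\<^sup>2) \<longlonglongrightarrow> 0 + B / (real (Suc N))\<^sup>2"
      by (intro tendsto_add tail_tendsto_0 fL tendsto_const)
    moreover have "\<forall>\<^sub>F M in sequentially. tail f N \<le> tail f M + B / (real (Suc N))\<^sup>2"
      using eventually_ge_at_top[of N]
    proof eventually_elim
      case (elim M)
      show ?case unfolding tail_split[OF elim] using part[of M N] by linarith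
    qed
    ultimately show "tail f N \<le> B / (real (Suc N))\<^sup>2"
      by (metis add_0 tendsto_lowerbound trivial_limit_sequentially)
  qed
qed

section \<open>The regularised reconstruction\<close>

text \<open>Where the weight vanishes the quotient is 0 by convention, so the map is total in the
  data. At the extrapolation nodes \<open>data_ratio_error\<close> keeps the weight away from 0 once
  the noise is small.\<close>

definition data_ratio ::
  "(real \<times> real \<Rightarrow> real) \<Rightarrow> (real \<times> real \<Rightarrow> real) \<Rightarrow> (real \<Rightarrow> real) \<Rightarrow> real \<Rightarrow> nat \<Rightarrow> real" where
  "data_ratio g0 g1 \<phi> \<alpha> n =
     (coef g1 \<alpha> n - exp (- freq \<alpha> n) * coef g0 \<alpha> n) / source_weight \<phi> (freq \<alpha> n)"

text \<open>For 0 < e < 1 this is the largest K with 256^K \<le> 1 / e. Rounding down loses a factor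
  of at most 2 in 2^K, which is the 2 in \<open>level_bounds\<close>.\<close>

definition level :: "real \<Rightarrow> nat" where
  "level e = nat \<lfloor>log 2 (1 / e) / 8\<rfloor>"

definition raw ::
  "real \<Rightarrow> (real \<times> real \<Rightarrow> real) \<Rightarrow> (real \<times> real \<Rightarrow> real) \<Rightarrow> (real \<Rightarrow> real) \<Rightarrow> real \<times> real \<Rightarrow> real" where
  "raw e g0 g1 \<phi> = synth (2 ^ level e)
     (\<lambda>p. extrapolate (level e) (\<lambda>\<alpha>. data_ratio g0 g1 \<phi> \<alpha> (snd p)) (real (fst p) * pi))"

definition consistent ::
  "(real \<times> real \<Rightarrow> real) \<Rightarrow> (real \<Rightarrow> real) \<Rightarrow> (real \<times> real \<Rightarrow> real) \<Rightarrow> (real \<times> real \<Rightarrow> real) \<Rightarrow> bool" where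
  "consistent f \<phi> g0 g1 \<longleftrightarrow> (\<forall>\<alpha> n.
     coef g1 \<alpha> n - exp (- freq \<alpha> n) * coef g0 \<alpha> n = source_weight \<phi> (freq \<alpha> n) * coef f \<alpha> n)"

definition close_data ::
  "real \<Rightarrow> (real \<times> real \<Rightarrow> real) \<Rightarrow> (real \<times> real \<Rightarrow> real) \<Rightarrow> (real \<Rightarrow> real) \<Rightarrow>
   (real \<times> real \<Rightarrow> real) \<Rightarrow> (real \<times> real \<Rightarrow> real) \<Rightarrow> (real \<Rightarrow> real) \<Rightarrow> bool" where
  "close_data e g0 g1 \<phi> h0 h1 \<psi> \<longleftrightarrow>
     h0 \<in> sq_L2 \<and> sq_norm (\<lambda>z. h0 z - g0 z) \<le> e \<and>
     h1 \<in> sq_L2 \<and> sq_norm (\<lambda>z. h1 z - g1 z) \<le> e \<and>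
     \<psi> \<in> L1_space {0<..<1} \<and> L1_norm {0<..<1} (\<lambda>t. \<psi> t - \<phi> t) \<le> e"

text \<open>The quantifiers over exact and noisy data stand inside, so "for all sufficiently small
  e" before this predicate yields a threshold that depends on f and \<phi> alone.\<close>

definition error_at_most ::
  "(real \<times> real \<Rightarrow> real) \<Rightarrow> (real \<Rightarrow> real) \<Rightarrow> real \<Rightarrow>
   ((real \<times> real \<Rightarrow> real) \<Rightarrow> (real \<times> real \<Rightarrow> real) \<Rightarrow> (real \<Rightarrow> real) \<Rightarrow> real \<times> real \<Rightarrow> real) \<Rightarrow> real \<Rightarrow> bool" where
  "error_at_most f \<phi> e T B \<longleftrightarrow> (\<forall>g0 g1 h0 h1 \<psi>. g0 \<in> sq_L2 \<longrightarrow> g1 \<in> sq_L2 \<longrightarrow>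
     consistent f \<phi> g0 g1 \<longrightarrow> close_data e g0 g1 \<phi> h0 h1 \<psi> \<longrightarrow>
     (sq_norm (\<lambda>z. T h0 h1 \<psi> z - f z))\<^sup>2 \<le> B)"

lemma error_at_mostD:
  "error_at_most f \<phi> e T B \<Longrightarrow> g0 \<in> sq_L2 \<Longrightarrow> g1 \<in> sq_L2 \<Longrightarrow>
    consistent f \<phi> g0 g1 \<Longrightarrow> close_data e g0 g1 \<phi> h0 h1 \<psi> \<Longrightarrow>
    (sq_norm (\<lambda>z. T h0 h1 \<psi> z - f z))\<^sup>2 \<le> B"
  by (simp add: error_at_most_def)

section \<open>Error of the reconstruction before thresholding\<close>

lemma level_bounds:
  assumes "0 < e" "e < 1"
  shows "e \<le> 1 / 256 ^ level e" "1 / 2 ^ level e \<le> 2 * e powr (1 / 8)"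
proof -
  define K where "K = level e"
  define L where "L = log 2 (1 / e)"
  have L: "0 \<le> L" unfolding L_def using assms by (subst zero_le_log_cancel_iff) auto
  have eps: "e = 2 powr (- L)"
    using assms by (simp add: L_def log_divide)
  have K: "real K \<le> L / 8" "L / 8 < real K + 1"
    using L unfolding K_def level_def L_def[symmetric] by linarith+
  have "e \<le> 2 powr (- (8 * real K))"
    unfolding eps using K(1) by simp
  also have "\<dots> = 1 / 256 ^ K"
  proof -
    have "(2::real) powr (8 * real K) = (2 powr 8) powr (real K)" by (simp only: powr_powr)
    also have "\<dots> = 256 ^ K" by (simp add: powr_realpow)
    finally show ?thesis by (simp add: powr_minus divide_inverse)
  qed
  finally show "e \<le> 1 / 256 ^ level e" by (simp add: K_def)
  have "2 * e powr (1 / 8) = 2 powr 1 * 2 powr (- L / 8)"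
    unfolding eps by (simp add: powr_powr)
  also have "\<dots> = 2 powr (1 - L / 8)" by (simp only: powr_add[symmetric]) simp
  also have "\<dots> \<ge> 2 powr (- real K)" using K(2) by (subst powr_le_cancel_iff) auto
  finally have "2 powr (- real K) \<le> 2 * e powr (1 / 8)" .
  moreover have "2 powr (- real K) = 1 / 2 ^ K"
    unfolding powr_minus_divide by (subst powr_realpow) simp_all
  ultimately show "1 / 2 ^ level e \<le> 2 * e powr (1 / 8)" by (simp only: K_def)
qed

lemma level_at_top: "filterlim level at_top (at_right 0)"
proof -
  have "filterlim (\<lambda>e::real. log 2 (1 / e) / 8) at_top (at_right 0)" by real_asymp
  then have "filterlim (\<lambda>e::real. \<lfloor>log 2 (1 / e) / 8\<rfloor>) at_top (at_right 0)"
    by (rule filterlim_compose[OF filterlim_floor_sequentially])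
  then show ?thesis
    unfolding level_def[abs_def] by (rule filterlim_compose[OF filterlim_nat_sequentially])
qed

text \<open>With F the exact coefficient, A - W' F = (A - W F) - (W' - W) F is linear in the noise:
  at most 2 e from the end-time data and e |F| from the weight. The perturbed weight keeps half of
  the lower bound c / \<mu>, since the noise e takes at most the other half; division then costs a
  factor 2 \<mu> / c.\<close>

lemma data_ratio_error:
  assumes f: "f \<in> sq_L2" and g: "g0 \<in> sq_L2" "g1 \<in> sq_L2"
    and \<phi>: "\<phi> \<in> L1_space {0<..<1}"
    and cons: "consistent f \<phi> g0 g1" and close: "close_data e g0 g1 \<phi> h0 h1 \<psi>"
    and c: "0 < c" "c / freq \<alpha> n \<le> \<bar>source_weight \<phi> (freq \<alpha> n)\<bar>" "0 < freq \<alpha> n" "e * freq \<alpha> n \<le> c / 2"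
  shows "\<bar>data_ratio h0 h1 \<psi> \<alpha> n - coef f \<alpha> n\<bar> \<le> 2 * (2 + sq_norm f) * (e * freq \<alpha> n) / c"
proof -
  define \<mu> W W' A F where "\<mu> = freq \<alpha> n" and "W = source_weight \<phi> \<mu>" and "W' = source_weight \<psi> \<mu>"
    and "A = coef h1 \<alpha> n - exp (- \<mu>) * coef h0 \<alpha> n" and "F = coef f \<alpha> n"
  have h: "h0 \<in> sq_L2" "h1 \<in> sq_L2" "\<psi> \<in> L1_space {0<..<1}"
    and e: "sq_norm (\<lambda>z. h0 z - g0 z) \<le> e" "sq_norm (\<lambda>z. h1 z - g1 z) \<le> e"
      "L1_norm {0<..<1} (\<lambda>t. \<psi> t - \<phi> t) \<le> e"
    using close by (auto simp: close_data_def)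
  have \<mu>: "0 < \<mu>" using c by (simp add: \<mu>_def)
  have eps: "0 \<le> e" using e(1) L2_norm_nonneg order_trans by blast
  have d: "\<bar>coef h0 \<alpha> n - coef g0 \<alpha> n\<bar> \<le> e" "\<bar>coef h1 \<alpha> n - coef g1 \<alpha> n\<bar> \<le> e"
    using abs_coef_le_L2_norm[OF L2_diff[OF h(1) g(1)], of \<alpha> n] abs_coef_le_L2_norm[OF L2_diff[OF h(2) g(2)], of \<alpha> n] e
    by (auto simp: coef_diff h g)
  have WW: "\<bar>W' - W\<bar> \<le> e"
    using source_weight_diff[OF h(3) \<phi>, of \<mu>] e(3) \<mu> by (simp add: W_def W'_def)
  have "A - W * F = (coef h1 \<alpha> n - coef g1 \<alpha> n) - exp (- \<mu>) * (coef h0 \<alpha> n - coef g0 \<alpha> n)"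
    using cons[unfolded consistent_def, rule_format, of \<alpha> n]
    unfolding A_def W_def F_def \<mu>_def right_diff_distrib by linarith
  also have "\<bar>\<dots>\<bar> \<le> e + 1 * e"
  proof (rule order_trans[OF abs_triangle_ineq4 add_mono[OF d(2)]])
    show "\<bar>exp (- \<mu>) * (coef h0 \<alpha> n - coef g0 \<alpha> n)\<bar> \<le> 1 * e"
      unfolding abs_mult using d(1) \<mu> by (intro mult_mono) auto
  qed
  finally have AW: "\<bar>A - W * F\<bar> \<le> 2 * e" by simp
  have Fn: "\<bar>F\<bar> \<le> sq_norm f" unfolding F_def by (rule abs_coef_le_L2_norm[OF f])
  have "A - W' * F = (A - W * F) - (W' - W) * F" by (simp add: algebra_simps)
  also have "\<bar>\<dots>\<bar> \<le> 2 * e + e * sq_norm f"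
  proof (rule order_trans[OF abs_triangle_ineq4 add_mono[OF AW]])
    show "\<bar>(W' - W) * F\<bar> \<le> e * sq_norm f"
      unfolding abs_mult using WW Fn eps by (intro mult_mono) auto
  qed
  finally have num: "\<bar>A - W' * F\<bar> \<le> e * (2 + sq_norm f)" by (simp add: algebra_simps)
  have "e \<le> c / 2 / \<mu>" using c(4) \<mu> by (simp add: \<mu>_def field_simps)
  moreover have "c / \<mu> \<le> \<bar>W\<bar>" using c(2) by (simp add: \<mu>_def W_def)
  moreover have "c / \<mu> = c / 2 / \<mu> + c / 2 / \<mu>" by simp
  ultimately have W': "c / 2 / \<mu> \<le> \<bar>W'\<bar>" using WW by linarith
  have pos: "0 < c / 2 / \<mu>" using c(1) \<mu> by simp
  then have nz: "W' \<noteq> 0" using W' by auto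
  have "data_ratio h0 h1 \<psi> \<alpha> n - F = (A - W' * F) / W'"
    using nz by (simp add: data_ratio_def A_def W'_def \<mu>_def[symmetric] diff_divide_distrib)
  also have "\<bar>\<dots>\<bar> \<le> e * (2 + sq_norm f) / (c / 2 / \<mu>)"
    unfolding abs_divide using num W' pos by (intro frac_le) auto
  also have "\<dots> = 2 * (2 + sq_norm f) * (e * \<mu>) / c"
    using c(1) by simp
  finally show ?thesis by (simp add: F_def \<mu>_def)
qed

text \<open>The lower bound comes from the extrapolation shift K / 64 and therefore covers k = n =
  0. For the upper bound, \<alpha> and n pi are each at most 4 * 2^K, and 16 + 16 = 32.\<close>

lemma freq_node_bounds:
  assumes "k \<le> 2 ^ K" "n \<le> 2 ^ K" "j < K"
  defines "\<alpha> \<equiv> real k * pi + real (K + j) / 64"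
  shows "(real K / 64)\<^sup>2 \<le> freq \<alpha> n" "freq \<alpha> n \<le> 32 * 4 ^ K"
proof -
  have pw: "(4::real) ^ K = (2 ^ K)\<^sup>2" by (simp add: power2_eq_square flip: power_mult_distrib)
  have pi4: "pi \<le> 3.5" using pi_approx by simp
  have K2: "real K \<le> 2 ^ K" using of_nat_less_two_power[of K, where 'a = real] by simp
  have kn: "real k \<le> 2 ^ K" "real n \<le> 2 ^ K"
    using assms(1,2) by (metis of_nat_le_iff of_nat_numeral of_nat_power)+
  have "real k * pi \<le> 2 ^ K * 3.5" using kn pi4 by (intro mult_mono) auto
  moreover have "real (K + j) / 64 \<le> 2 ^ K / 2" 
  proof -
    have "real j \<le> real K" using assms(3) by simp
    then have "real (K + j) \<le> 2 * 2 ^ K" using K2 by linarith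
    moreover have "(0::real) \<le> 2 ^ K" by simp
    moreover have "y / 64 \<le> x / 2" if "y \<le> 2 * x" "0 \<le> x" for x y :: real
      using that by linarith
    ultimately show ?thesis by blast
  qed
  moreover have "a + b \<le> 4 * x" if "a \<le> x * 3.5" "b \<le> x / 2" for a b x :: real
    using that by linarith
  ultimately have a: "\<alpha> \<le> 4 * 2 ^ K" unfolding \<alpha>_def by blast
  have "0 \<le> real k * pi" by simp
  moreover have "real K / 64 \<le> real (K + j) / 64" by simp
  ultimately have a1: "real K / 64 \<le> \<alpha>" unfolding \<alpha>_def by linarith
  have "(real K / 64)\<^sup>2 \<le> \<alpha>\<^sup>2" using a1 by (intro power_mono) auto
  then show "(real K / 64)\<^sup>2 \<le> freq \<alpha> n" unfolding freq_def by (simp add: add_increasing2)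
  have "real n * pi \<le> 2 ^ K * 4" using kn pi4 by (intro mult_mono) auto
  then have "(real n * pi)\<^sup>2 \<le> (4 * 2 ^ K)\<^sup>2" by (intro power_mono) auto
  moreover have "0 \<le> \<alpha>" using a1 by (rule order_trans[rotated]) simp
  then have "\<alpha>\<^sup>2 \<le> (4 * 2 ^ K)\<^sup>2" using a by (intro power_mono) auto
  ultimately show "freq \<alpha> n \<le> 32 * 4 ^ K"
    unfolding freq_def pw by (simp add: power_mult_distrib)
qed

lemma card_grid_bound: "real (card (grid (2 ^ K))) \<le> 4 * 4 ^ K"
proof -
  have "real (card (grid (2 ^ K))) = (2 ^ K + 1)\<^sup>2"
    by (simp add: grid_def card_cartesian_product power2_eq_square algebra_simps)
  also have "\<dots> \<le> (2 * 2 ^ K)\<^sup>2" by (intro power_mono) auto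
  also have "\<dots> = 4 * 4 ^ K" by (simp add: power2_eq_square flip: power_mult_distrib)
  finally show ?thesis .
qed

text \<open>\<open>synth_error\<close> separates the tail of f from the errors of the coefficients.
  Each of these is the extrapolated noise plus the extrapolation error for the exact transform, and
  all of them are bounded alike on the grid.\<close>

lemma raw_error:
  assumes \<phi>: "\<phi> \<in> L1_space {0<..<1}" "nondegenerate_near_1 \<phi>" and f: "f \<in> sq_L2"
  obtains D where "0 \<le> D"
    "\<forall>\<^sub>F e in at_right 0. error_at_most f \<phi> e (raw e) (tail f (2 ^ level e) + D / 4 ^ level e)"
proof -
  obtain c where c: "0 < c" "\<forall>\<^sub>F \<mu> in at_top. c / \<mu> \<le> \<bar>source_weight \<phi> \<mu>\<bar>"
    using source_weight_lower_bound[OF \<phi>] .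
  then obtain \<mu>0 where \<mu>0: "\<And>\<mu>. \<mu>0 \<le> \<mu> \<Longrightarrow> c / \<mu> \<le> \<bar>source_weight \<phi> \<mu>\<bar>"
    unfolding eventually_at_top_linorder by blast
  define F where "F = sq_norm f"
  \<comment> \<open>The first summand accounts for the noise after extrapolation, the second for the
    extrapolation of the exact transform; both carry the factor 8^(-K).\<close>
  define D0 where "D0 = 64 * (2 + F) / c + F"
  have F: "0 \<le> F" by (simp add: F_def L2_norm_nonneg)
  have D0: "0 \<le> D0" using F c(1) by (simp add: D0_def)
  have "\<forall>\<^sub>F K in sequentially. \<mu>0 \<le> (real K / 64)\<^sup>2"
  proof -
    have "filterlim (\<lambda>K::nat. (real K / 64)\<^sup>2) at_top sequentially" by real_asymp
    then show ?thesis by (simp add: filterlim_at_top)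
  qed
  \<comment> \<open>At the nodes e times the frequency is at most 256^(-K) * 32 * 4^K, so this is
    the smallness condition of \<open>data_ratio_error\<close>.\<close>
  moreover have "\<forall>\<^sub>F K in sequentially. 32 * (1 / 64) ^ K \<le> c / 2"
  proof -
    have "(\<lambda>K. 32 * (1 / 64) ^ K) \<longlonglongrightarrow> (32 * 0 :: real)"
      by (intro tendsto_mult tendsto_const LIMSEQ_power_zero) auto
    then have "\<forall>\<^sub>F K in sequentially. 32 * (1 / 64) ^ K < c / 2"
      by (rule order_tendstoD) (use c(1) in simp)
    then show ?thesis by eventually_elim simp
  qed
  ultimately have "\<forall>\<^sub>F K in sequentially. \<mu>0 \<le> (real K / 64)\<^sup>2 \<and> 32 * (1 / 64) ^ K \<le> c / 2 \<and> 0 < K"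
    using eventually_gt_at_top[of 0] by eventually_elim auto
  then have ev: "\<forall>\<^sub>F e in at_right 0. \<mu>0 \<le> (real (level e) / 64)\<^sup>2 \<and> 32 * (1 / 64) ^ level e \<le> c / 2 \<and> 0 < level e"
    using level_at_top by (rule eventually_compose_filterlim)
  have ev1: "\<forall>\<^sub>F e in at_right 0. 0 < e \<and> e < (1::real)"
    by (auto simp: eventually_at_right_field intro!: exI[of _ 1])
  show ?thesis
  proof (rule that[of "16 * D0\<^sup>2"])
    show "0 \<le> 16 * D0\<^sup>2" by simp
    show "\<forall>\<^sub>F e in at_right 0. error_at_most f \<phi> e (raw e) (tail f (2 ^ level e) + 16 * D0\<^sup>2 / 4 ^ level e)"
      using ev ev1
    proof eventually_elim
      case (elim e)
      define K where "K = level e"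
      have K: "\<mu>0 \<le> (real K / 64)\<^sup>2" "32 * (1 / 64) ^ K \<le> c / 2" "0 < K" and eps: "0 < e" "e < 1"
        using elim by (auto simp: K_def)
      have eK: "e \<le> 1 / 256 ^ K" using level_bounds(1)[OF eps] by (simp add: K_def)
      obtain k where Kk: "K = Suc k" using K(3) by (cases K) auto
      show ?case
        unfolding error_at_most_def
      proof (intro allI impI)
        fix g0 g1 h0 h1 \<psi>
        assume g: "g0 \<in> sq_L2" "g1 \<in> sq_L2"
          and cons: "consistent f \<phi> g0 g1" and close: "close_data e g0 g1 \<phi> h0 h1 \<psi>"
        define C where "C p = extrapolate K (\<lambda>\<alpha>. data_ratio h0 h1 \<psi> \<alpha> (snd p)) (real (fst p) * pi)" for p
        have "\<bar>C p - fcoef f p\<bar> \<le> D0 / 8 ^ K" if p: "p \<in> grid (2 ^ K)" for p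
        proof -
          let ?\<omega> = "real (fst p) * pi" and ?n = "snd p"
          have fp: "fcoef f p = coef f ?\<omega> ?n" by (simp add: fcoef_def coef_def cosmode_def)
          have "\<bar>extrapolate K (\<lambda>\<alpha>. data_ratio h0 h1 \<psi> \<alpha> ?n - coef f \<alpha> ?n) ?\<omega>\<bar> \<le> 8 ^ K * (64 * (2 + F) / c / 64 ^ K)"
          proof (rule extrapolate_bound)
            fix j assume j: "j < K"
            let ?\<alpha> = "?\<omega> + real (K + j) / 64"
            have fr: "(real K / 64)\<^sup>2 \<le> freq ?\<alpha> ?n" "freq ?\<alpha> ?n \<le> 32 * 4 ^ K"
              using p freq_node_bounds[of "fst p" K ?n j] j by (auto simp: grid_def)
            have "0 < (real K / 64)\<^sup>2" using K(3) by simp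
            then have pos: "0 < freq ?\<alpha> ?n" using fr(1) by linarith
            have "e * freq ?\<alpha> ?n \<le> 1 / 256 ^ K * (32 * 4 ^ K)"
              using eK fr(2) pos eps by (intro mult_mono) auto
            also have "\<dots> = 32 * ((1 / 256) ^ K * 4 ^ K)" by (simp add: power_one_over)
            also have "\<dots> = 32 * (1 / 64) ^ K" by (simp only: power_mult_distrib[symmetric]) simp
            finally have ef: "e * freq ?\<alpha> ?n \<le> 32 * (1 / 64) ^ K" .
            have "\<bar>data_ratio h0 h1 \<psi> ?\<alpha> ?n - coef f ?\<alpha> ?n\<bar> \<le> 2 * (2 + sq_norm f) * (e * freq ?\<alpha> ?n) / c"
              by (rule data_ratio_error[OF f g \<phi>(1) cons close c(1) _ pos])
                (use \<mu>0 K fr(1) ef in auto)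
            also have "\<dots> \<le> 2 * (2 + F) * (32 * (1 / 64) ^ K) / c"
              unfolding F_def[symmetric] using ef F c(1) by (intro divide_right_mono mult_left_mono) auto
            also have "\<dots> = 64 * (2 + F) / c / 64 ^ K" by (simp add: power_one_over field_simps)
            finally show "\<bar>data_ratio h0 h1 \<psi> ?\<alpha> ?n - coef f ?\<alpha> ?n\<bar> \<le> 64 * (2 + F) / c / 64 ^ K" .
          qed (use F c(1) in simp)
          also have "8 ^ K * (64 * (2 + F) / c / 64 ^ K) = 64 * (2 + F) / c / 8 ^ K"
          proof -
            have "(64::real) ^ K = 8 ^ K * 8 ^ K" by (simp flip: power_mult_distrib)
            then show ?thesis by simp
          qed
          finally have 1: "\<bar>C p - extrapolate K (\<lambda>\<alpha>. coef f \<alpha> ?n) ?\<omega>\<bar> \<le> 64 * (2 + F) / c / 8 ^ K"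
            unfolding C_def extrapolate_diff .
          have 2: "\<bar>fcoef f p - extrapolate K (\<lambda>\<alpha>. coef f \<alpha> ?n) ?\<omega>\<bar> \<le> F / 8 ^ K"
            unfolding fp F_def Kk by (rule extrapolate_coef_error[OF f])
          have "D0 / 8 ^ K = 64 * (2 + F) / c / 8 ^ K + F / 8 ^ K" by (simp add: D0_def add_divide_distrib)
          then show ?thesis using 1 2 by linarith
        qed
        then have ce: "pweight p * (C p - fcoef f p)\<^sup>2 \<le> 4 * (D0 / 8 ^ K)\<^sup>2" if "p \<in> grid (2 ^ K)" for p
          using that pweight_bounds(2)[of p] pweight_nonneg[of p] D0
          by (intro mult_mono) (auto simp: abs_le_square_iff[symmetric])
        have "(\<Sum>p\<in>grid (2 ^ K). pweight p * (C p - fcoef f p)\<^sup>2) \<le> real (card (grid (2 ^ K))) * (4 * (D0 / 8 ^ K)\<^sup>2)"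
          using sum_bounded_above[of "grid (2 ^ K)", OF ce] by simp
        also have "\<dots> \<le> 4 * 4 ^ K * (4 * (D0 / 8 ^ K)\<^sup>2)"
          using card_grid_bound by (rule mult_right_mono) simp
        also have "\<dots> = 16 * D0\<^sup>2 * (4 ^ K / (8 ^ K * 8 ^ K))" by (simp add: power2_eq_square field_simps)
        also have "(4::real) ^ K / (8 ^ K * 8 ^ K) = 1 / 16 ^ K"
          by (simp add: field_simps flip: power_mult_distrib)
        \<comment> \<open>The decay 16^(-K) is relaxed to 4^(-K), the order of the tail of an H1
          function on this grid.\<close>
        also have "16 * D0\<^sup>2 * (1 / 16 ^ K) \<le> 16 * D0\<^sup>2 * (1 / 4 ^ K)"
          by (intro mult_left_mono divide_left_mono power_mono) auto
        finally have "(\<Sum>p\<in>grid (2 ^ K). pweight p * (C p - fcoef f p)\<^sup>2) \<le> 16 * D0\<^sup>2 / 4 ^ K" by simp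
        moreover have "raw e h0 h1 \<psi> = synth (2 ^ K) C" by (simp add: raw_def C_def[abs_def] K_def)
        ultimately show "(sq_norm (\<lambda>z. raw e h0 h1 \<psi> z - f z))\<^sup>2 \<le> tail f (2 ^ level e) + 16 * D0\<^sup>2 / 4 ^ level e"
          by (subst L2_norm_minus_commute) (simp add: synth_error[OF f] K_def)
      qed
    qed
  qed
qed

text \<open>Outside the square the value is 0, which embeds the result into the plane. The threshold
  e^(1/8) for the squared norm has to meet two demands: it eventually exceeds the squared error of
  \<open>raw\<close>, of order e^(1/4) for f = 0, so that a zero source is reproduced exactly; and
  it tends to 0, so that a nonzero source eventually passes.\<close>

definition recon ::
  "real \<Rightarrow> (real \<times> real \<Rightarrow> real) \<Rightarrow> (real \<times> real \<Rightarrow> real) \<Rightarrow> (real \<Rightarrow> real) \<Rightarrow> real \<times> real \<Rightarrow> real" where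
  "recon e g0 g1 \<phi> z =
     (if z \<in> unit_square \<and> e powr (1 / 8) < (sq_norm (raw e g0 g1 \<phi>))\<^sup>2 then raw e g0 g1 \<phi> z else 0)"

lemma L2_raw: "raw e g0 g1 \<phi> \<in> sq_L2"
  unfolding raw_def by (rule L2_synth)

lemma L2_extend_zero:
  assumes "S \<in> sets lebesgue" "f \<in> L2_space S"
  shows "(\<lambda>x. if x \<in> S then f x else 0) \<in> L2_space UNIV"
proof -
  have "(\<lambda>x. if x \<in> S then f x else 0) \<in> borel_measurable lebesgue"
    using assms by (simp add: borel_measurable_if L2_spaceD)
  moreover have "integrable lebesgue (\<lambda>x. if x \<in> S then (f x)\<^sup>2 else 0)"
    using Lebesgue_Measure.integrable_restrict_UNIV[OF assms(1), of "\<lambda>x. (f x)\<^sup>2"] L2_spaceD(2)[OF assms(2)] by simp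
  then have "integrable lebesgue (\<lambda>x. (if x \<in> S then f x else 0)\<^sup>2)"
    by (rule back_subst[where P = "integrable lebesgue"]) auto
  ultimately show ?thesis by (simp add: L2_space_def lebesgue_on_UNIV_eq)
qed

lemma recon_cases:
  "recon e g0 g1 \<phi> = (if e powr (1 / 8) < (sq_norm (raw e g0 g1 \<phi>))\<^sup>2
     then (\<lambda>z. if z \<in> unit_square then raw e g0 g1 \<phi> z else 0) else (\<lambda>z. 0))"
  by (auto simp: recon_def)

lemma reconstruction_map_recon: "reconstruction_map (recon e)"
  unfolding reconstruction_map_def
proof (intro conjI ballI impI)
  fix g0 g1 \<phi>
  show "recon e g0 g1 \<phi> \<in> L2_space UNIV"
    unfolding recon_cases
    using L2_extend_zero[OF _ L2_raw] lmeasurable_sq by (simp add: L2_zero fmeasurableD)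
next
  fix g0 g1 h0 h1 :: "real \<times> real \<Rightarrow> real" and \<phi> \<psi> :: "real \<Rightarrow> real"
  assume L: "g0 \<in> sq_L2" "g1 \<in> sq_L2" "\<phi> \<in> L1_space {0<..<1}"
    "h0 \<in> sq_L2" "h1 \<in> sq_L2" "\<psi> \<in> L1_space {0<..<1}"
    and AE: "AE z in sq. g0 z = h0 z" "AE z in sq. g1 z = h1 z" "AE t in itv. \<phi> t = \<psi> t"
  have "coef g0 \<alpha> n = coef h0 \<alpha> n" "coef g1 \<alpha> n = coef h1 \<alpha> n" for \<alpha> n
    using AE L by (auto intro!: coef_cong_AE dest: L2_spaceD(1))
  moreover have "source_weight \<phi> \<mu> = source_weight \<psi> \<mu>" for \<mu>
    unfolding source_weight_def
  proof (rule integral_cong_AE)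
    have e: "(\<lambda>t. exp (- \<mu> * (1 - t))) \<in> borel_measurable itv"
      by (intro continuous_measurable_lebesgue_on continuous_intros)
    show "(\<lambda>t. exp (- \<mu> * (1 - t)) * \<phi> t) \<in> borel_measurable itv"
      "(\<lambda>t. exp (- \<mu> * (1 - t)) * \<psi> t) \<in> borel_measurable itv"
      using L(3,6) unfolding L1_space_def by (auto intro: borel_measurable_times[OF e] simp only: mem_Collect_eq borel_measurable_integrable)
    show "AE t in itv. exp (- \<mu> * (1 - t)) * \<phi> t = exp (- \<mu> * (1 - t)) * \<psi> t"
      using AE(3) by eventually_elim simp
  qed
  ultimately have "data_ratio g0 g1 \<phi> = data_ratio h0 h1 \<psi>"
    by (simp add: data_ratio_def fun_eq_iff)
  then have "raw e g0 g1 \<phi> = raw e h0 h1 \<psi>" by (simp add: raw_def)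
  then have "recon e g0 g1 \<phi> = recon e h0 h1 \<psi>" by (simp only: recon_cases)
  then show "AE z in lebesgue. recon e g0 g1 \<phi> z = recon e h0 h1 \<psi> z" by simp
qed

text \<open>On the square either nothing is changed, or what is dropped has squared norm at most the
  threshold.\<close>

lemma recon_minus_raw:
  assumes "0 \<le> e"
  shows "(sq_norm (\<lambda>z. recon e g0 g1 \<phi> z - raw e g0 g1 \<phi> z))\<^sup>2 \<le> e powr (1 / 8)"
proof (cases "e powr (1 / 8) < (sq_norm (raw e g0 g1 \<phi>))\<^sup>2")
  case True
  then have "(LINT z|sq. (recon e g0 g1 \<phi> z - raw e g0 g1 \<phi> z)\<^sup>2) = (LINT z|sq. 0)"
    by (intro LINT_cong) (auto simp: recon_def)
  then show ?thesis by (simp add: L2_norm_power2)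
next
  case False
  then have "recon e g0 g1 \<phi> z = 0" for z by (simp add: recon_def)
  then have "sq_norm (\<lambda>z. recon e g0 g1 \<phi> z - raw e g0 g1 \<phi> z) = sq_norm (raw e g0 g1 \<phi>)"
    by (simp add: L2_norm_def)
  then show ?thesis using False by simp
qed

lemma L2_recon: "recon e g0 g1 \<phi> \<in> sq_L2"
proof (cases "e powr (1 / 8) < (sq_norm (raw e g0 g1 \<phi>))\<^sup>2")
  case True
  have "recon e g0 g1 \<phi> \<in> borel_measurable sq \<longleftrightarrow> raw e g0 g1 \<phi> \<in> borel_measurable sq"
    using True by (intro measurable_cong) (auto simp: recon_def)
  then have "recon e g0 g1 \<phi> \<in> borel_measurable sq" using L2_spaceD(1)[OF L2_raw] by blast
  moreover have "AE z in sq. raw e g0 g1 \<phi> z = recon e g0 g1 \<phi> z"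
    using True by (intro AE_I2) (simp add: recon_def)
  ultimately show ?thesis using L2_space_cong_AE[OF _ L2_raw] by blast
next
  case False
  then show ?thesis by (simp add: recon_cases L2_zero)
qed

section \<open>Convergence, uniqueness of the source, and the rate\<close>

lemma raw_error_tendsto_0:
  assumes f: "f \<in> sq_L2" and D: "0 \<le> D"
  shows "((\<lambda>e. tail f (2 ^ level e) + D / 4 ^ level e) \<longlongrightarrow> 0) (at_right 0)"
proof -
  have "filterlim (\<lambda>K::nat. (2::nat) ^ K) at_top sequentially"
    by (rule filterlim_at_top_mono[OF filterlim_ident]) (auto intro!: always_eventually less_imp_le)
  then have "(\<lambda>K. tail f (2 ^ K)) \<longlonglongrightarrow> 0" by (rule filterlim_compose[OF tail_tendsto_0[OF f]])
  moreover have "(\<lambda>K::nat. D / 4 ^ K) \<longlonglongrightarrow> 0" by real_asymp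
  ultimately have "(\<lambda>K. tail f (2 ^ K) + D / 4 ^ K) \<longlonglongrightarrow> 0 + 0" by (rule tendsto_add)
  then show ?thesis using filterlim_compose[OF _ level_at_top] by fastforce
qed

lemma source_problem_consistent:
  "solves_source_problem u f \<phi> g0 g1 \<Longrightarrow> \<phi> \<in> L1_space {0<..<1} \<Longrightarrow> g0 \<in> sq_L2 \<Longrightarrow>
    g1 \<in> sq_L2 \<Longrightarrow> consistent f \<phi> g0 g1"
  unfolding consistent_def by (blast intro: source_problem_coef)

lemma noisy_data_close:
  "noisy_data g0 g1 \<phi> g0e g1e \<phi>e \<Longrightarrow> 0 < e \<Longrightarrow> e < 1 \<Longrightarrow> close_data e g0 g1 \<phi> (g0e e) (g1e e) (\<phi>e e)"
  by (auto simp: noisy_data_def close_data_def)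

lemma eventually_in_unit: "\<forall>\<^sub>F e in at_right 0. 0 < e \<and> e < (1::real)"
  by (auto simp: eventually_at_right_field intro!: exI[of _ 1])

lemma raw_converges:
  assumes \<phi>: "\<phi> \<in> L1_space {0<..<1}" "nondegenerate_near_1 \<phi>" and f: "f \<in> sq_L2"
    and g: "g0 \<in> sq_L2" "g1 \<in> sq_L2" and cons: "consistent f \<phi> g0 g1"
    and close: "\<And>e. 0 < e \<Longrightarrow> e < 1 \<Longrightarrow> close_data e g0 g1 \<phi> (g0e e) (g1e e) (\<phi>e e)"
  shows "((\<lambda>e. sq_norm (\<lambda>z. raw e (g0e e) (g1e e) (\<phi>e e) z - f z)) \<longlongrightarrow> 0) (at_right 0)"
proof -
  obtain D where D: "0 \<le> D" and ev: "\<forall>\<^sub>F e in at_right 0. error_at_most f \<phi> e (raw e) (tail f (2 ^ level e) + D / 4 ^ level e)"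
    using raw_error[OF \<phi> f] .
  have "((\<lambda>e. (sq_norm (\<lambda>z. raw e (g0e e) (g1e e) (\<phi>e e) z - f z))\<^sup>2) \<longlongrightarrow> 0) (at_right 0)"
  proof (rule tendsto_sandwich[OF _ _ tendsto_const raw_error_tendsto_0[OF f D]])
    show "\<forall>\<^sub>F e in at_right 0. (sq_norm (\<lambda>z. raw e (g0e e) (g1e e) (\<phi>e e) z - f z))\<^sup>2
        \<le> tail f (2 ^ level e) + D / 4 ^ level e"
      using ev eventually_in_unit
    proof eventually_elim
      case (elim e)
      then show ?case by (intro error_at_mostD[OF _ g cons close]) auto
    qed
  qed simp
  from tendsto_real_sqrt[OF this] show ?thesis by (simp add: L2_norm_nonneg)
qed

lemma recon_converges:
  assumes \<phi>: "\<phi> \<in> L1_space {0<..<1}" "nondegenerate_near_1 \<phi>" and f: "f \<in> sq_L2"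
    and g: "g0 \<in> sq_L2" "g1 \<in> sq_L2" and cons: "consistent f \<phi> g0 g1"
    and noisy: "noisy_data g0 g1 \<phi> g0e g1e \<phi>e"
  shows "((\<lambda>e. sq_norm (\<lambda>z. recon e (g0e e) (g1e e) (\<phi>e e) z - f z)) \<longlongrightarrow> 0) (at_right 0)"
proof (rule tendsto_sandwich[OF _ _ tendsto_const])
  let ?r = "\<lambda>e. raw e (g0e e) (g1e e) (\<phi>e e)" and ?R = "\<lambda>e. recon e (g0e e) (g1e e) (\<phi>e e)"
  have "((\<lambda>e::real. sqrt (e powr (1 / 8))) \<longlongrightarrow> 0) (at_right 0)" by real_asymp
  from tendsto_add[OF this raw_converges[OF \<phi> f g cons noisy_data_close[OF noisy]]]
  show "((\<lambda>e. sqrt (e powr (1 / 8)) + sq_norm (\<lambda>z. ?r e z - f z)) \<longlongrightarrow> 0) (at_right 0)" by simp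
  show "\<forall>\<^sub>F e in at_right 0. sq_norm (\<lambda>z. ?R e z - f z)
      \<le> sqrt (e powr (1 / 8)) + sq_norm (\<lambda>z. ?r e z - f z)"
    using eventually_in_unit
  proof eventually_elim
    case (elim e)
    have "sq_norm (\<lambda>z. ?R e z - ?r e z) \<le> sqrt (e powr (1 / 8))"
      using recon_minus_raw[of e] elim by (intro real_le_rsqrt) auto
    then show ?case
      using L2_norm_diff_triangle[OF L2_recon[of e "g0e e" "g1e e" "\<phi>e e"] L2_raw[of e "g0e e" "g1e e" "\<phi>e e"] f]
      by linarith
  qed
qed (simp add: L2_norm_nonneg)

text \<open>Exact data count as noisy data of every size, so the reconstructions from one and the
  same data converge to both sources. The data of the two problems agree almost everywhere, being
  the values of u at t = 0 and t = 1.\<close>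

lemma source_unique:
  assumes \<phi>: "\<phi> \<in> L1_space {0<..<1}" "nondegenerate_near_1 \<phi>"
    and sol: "solves_source_problem u f \<phi> g0 g1" "solves_source_problem u f' \<phi> h0 h1"
    and L: "g0 \<in> sq_L2" "g1 \<in> sq_L2"
      "h0 \<in> sq_L2" "h1 \<in> sq_L2"
  shows "AE z in sq. f z = f' z"
proof -
  have f: "f \<in> sq_L2" "f' \<in> sq_L2"
    using sol by (auto simp: solves_source_problem_def)
  have c: "consistent f \<phi> g0 g1" "consistent f' \<phi> h0 h1"
    using source_problem_consistent sol \<phi>(1) L by blast+
  have u01: "AE z in sq. u 0 z = g0 z" "AE z in sq. u 1 z = g1 z" "AE z in sq. u 0 z = h0 z" "AE z in sq. u 1 z = h1 z"
    using sol unfolding solves_source_problem_def by blast+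
  have "AE z in sq. h0 z = g0 z"
    using u01(1,3) by eventually_elim simp
  moreover have "AE z in sq. h1 z = g1 z"
    using u01(2,4) by eventually_elim simp
  ultimately have "coef h0 \<alpha> n = coef g0 \<alpha> n" "coef h1 \<alpha> n = coef g1 \<alpha> n" for \<alpha> n
    using L by (auto intro!: coef_cong_AE dest: L2_spaceD(1))
  then have c': "consistent f' \<phi> g0 g1" using c(2) by (simp add: consistent_def)
  have cl: "close_data e g0 g1 \<phi> g0 g1 \<phi>" if "0 < e" for e
    using that L \<phi>(1) by (simp add: close_data_def L2_norm_def L1_norm_def)
  let ?r = "\<lambda>e. raw e g0 g1 \<phi>"
  have t1: "((\<lambda>e. sq_norm (\<lambda>z. ?r e z - f z)) \<longlongrightarrow> 0) (at_right 0)"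
    by (rule raw_converges[OF \<phi> f(1) L(1,2) c(1) cl])
  have t2: "((\<lambda>e. sq_norm (\<lambda>z. ?r e z - f' z)) \<longlongrightarrow> 0) (at_right 0)"
    by (rule raw_converges[OF \<phi> f(2) L(1,2) c' cl])
  have "sq_norm (\<lambda>z. f z - f' z) \<le> 0"
  proof (rule tendsto_lowerbound)
    show "((\<lambda>e. sq_norm (\<lambda>z. ?r e z - f z) + sq_norm (\<lambda>z. ?r e z - f' z)) \<longlongrightarrow> 0) (at_right 0)"
      using tendsto_add[OF t1 t2] by simp
    show "\<forall>\<^sub>F e in at_right 0. sq_norm (\<lambda>z. f z - f' z)
        \<le> sq_norm (\<lambda>z. ?r e z - f z) + sq_norm (\<lambda>z. ?r e z - f' z)"
    proof (rule always_eventually, rule allI)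
      fix e
      show "sq_norm (\<lambda>z. f z - f' z)
        \<le> sq_norm (\<lambda>z. ?r e z - f z) + sq_norm (\<lambda>z. ?r e z - f' z)"
        using L2_norm_diff_triangle[OF f(1) L2_raw f(2), of e g0 g1 \<phi>]
        by (simp add: L2_norm_minus_commute[of _ f "?r e"])
    qed
  qed simp
  then have "sq_norm (\<lambda>z. f z - f' z) = 0" using L2_norm_nonneg by (meson antisym)
  from L2_norm_eq_0D[OF L2_diff[OF f] this] show ?thesis by simp
qed

text \<open>On the grid of size 2^K both the H1 tail and the coefficient error are of order 4^(-K);
  as 2^(-K) \<le> 2 e^(1/8), squaring gives 4 e^(1/4).\<close>

lemma raw_rate:
  assumes \<phi>: "\<phi> \<in> L1_space {0<..<1}" "nondegenerate_near_1 \<phi>" and f: "f \<in> H1_space unit_square"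
  obtains C where "0 \<le> C"
    "\<forall>\<^sub>F e in at_right 0. error_at_most f \<phi> e (raw e) (C * e powr (1 / 4))"
proof -
  have fL: "f \<in> sq_L2" using f by (simp add: H1_space_def)
  obtain D where D: "0 \<le> D" and ev: "\<forall>\<^sub>F e in at_right 0. error_at_most f \<phi> e (raw e) (tail f (2 ^ level e) + D / 4 ^ level e)"
    using raw_error[OF \<phi> fL] .
  obtain B where B: "0 \<le> B" "\<And>N. tail f N \<le> B / (real (Suc N))\<^sup>2"
    by (rule tail_H1_bound[OF f]) blast
  show ?thesis
  proof (rule that[of "4 * (B + D)"])
    show "0 \<le> 4 * (B + D)" using B D by simp
    show "\<forall>\<^sub>F e in at_right 0. error_at_most f \<phi> e (raw e) (4 * (B + D) * e powr (1 / 4))"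
      using ev eventually_in_unit
    proof eventually_elim
      case (elim e)
      define K where "K = level e"
      have pw: "(4::real) ^ K = (2 ^ K)\<^sup>2" by (simp add: power2_eq_square flip: power_mult_distrib)
      have "tail f (2 ^ K) \<le> B / (real (Suc (2 ^ K)))\<^sup>2" by (rule B(2))
      also have "\<dots> \<le> B / 4 ^ K" unfolding pw using B(1)
        by (intro divide_left_mono power_mono mult_pos_pos zero_less_power) (auto intro: add_pos_pos)
      finally have "tail f (2 ^ K) + D / 4 ^ K \<le> (B + D) * (1 / 2 ^ K)\<^sup>2"
        unfolding pw by (simp add: power_one_over add_divide_distrib distrib_right)
      also have "\<dots> \<le> (B + D) * (2 * e powr (1 / 8))\<^sup>2"
        using level_bounds(2)[of e] elim(2) B(1) D unfolding K_def by (intro mult_left_mono power_mono) auto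
      also have "(2 * e powr (1 / 8))\<^sup>2 = 4 * e powr (1 / 4)"
        by (simp add: power2_eq_square flip: powr_add)
      also have "(B + D) * (4 * e powr (1 / 4)) = 4 * (B + D) * e powr (1 / 4)" by simp
      finally have "tail f (2 ^ level e) + D / 4 ^ level e \<le> 4 * (B + D) * e powr (1 / 4)" by (simp add: K_def)
      then show ?case using elim(1) order_trans unfolding error_at_most_def by blast
    qed
  qed
qed

text \<open>The gap between the exponents 1/4 and 1/8 swallows any constant, but only against a
  positive right-hand side. If f vanishes almost everywhere the right-hand side is 0, and the
  threshold turns the reconstruction into exactly 0. Otherwise the L1 norm of f is positive, and the
  norm of \<open>raw\<close> approaches that of f, so that \<open>recon\<close> and
  \<open>raw\<close> agree on the square.\<close>

lemma recon_rate:
  assumes \<phi>: "\<phi> \<in> L1_space {0<..<1}" "nondegenerate_near_1 \<phi>" and f: "f \<in> H1_space unit_square"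
  shows "\<forall>\<^sub>F e in at_right 0. error_at_most f \<phi> e (recon e) (4 / pi * ((L1_norm unit_square f)\<^sup>2 * e powr (1 / 8)))"
proof -
  have fL: "f \<in> sq_L2" using f by (simp add: H1_space_def)
  obtain C where C: "0 \<le> C" and ev: "\<forall>\<^sub>F e in at_right 0. error_at_most f \<phi> e (raw e) (C * e powr (1 / 4))"
    using raw_rate[OF \<phi> f] .
  have small: "\<forall>\<^sub>F e in at_right 0. C * e powr (1 / 4) \<le> d * e powr (1 / 8)" if d: "0 < d" for d
  proof -
    have "((\<lambda>e::real. C * e powr (1 / 8)) \<longlongrightarrow> C * 0) (at_right 0)"
      by (intro tendsto_mult tendsto_const) real_asymp
    then have "\<forall>\<^sub>F e in at_right 0. C * e powr (1 / 8) < d"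
      by (rule order_tendstoD) (use d in simp)
    then show ?thesis
    proof eventually_elim
      case (elim e)
      have "C * e powr (1 / 4) = (C * e powr (1 / 8)) * e powr (1 / 8)"
        by (simp flip: powr_add)
      also have "\<dots> \<le> d * e powr (1 / 8)" using elim by (intro mult_right_mono) auto
      finally show ?case .
    qed
  qed
  show ?thesis
  proof (cases "sq_norm f = 0")
    case True
    show ?thesis using ev small[OF zero_less_one]
    proof eventually_elim
      case (elim e)
      show ?case
        unfolding error_at_most_def
      proof (intro allI impI)
        fix g0 g1 h0 h1 \<psi>
        assume data: "g0 \<in> sq_L2" "g1 \<in> sq_L2" "consistent f \<phi> g0 g1"
          "close_data e g0 g1 \<phi> h0 h1 \<psi>"
        then have "(sq_norm (\<lambda>z. raw e h0 h1 \<psi> z - f z))\<^sup>2 \<le> e powr (1 / 8)"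
          using error_at_mostD[OF elim(1) data] elim(2) by simp
        moreover have "sq_norm (raw e h0 h1 \<psi>) \<le> sq_norm (\<lambda>z. raw e h0 h1 \<psi> z - f z)"
          using L2_norm_diff_triangle[OF L2_raw fL L2_zero, of e h0 h1 \<psi>] True by simp
        then have "(sq_norm (raw e h0 h1 \<psi>))\<^sup>2 \<le> (sq_norm (\<lambda>z. raw e h0 h1 \<psi> z - f z))\<^sup>2"
          by (intro power_mono L2_norm_nonneg)
        ultimately have "recon e h0 h1 \<psi> = (\<lambda>z. 0)" by (simp add: recon_cases)
        then have "sq_norm (\<lambda>z. recon e h0 h1 \<psi> z - f z) = 0" using True by (simp add: L2_norm_def)
        then show "(sq_norm (\<lambda>z. recon e h0 h1 \<psi> z - f z))\<^sup>2 \<le> 4 / pi * ((L1_norm unit_square f)\<^sup>2 * e powr (1 / 8))"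
          by simp
      qed
    qed
  next
    case False
    then have F: "0 < sq_norm f" using L2_norm_nonneg[of unit_square f] by simp
    have L1: "0 < L1_norm unit_square f"
    proof (rule ccontr)
      assume "\<not> 0 < L1_norm unit_square f"
      moreover have "0 \<le> L1_norm unit_square f" by (simp add: L1_norm_def)
      ultimately have "L1_norm unit_square f = 0" by linarith
      then have "(LINT z|sq. \<bar>f z\<bar>) = 0" unfolding L1_norm_def .
      then have "AE z in sq. \<bar>f z\<bar> = 0"
        using L2_integrable[OF lmeasurable_sq fL] by (subst (asm) integral_nonneg_eq_0_iff_AE) auto
      then have "AE z in sq. f z = 0" by simp
      from L2_norm_cong_AE[OF this L2_spaceD(1)[OF fL]] have "sq_norm f = 0" by (simp add: L2_norm_def)
      then show False using F by simp
    qed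
    define d where "d = 4 / pi * (L1_norm unit_square f)\<^sup>2"
    have d: "0 < d" using L1 by (simp add: d_def)
    \<comment> \<open>For such e the error of \<open>raw\<close> plus the square root of the
      threshold stays below the norm of f, which forces \<open>raw\<close> past the
      threshold.\<close>
    have "((\<lambda>e::real. sqrt (e powr (1 / 8)) + sqrt (C * e powr (1 / 4))) \<longlongrightarrow> sqrt 0 + sqrt (C * 0)) (at_right 0)"
      by (intro tendsto_add tendsto_real_sqrt tendsto_mult tendsto_const; real_asymp)
    then have "\<forall>\<^sub>F e in at_right 0. sqrt (e powr (1 / 8)) + sqrt (C * e powr (1 / 4)) < sq_norm f"
      by (rule order_tendstoD) (use F in simp)
    then show ?thesis using ev small[OF d]
    proof eventually_elim
      case (elim e)
      show ?case
        unfolding error_at_most_def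
      proof (intro allI impI)
        fix g0 g1 h0 h1 \<psi>
        assume data: "g0 \<in> sq_L2" "g1 \<in> sq_L2" "consistent f \<phi> g0 g1"
          "close_data e g0 g1 \<phi> h0 h1 \<psi>"
        then have e: "(sq_norm (\<lambda>z. raw e h0 h1 \<psi> z - f z))\<^sup>2 \<le> C * e powr (1 / 4)"
          by (intro error_at_mostD[OF elim(2)])
        have "sq_norm f \<le> sq_norm (\<lambda>z. raw e h0 h1 \<psi> z - f z) + sq_norm (raw e h0 h1 \<psi>)"
          using L2_norm_diff_triangle[OF fL L2_raw L2_zero, of e h0 h1 \<psi>]
          by (simp add: L2_norm_minus_commute[of _ f])
        moreover have "sq_norm (\<lambda>z. raw e h0 h1 \<psi> z - f z) \<le> sqrt (C * e powr (1 / 4))"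
          using e by (rule real_le_rsqrt)
        ultimately have "sqrt (e powr (1 / 8)) < sq_norm (raw e h0 h1 \<psi>)" using elim by linarith
        then have "(sqrt (e powr (1 / 8)))\<^sup>2 < (sq_norm (raw e h0 h1 \<psi>))\<^sup>2"
          by (intro power_strict_mono) auto
        then have "e powr (1 / 8) < (sq_norm (raw e h0 h1 \<psi>))\<^sup>2" by simp
        then have "recon e h0 h1 \<psi> z = raw e h0 h1 \<psi> z" if "z \<in> unit_square" for z
          using that by (simp add: recon_def)
        then have "sq_norm (\<lambda>z. recon e h0 h1 \<psi> z - f z) = sq_norm (\<lambda>z. raw e h0 h1 \<psi> z - f z)"
          unfolding L2_norm_def by (intro arg_cong[where f = sqrt] LINT_cong) simp_all
        then show "(sq_norm (\<lambda>z. recon e h0 h1 \<psi> z - f z))\<^sup>2 \<le> 4 / pi * ((L1_norm unit_square f)\<^sup>2 * e powr (1 / 8))"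
          using e elim(3) unfolding d_def by (simp add: mult.assoc)
      qed
    qed
  qed
qed

text \<open>The threshold \<epsilon>0 has to be chosen before f. If u admits a source in H1 at all,
  one such source f0 is fixed; by \<open>source_unique\<close> any other equals it almost
  everywhere, so norms, coefficients and errors coincide and the threshold found for f0 serves them
  all.\<close>

lemma recon_rate_solution:
  assumes \<phi>: "\<phi> \<in> L1_space {0<..<1}" "nondegenerate_near_1 \<phi>"
  shows "\<exists>\<epsilon>0\<in>{0<..<1}. \<forall>f\<in>H1_space unit_square. \<forall>g0\<in>sq_L2. \<forall>g1\<in>sq_L2.
         \<forall>g0e g1e \<phi>e.
           solves_source_problem u f \<phi> g0 g1 \<longrightarrow> noisy_data g0 g1 \<phi> g0e g1e \<phi>e \<longrightarrow>
           (\<forall>e\<in>{0<..<\<epsilon>0}.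
              (sq_norm (\<lambda>z. recon e (g0e e) (g1e e) (\<phi>e e) z - f z))\<^sup>2
                \<le> 4 / pi * ((L1_norm unit_square f)\<^sup>2 * e powr (1 / 8)
                              + 9 * (H1_norm unit_square f)\<^sup>2 * e powr (1 / 6)))"
proof (cases "\<exists>f\<in>H1_space unit_square. \<exists>g0\<in>sq_L2. \<exists>g1\<in>sq_L2.
    solves_source_problem u f \<phi> g0 g1")
  case False
  \<comment> \<open>Without any such source the claim is vacuous.\<close>
  then show ?thesis by (intro bexI[of _ "1/2"]) auto
next
  case True
  then obtain f0 k0 k1 where f0: "f0 \<in> H1_space unit_square" and k: "k0 \<in> sq_L2" "k1 \<in> sq_L2"
    and sol0: "solves_source_problem u f0 \<phi> k0 k1" by blast
  have f0L: "f0 \<in> sq_L2" using f0 by (simp add: H1_space_def)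
  obtain b where b: "0 < b" and rate: "\<forall>e>0. e < b \<longrightarrow>
      error_at_most f0 \<phi> e (recon e) (4 / pi * ((L1_norm unit_square f0)\<^sup>2 * e powr (1 / 8)))"
    using recon_rate[OF \<phi> f0] unfolding eventually_at_right_field by (elim exE conjE)
  show ?thesis
  proof (intro bexI[of _ "min b (1/2)"] ballI allI impI)
    show "min b (1/2) \<in> {0<..<1}" using b by auto
    fix f g0 g1 g0e g1e \<phi>e e
    assume f: "f \<in> H1_space unit_square" and g: "g0 \<in> sq_L2" "g1 \<in> sq_L2"
      and sol: "solves_source_problem u f \<phi> g0 g1" and noisy: "noisy_data g0 g1 \<phi> g0e g1e \<phi>e"
      and e: "e \<in> {0<..<min b (1/2)}"
    have fL: "f \<in> sq_L2" using f by (simp add: H1_space_def)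
    have ae: "AE z in sq. f z = f0 z" by (rule source_unique[OF \<phi> sol sol0 g k])
    have "coef f \<alpha> n = coef f0 \<alpha> n" for \<alpha> n
      by (rule coef_cong_AE[OF ae L2_spaceD(1)[OF fL] L2_spaceD(1)[OF f0L]])
    then have cons: "consistent f0 \<phi> g0 g1"
      using source_problem_consistent[OF sol \<phi>(1) g] by (simp add: consistent_def)
    let ?R = "recon e (g0e e) (g1e e) (\<phi>e e)"
    have "sq_norm (\<lambda>z. ?R z - f z) = sq_norm (\<lambda>z. ?R z - f0 z)"
      using ae by (intro L2_norm_cong_AE L2_spaceD(1) L2_diff L2_recon fL f0L) (auto elim: eventually_mono)
    moreover have "L1_norm unit_square f = L1_norm unit_square f0"
      unfolding L1_norm_def using ae L2_spaceD(1)[OF fL] L2_spaceD(1)[OF f0L]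
      by (intro integral_cong_AE) (auto elim: eventually_mono)
    moreover have "(sq_norm (\<lambda>z. ?R z - f0 z))\<^sup>2 \<le> 4 / pi * ((L1_norm unit_square f0)\<^sup>2 * e powr (1 / 8))"
      using e rate by (intro error_at_mostD[OF _ g cons noisy_data_close[OF noisy]]) auto
    moreover have "0 \<le> 9 * (H1_norm unit_square f)\<^sup>2 * e powr (1 / 6)" by simp
    then have "4 / pi * ((L1_norm unit_square f)\<^sup>2 * e powr (1 / 8))
        \<le> 4 / pi * ((L1_norm unit_square f)\<^sup>2 * e powr (1 / 8) + 9 * (H1_norm unit_square f)\<^sup>2 * e powr (1 / 6))"
      by (intro mult_left_mono) auto
    ultimately show "(sq_norm (\<lambda>z. ?R z - f z))\<^sup>2
        \<le> 4 / pi * ((L1_norm unit_square f)\<^sup>2 * e powr (1 / 8) + 9 * (H1_norm unit_square f)\<^sup>2 * e powr (1 / 6))"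
      by simp
  qed
qed

theorem theorem3:
  shows "\<exists>R :: real \<Rightarrow> (real \<times> real \<Rightarrow> real) \<Rightarrow> (real \<times> real \<Rightarrow> real) \<Rightarrow> (real \<Rightarrow> real)
                \<Rightarrow> (real \<times> real \<Rightarrow> real).
    (\<forall>\<epsilon>\<in>{0<..<1}. reconstruction_map (R \<epsilon>)) \<and>
    (\<forall>\<phi>\<in>L1_space {0<..<1}. nondegenerate_near_1 \<phi> \<longrightarrow>
      (\<forall>u f. \<forall>g0\<in>L2_space unit_square. \<forall>g1\<in>L2_space unit_square. \<forall>g0e g1e \<phi>e.
         solves_source_problem u f \<phi> g0 g1 \<longrightarrow> noisy_data g0 g1 \<phi> g0e g1e \<phi>e \<longrightarrow>
         ((\<lambda>\<epsilon>. L2_norm unit_square (\<lambda>z. R \<epsilon> (g0e \<epsilon>) (g1e \<epsilon>) (\<phi>e \<epsilon>) z - f z)) \<longlongrightarrow> 0) (at_right 0)) \<and>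
      (\<exists>\<gamma>>0. \<forall>u. \<exists>\<epsilon>0\<in>{0<..<1}.
         \<forall>f\<in>H1_space unit_square. \<forall>g0\<in>L2_space unit_square. \<forall>g1\<in>L2_space unit_square.
         \<forall>g0e g1e \<phi>e.
           solves_source_problem u f \<phi> g0 g1 \<longrightarrow> noisy_data g0 g1 \<phi> g0e g1e \<phi>e \<longrightarrow>
           (\<forall>\<epsilon>\<in>{0<..<\<epsilon>0}.
              (L2_norm unit_square (\<lambda>z. R \<epsilon> (g0e \<epsilon>) (g1e \<epsilon>) (\<phi>e \<epsilon>) z - f z))\<^sup>2
                \<le> 4 / pi * ((L1_norm unit_square f)\<^sup>2 * \<epsilon> powr \<gamma>
                              + 9 * (H1_norm unit_square f)\<^sup>2 * \<epsilon> powr (1 / 6)))))"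
proof (intro exI[of _ recon] conjI ballI impI allI)
  show "reconstruction_map (recon \<epsilon>)" for \<epsilon> by (rule reconstruction_map_recon)
next
  fix \<phi> u f g0 g1 g0e g1e \<phi>e
  assume *: "\<phi> \<in> L1_space {0<..<1}" "nondegenerate_near_1 \<phi>" "g0 \<in> sq_L2" "g1 \<in> sq_L2"
    "solves_source_problem u f \<phi> g0 g1" "noisy_data g0 g1 \<phi> g0e g1e \<phi>e"
  then have "f \<in> sq_L2" by (simp add: solves_source_problem_def)
  then show "((\<lambda>\<epsilon>. sq_norm (\<lambda>z. recon \<epsilon> (g0e \<epsilon>) (g1e \<epsilon>) (\<phi>e \<epsilon>) z - f z)) \<longlongrightarrow> 0) (at_right 0)"
    by (rule recon_converges[OF *(1,2) _ *(3,4) source_problem_consistent[OF *(5,1,3,4)] *(6)])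
\<comment> \<open>The exponent 1/8 is the power of \<epsilon> at which \<open>recon\<close> sets its
  threshold.\<close>
qed (rule exI[of _ "1 / 8"], rule conjI, simp, rule allI, rule recon_rate_solution)

end
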